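(* Let $(M,\omega)$ be a connected symplectic manifold and $X$ a displaceable compact subset of $M$. Let $n$ be a positive integer and let $e=(e_1,\ldots,e_n)\in\mathbb{Z}^n$ and $R=(R_1,\ldots,R_n)\in(\mathbb{R}_{>0})^n$ be such that $R_k\cdot|e_k|>E(X)$ for some $k$. Then $C(M,X,R;e)=\infty$.
   Context: Conventions. $S^1=\mathbb{R}/\mathbb{Z}$, $T^n=(\mathbb{R}/\mathbb{Z})^n$. The Hamiltonian vector field is defined by $\omega(X_H,V)=-dH(V)$; for compactly supported $H\colon S^1\times N\to\mathbb{R}$, $H_t=H(t,\cdot)$, and $\{\phi_H^t\}$ is the isotopy generated by $X_H^t=X_{H_t}$ with $\phi_H^0=\mathrm{id}$. For $\alpha\in[S^1,N]$, $\mathcal{P}(H;\alpha)$ is the set of smooth loops $z\colon S^1\to N$ in the free homotopy class $\alpha$ with $\dot z(t)=X_H^t(z(t))$. A subset $X\subset M$ is displaceable if $\bar X\cap\phi_H^1(X)=\emptyset$ for some compactly supported $H\colon S^1\times M\to\mathbb{R}$ ($\bar X$ is the closure). The Hofer length of $H\in C_c^\infty(S^1\times M)$ is $\|H\|=\int_0^1\|H_t\|_{C^0}\,dt$, with $\|H_t\|_{C^0}=\max|H_t|$, and the displacement energy is $E(X)=\inf\{\|H\| : H\in C_c^\infty(S^1\times M),\ \bar X\cap\phi_H^1(X)=\emptyset\}$. The capacity. For a compact subset $Y$ of an open symplectic manifold $N$ and $\alpha\in[S^1,N]$, $C_{BPS}(N,Y;\alpha)=\inf\{K>0 : \mathcal{P}(H;\alpha)\ne\emptyset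 \text{ for all } H\in C_c^\infty(S^1\times N)\text{ with }\inf_{S^1\times Y}H\ge K\}$ (with $\inf\emptyset=+\infty$). Let $I_R^n=\{p\in\mathbb{R}^n:|p_i|<R_i\ \forall i\}$, let $\omega_0=\sum_i dp_i\wedge dq_i$ on $I_R^n\times T^n$, and equip $M\times I_R^n\times T^n$ with $\mathrm{pr}_1^*\omega+\mathrm{pr}_2^*\omega_0$ ($\mathrm{pr}_1,\mathrm{pr}_2$ the projections to $M$ and $I_R^n\times T^n$). Then $C(M,X,R;e)=C_{BPS}(M\times I_R^n\times T^n,\ X\times T^n;\ (0_M,e))$, where $X\times T^n$ means $X\times\{0\}\times T^n$ and $(0_M,e)$ is the class of loops with contractible $M$-component and $T^n$-component of class $e$. *)

theory Defs
  imports "HOL-Analysis.Analysis"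
begin

section \<open>Smooth maps between Euclidean spaces\<close>

text \<open>Only used for open sets \<open>S\<close>; \<open>Ck_on k S f\<close> says that all iterated directional
  derivatives of order at most \<open>k\<close> exist and are continuous on \<open>S\<close>.\<close>

primrec Ck_on ::
  "nat \<Rightarrow> 'a::real_normed_vector set \<Rightarrow> ('a \<Rightarrow> 'b::real_normed_vector) \<Rightarrow> bool"
where
  "Ck_on 0 S f \<longleftrightarrow> continuous_on S f"
| "Ck_on (Suc k) S f \<longleftrightarrow>
     (\<forall>x\<in>S. f differentiable (at x)) \<and> (\<forall>v. Ck_on k S (\<lambda>x. frechet_derivative f (at x) v))"

definition smooth_on ::
  "'a::real_normed_vector set \<Rightarrow> ('a \<Rightarrow> 'b::real_normed_vector) \<Rightarrow> bool"
  where "smooth_on S f \<longleftrightarrow> (\<forall>k. Ck_on k S f)"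

section \<open>Smooth manifolds\<close>

text \<open>A chart is a pair of its domain and its coordinate map; values of the coordinate map
  outside the domain are irrelevant. The underlying set of a manifold is the \<open>topspace\<close> of its
  topology, and its smooth structure is the one generated by the given atlas.\<close>

type_synonym ('a, 'e) chart = "'a set \<times> ('a \<Rightarrow> 'e)"

record ('a, 'e) mfd =
  mtop :: "'a topology"
  atlas :: "('a, 'e) chart set"

definition chart_inv :: "('a, 'e) chart \<Rightarrow> 'e \<Rightarrow> 'a"
  where "chart_inv c = inv_into (fst c) (snd c)"

definition chart_image :: "('a, 'e) chart \<Rightarrow> 'e set"
  where "chart_image c = snd c ` fst c"

definition smooth_manifold :: "('a, 'e::euclidean_space) mfd \<Rightarrow> bool"
  where "smooth_manifold M \<longleftrightarrow>
    Hausdorff_space (mtop M) \<and> second_countable (mtop M) \<and>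
    (\<Union>c\<in>atlas M. fst c) = topspace (mtop M) \<and>
    (\<forall>c\<in>atlas M. openin (mtop M) (fst c) \<and> open (chart_image c) \<and>
       homeomorphic_map (subtopology (mtop M) (fst c)) (top_of_set (chart_image c)) (snd c)) \<and>
    (\<forall>c\<in>atlas M. \<forall>d\<in>atlas M. smooth_on (snd c ` (fst c \<inter> fst d)) (snd d \<circ> chart_inv c))"

definition smooth_map ::
  "('a, 'e::euclidean_space) mfd \<Rightarrow> ('b, 'f::euclidean_space) mfd \<Rightarrow> ('a \<Rightarrow> 'b) \<Rightarrow> bool"
  where "smooth_map M N f \<longleftrightarrow>
    continuous_map (mtop M) (mtop N) f \<and>
    (\<forall>c\<in>atlas M. \<forall>d\<in>atlas N.
       smooth_on (snd c ` (fst c \<inter> f -` fst d)) (snd d \<circ> f \<circ> chart_inv c))"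

definition prod_mfd :: "('a, 'e) mfd \<Rightarrow> ('b, 'f) mfd \<Rightarrow> ('a \<times> 'b, 'e \<times> 'f) mfd"
  where "prod_mfd M N =
    \<lparr>mtop = prod_topology (mtop M) (mtop N),
     atlas = {(fst c \<times> fst d, map_prod (snd c) (snd d)) | c d. c \<in> atlas M \<and> d \<in> atlas N}\<rparr>"

text \<open>An open subset of Euclidean space.\<close>

definition open_mfd :: "'e::euclidean_space set \<Rightarrow> ('e, 'e) mfd"
  where "open_mfd S = \<lparr>mtop = top_of_set S, atlas = {(S, id)}\<rparr>"

section \<open>The circle and the torus\<close>

quotient_type circle = real / "\<lambda>x y :: real. x - y \<in> \<int>"
proof (rule equivpI)
  show "reflp (\<lambda>x y :: real. x - y \<in> \<int>)"
    by (auto intro: reflpI)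
  show "symp (\<lambda>x y :: real. x - y \<in> \<int>)"
    by (metis Ints_minus minus_diff_eq sympI)
  show "transp (\<lambda>x y :: real. x - y \<in> \<int>)"
  proof (rule transpI)
    fix x y z :: real
    assume "x - y \<in> \<int>" "y - z \<in> \<int>"
    then have "(x - y) + (y - z) \<in> \<int>" by (rule Ints_add)
    then show "x - z \<in> \<int>" by simp
  qed
qed

lift_definition circle_of :: "real \<Rightarrow> circle" is "\<lambda>x. x" .

text \<open>The quotient topology.\<close>

instantiation circle :: topological_space
begin

definition open_circle :: "circle set \<Rightarrow> bool"
  where "open_circle U \<longleftrightarrow> open (circle_of -` U)"

instance
  by standard (auto simp: open_circle_def vimage_Union)

end

lift_definition circle_mult :: "int \<Rightarrow> circle \<Rightarrow> circle" is "\<lambda>k x. of_int k * x"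
proof -
  fix k :: int and x y :: real
  assume "x - y \<in> \<int>"
  then have "of_int k * (x - y) \<in> \<int>" by (intro Ints_mult) auto
  then show "of_int k * x - of_int k * y \<in> \<int>" by (simp add: algebra_simps)
qed

definition circle_mfd :: "(circle, real) mfd"
  where "circle_mfd =
    \<lparr>mtop = euclidean,
     atlas = {(circle_of ` {a<..<a+1}, inv_into {a<..<a+1} circle_of) | a. True}\<rparr>"

definition torus_of :: "real ^ 'n \<Rightarrow> circle ^ 'n"
  where "torus_of x = (\<chi> i. circle_of (x $ i))"

definition unit_box :: "real ^ 'n \<Rightarrow> (real ^ 'n) set"
  where "unit_box a = {x. \<forall>i. a $ i < x $ i \<and> x $ i < a $ i + 1}"

definition torus_mfd :: "(circle ^ 'n, real ^ 'n) mfd"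
  where "torus_mfd =
    \<lparr>mtop = euclidean,
     atlas = {(torus_of ` unit_box a, inv_into (unit_box a) torus_of) | a. True}\<rparr>"

section \<open>Symplectic forms\<close>

text \<open>A 2-form is given by its local representatives: \<open>\<omega> c x v w\<close> is the value, at the point
  with coordinates \<open>x\<close> in the chart \<open>c\<close>, on the tangent vectors with coordinates \<open>v\<close> and \<open>w\<close>.
  The second conjunct below is the transformation law which makes the local representatives a
  globally defined object.\<close>

type_synonym ('a, 'e) form2 = "('a, 'e) chart \<Rightarrow> 'e \<Rightarrow> 'e \<Rightarrow> 'e \<Rightarrow> real"

definition smooth_2form :: "('a, 'e::euclidean_space) mfd \<Rightarrow> ('a, 'e) form2 \<Rightarrow> bool"
  where "smooth_2form M \<omega> \<longleftrightarrow>
    (\<forall>c\<in>atlas M.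
       (\<forall>x\<in>chart_image c. bilinear (\<omega> c x) \<and> (\<forall>v. \<omega> c x v v = 0)) \<and>
       (\<forall>v w. smooth_on (chart_image c) (\<lambda>x. \<omega> c x v w))) \<and>
    (\<forall>c\<in>atlas M. \<forall>d\<in>atlas M. \<forall>p\<in>fst c \<inter> fst d.
       let D = frechet_derivative (snd d \<circ> chart_inv c) (at (snd c p))
       in \<forall>v w. \<omega> c (snd c p) v w = \<omega> d (snd d p) (D v) (D w))"

definition closed_2form :: "('a, 'e::euclidean_space) mfd \<Rightarrow> ('a, 'e) form2 \<Rightarrow> bool"
  where "closed_2form M \<omega> \<longleftrightarrow>
    (\<forall>c\<in>atlas M. \<forall>x\<in>chart_image c. \<forall>u v w.
       frechet_derivative (\<lambda>y. \<omega> c y v w) (at x) u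
     + frechet_derivative (\<lambda>y. \<omega> c y w u) (at x) v
     + frechet_derivative (\<lambda>y. \<omega> c y u v) (at x) w = 0)"

definition nondegenerate_2form :: "('a, 'e::euclidean_space) mfd \<Rightarrow> ('a, 'e) form2 \<Rightarrow> bool"
  where "nondegenerate_2form M \<omega> \<longleftrightarrow>
    (\<forall>c\<in>atlas M. \<forall>x\<in>chart_image c. \<forall>v. v \<noteq> 0 \<longrightarrow> (\<exists>w. \<omega> c x v w \<noteq> 0))"

definition symplectic_manifold :: "('a, 'e::euclidean_space) mfd \<Rightarrow> ('a, 'e) form2 \<Rightarrow> bool"
  where "symplectic_manifold M \<omega> \<longleftrightarrow>
    smooth_manifold M \<and> smooth_2form M \<omega> \<and> closed_2form M \<omega> \<and> nondegenerate_2form M \<omega>"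

text \<open>The representative of \<open>f\<^sup>*\<omega>\<close> in a chart \<open>c\<close> of the source is computed with some chart \<open>d\<close>
  of the target around \<open>f p\<close>; by the transformation law the choice does not matter.\<close>

definition pullback_2form ::
  "('b, 'f::euclidean_space) mfd \<Rightarrow> ('a \<Rightarrow> 'b) \<Rightarrow> ('b, 'f) form2 \<Rightarrow> ('a, 'e::euclidean_space) form2"
  where "pullback_2form N f \<omega> c x v w =
    (let p = chart_inv c x;
         d = (SOME d. d \<in> atlas N \<and> f p \<in> fst d);
         D = frechet_derivative (snd d \<circ> f \<circ> chart_inv c) (at x)
     in \<omega> d (snd d (f p)) (D v) (D w))"

definition sum_symplectic ::
  "('a, 'e::euclidean_space) mfd \<Rightarrow> ('a, 'e) form2 \<Rightarrow>
   ('b, 'f::euclidean_space) mfd \<Rightarrow> ('b, 'f) form2 \<Rightarrow> ('a \<times> 'b, 'e \<times> 'f) form2"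
  where "sum_symplectic M \<omega> N \<sigma> c x v w =
    pullback_2form M fst \<omega> c x v w + pullback_2form N snd \<sigma> c x v w"

section \<open>Hamiltonian dynamics\<close>

definition Cc_smooth :: "('a, 'e::euclidean_space) mfd \<Rightarrow> ('a \<Rightarrow> real) set"
  where "Cc_smooth M = {f. smooth_map M (open_mfd UNIV) f \<and>
    compactin (mtop M) (mtop M closure_of {p \<in> topspace (mtop M). f p \<noteq> 0})}"

definition ham_vf :: "('a, 'e::euclidean_space) form2 \<Rightarrow> ('a \<Rightarrow> real) \<Rightarrow> ('a, 'e) chart \<Rightarrow> 'e \<Rightarrow> 'e"
  where "ham_vf \<omega> h c x =
    (THE v. \<forall>w. \<omega> c x v w = - frechet_derivative (h \<circ> chart_inv c) (at x) w)"

definition ham_curve ::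
  "('a, 'e::euclidean_space) mfd \<Rightarrow> ('a, 'e) form2 \<Rightarrow> (circle \<times> 'a \<Rightarrow> real) \<Rightarrow> (real \<Rightarrow> 'a) \<Rightarrow> bool"
  where "ham_curve M \<omega> H \<gamma> \<longleftrightarrow>
    continuous_map euclideanreal (mtop M) \<gamma> \<and>
    (\<forall>t. \<forall>c\<in>atlas M. \<gamma> t \<in> fst c \<longrightarrow>
       (snd c \<circ> \<gamma> has_vector_derivative
          ham_vf \<omega> (\<lambda>p. H (circle_of t, p)) c (snd c (\<gamma> t))) (at t))"

text \<open>\<open>ham_flow M \<omega> H t\<close> is the isotopy \<open>\<phi>\<^sub>H\<^sup>t\<close>.\<close>

definition ham_flow ::
  "('a, 'e::euclidean_space) mfd \<Rightarrow> ('a, 'e) form2 \<Rightarrow> (circle \<times> 'a \<Rightarrow> real) \<Rightarrow> real \<Rightarrow> 'a \<Rightarrow> 'a"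
  where "ham_flow M \<omega> H t p = (THE \<gamma>. ham_curve M \<omega> H \<gamma> \<and> \<gamma> 0 = p) t"

text \<open>A free homotopy class is represented by the set \<open>\<alpha>\<close> of the loops belonging to it.\<close>

definition periodic_orbits ::
  "('a, 'e::euclidean_space) mfd \<Rightarrow> ('a, 'e) form2 \<Rightarrow> (circle \<times> 'a \<Rightarrow> real) \<Rightarrow>
   (circle \<Rightarrow> 'a) set \<Rightarrow> (circle \<Rightarrow> 'a) set"
  where "periodic_orbits M \<omega> H \<alpha> =
    {z \<in> \<alpha>. smooth_map circle_mfd M z \<and> ham_curve M \<omega> H (z \<circ> circle_of)}"

section \<open>Displacement energy\<close>

definition displaces ::
  "('a, 'e::euclidean_space) mfd \<Rightarrow> ('a, 'e) form2 \<Rightarrow> (circle \<times> 'a \<Rightarrow> real) \<Rightarrow> 'a set \<Rightarrow> bool"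
  where "displaces M \<omega> H X \<longleftrightarrow> (mtop M closure_of X) \<inter> ham_flow M \<omega> H 1 ` X = {}"

definition displaceable :: "('a, 'e::euclidean_space) mfd \<Rightarrow> ('a, 'e) form2 \<Rightarrow> 'a set \<Rightarrow> bool"
  where "displaceable M \<omega> X \<longleftrightarrow> (\<exists>H\<in>Cc_smooth (prod_mfd circle_mfd M). displaces M \<omega> H X)"

definition hofer_length :: "('a, 'e) mfd \<Rightarrow> (circle \<times> 'a \<Rightarrow> real) \<Rightarrow> real"
  where "hofer_length M H =
    integral {0..1} (\<lambda>t. SUP p\<in>topspace (mtop M). \<bar>H (circle_of t, p)\<bar>)"

definition displacement_energy ::
  "('a, 'e::euclidean_space) mfd \<Rightarrow> ('a, 'e) form2 \<Rightarrow> 'a set \<Rightarrow> ereal"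
  where "displacement_energy M \<omega> X =
    Inf {ereal (hofer_length M H) | H.
           H \<in> Cc_smooth (prod_mfd circle_mfd M) \<and> displaces M \<omega> H X}"

section \<open>The capacity\<close>

definition C_BPS ::
  "('a, 'e::euclidean_space) mfd \<Rightarrow> ('a, 'e) form2 \<Rightarrow> 'a set \<Rightarrow> (circle \<Rightarrow> 'a) set \<Rightarrow> ereal"
  where "C_BPS N \<omega> Y \<alpha> =
    Inf {ereal K | K. K > 0 \<and>
      (\<forall>H\<in>Cc_smooth (prod_mfd circle_mfd N).
         (INF x\<in>UNIV \<times> Y. ereal (H x)) \<ge> ereal K \<longrightarrow> periodic_orbits N \<omega> H \<alpha> \<noteq> {})}"

definition open_cube :: "real ^ 'n \<Rightarrow> (real ^ 'n) set"
  where "open_cube R = {p. \<forall>i. \<bar>p $ i\<bar> < R $ i}"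

definition cotangent_mfd ::
  "real ^ 'n \<Rightarrow> ((real ^ 'n) \<times> (circle ^ 'n), (real ^ 'n) \<times> (real ^ 'n)) mfd"
  where "cotangent_mfd R = prod_mfd (open_mfd (open_cube R)) torus_mfd"

text \<open>All charts of \<open>cotangent_mfd R\<close> have coordinates \<open>(p, q)\<close>, with \<open>q\<close> a local lift to
  \<open>\<real>\<^sup>n\<close>; so \<open>\<Sum>\<^sub>i dp\<^sub>i \<and> dq\<^sub>i\<close> has the same constant representative in each of them.\<close>

definition omega0 :: "((real ^ 'n) \<times> (circle ^ 'n), (real ^ 'n) \<times> (real ^ 'n)) form2"
  where "omega0 c x v w = (\<Sum>i\<in>UNIV. fst v $ i * snd w $ i - fst w $ i * snd v $ i)"

text \<open>The free homotopy class \<open>(0\<^sub>M, e)\<close>; the integer vector \<open>e\<close> stands for the class of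
  \<open>t \<mapsto> (e\<^sub>1 t, \<dots>, e\<^sub>n t)\<close>.\<close>

definition loop_class ::
  "('a, 'e) mfd \<Rightarrow> real ^ 'n \<Rightarrow> int ^ 'n \<Rightarrow> (circle \<Rightarrow> 'a \<times> (real ^ 'n) \<times> (circle ^ 'n)) set"
  where "loop_class M R e = {z.
    continuous_map euclidean (prod_topology (mtop M) (mtop (cotangent_mfd R))) z \<and>
    (\<exists>m\<in>topspace (mtop M).
       homotopic_with (\<lambda>_. True) euclidean (mtop M) (\<lambda>t. fst (z t)) (\<lambda>_. m)) \<and>
    homotopic_with (\<lambda>_. True) euclidean (mtop torus_mfd)
      (\<lambda>t. snd (snd (z t))) (\<lambda>t. \<chi> i. circle_mult (e $ i) t)}"

definition C_torus ::
  "('a, 'e::euclidean_space) mfd \<Rightarrow> ('a, 'e) form2 \<Rightarrow> 'a set \<Rightarrow> real ^ 'n \<Rightarrow> int ^ 'n \<Rightarrow> ereal"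
  where "C_torus M \<omega> X R e =
    C_BPS (prod_mfd M (cotangent_mfd R)) (sum_symplectic M \<omega> (cotangent_mfd R) omega0)
      (X \<times> {0} \<times> UNIV) (loop_class M R e)"

end

theory Submission
  imports Defs "HOL-Complex_Analysis.Winding_Numbers"
begin

text \<open>
  Let \<open>H\<close> displace \<open>X\<close> with \<open>\<parallel>H\<parallel> < R\<^sub>k \<bar>e\<^sub>k\<bar>\<close>, run its flow during a short part \<open>[0, \<epsilon>]\<close> of the period, i.e. replace
  it by \<open>a'(t) H\<^bsub>a(t)\<^esub>\<close>, and put
  \<open>F\<^sub>t(x, p, q) = \<lambda>(p) (K\<^sub>1 b(x) + B (a'(t) - 1) \<theta>(x)) + \<chi>(p) a'(t) H\<^bsub>a(t)\<^esub>(x).\<close>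
  Here \<open>b\<close> is a bump function around \<open>X\<close>, \<open>\<theta>\<close> is a cutoff function that equals \<open>1\<close> around the supports of
  \<open>b\<close> and \<open>H\<close>, \<open>B \<ge> max \<bar>H\<bar>\<close> and \<open>K\<^sub>1 = K + B\<close>; \<open>\<chi>\<close> is \<open>1\<close> near \<open>p = 0\<close>, has compact support in the cube
  and slope barely larger than \<open>1 / R\<^sub>k\<close> in the direction \<open>p\<^sub>k\<close>, and \<open>\<lambda>\<close> is a bump function on the plateau of
  \<open>\<chi>\<close>. Then \<open>F \<ge> K\<close> on \<open>X \<times> {0} \<times> T\<^sup>n\<close> at all times: the \<open>\<theta>\<close>-term makes up for negative values of the fast
  Hamiltonian, and as \<open>a' - 1\<close> has mean \<open>0\<close> and \<open>\<theta>\<close> is conserved, it contributes nothing to the total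
  advance of \<open>q\<close> along an orbit.

  The momentum \<open>p\<close> is constant along orbits, and \<open>q\<^sub>k\<close> advances by \<open>\<integral> \<partial>F/\<partial>p\<^sub>k dt\<close>, which is \<open>e\<^sub>k\<close> for a closed
  orbit in the class \<open>(0, e)\<close>. Off the plateau of \<open>\<chi>\<close> this integral is at most \<open>max \<bar>\<partial>\<^sub>k\<chi>\<bar> \<parallel>H\<parallel> < \<bar>e\<^sub>k\<bar>\<close>. On
  the plateau it is \<open>\<partial>\<^sub>k\<lambda> \<integral> K\<^sub>1 b(x(t)) dt\<close>. During \<open>[0, \<epsilon>]\<close> the term \<open>K\<^sub>1 b\<close> is only a small perturbation of
  the displacing flow, so an orbit that starts in the support of \<open>b\<close> has left it at time \<open>\<epsilon>\<close>; during
  \<open>[\<epsilon>, 1]\<close> the function \<open>b\<close> is conserved. So \<open>b\<close> vanishes along a closed orbit except during \<open>[0, \<epsilon>]\<close>, and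
  the integral is of order \<open>\<epsilon>\<close>.
\<close>

section \<open>Calculus of smooth maps\<close>

text \<open>The value \<open>K\<close> is arbitrary whereas |e_k| is fixed, so \<open>K\<close> must
  not enter the advance of q_k. Squeezing the displacing flow into [0, \<epsilon>] changes neither
  its end map nor the time integral of its sup norm, while the bump acts there with total strength
  \<epsilon> K_1 only: in the time scale of the displacing flow it reads \<epsilon> s K_1 b with s =
  \<lambda>(p) in [0, 1], and \<epsilon> is chosen after K_1. The price is that a' is of order
  1/\<epsilon>. A constant of that order added to K would dominate a' H, but would spoil the
  smallness of \<epsilon> K_1; hence the compensation by a term whose mean over a period vanishes.
  The displacement must survive the perturbation uniformly in s. This comes from the continuity of
  single solutions in the starting point and in s, a Gronwall estimate in charts, together with
  compactness of the displaced set; the same continuity, with zero perturbation, also yields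
  uniqueness of Hamiltonian curves. The class of a closed orbit enters through a winding number of
  its k-th angular component.\<close>

lemma has_derivative_cong_open:
  assumes "open S" "x \<in> S" "\<And>y. y \<in> S \<Longrightarrow> f y = g y"
  shows "(f has_derivative D) (at x) \<longleftrightarrow> (g has_derivative D) (at x)"
  using assms has_derivative_transform_within_open[of f D x UNIV S g]
    has_derivative_transform_within_open[of g D x UNIV S f] by auto

lemma frechet_derivative_cong_open:
  assumes "open S" "x \<in> S" "\<And>y. y \<in> S \<Longrightarrow> f y = g y"
  shows "frechet_derivative f (at x) = frechet_derivative g (at x)"
  unfolding frechet_derivative_def using has_derivative_cong_open[OF assms] by simp

lemma Ck_on_cong:
  assumes "open S" "\<And>x. x \<in> S \<Longrightarrow> f x = g x"
  shows "Ck_on k S f \<longleftrightarrow> Ck_on k S g"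
  using assms(2)
proof (induction k arbitrary: f g)
  case 0
  then show ?case by (auto cong: continuous_on_cong)
next
  case (Suc k)
  have "f differentiable at x \<longleftrightarrow> g differentiable at x" if "x \<in> S" for x
    unfolding differentiable_def by (intro iff_exI has_derivative_cong_open[OF assms(1) that Suc.prems])
  moreover have "Ck_on k S (\<lambda>x. frechet_derivative f (at x) v) \<longleftrightarrow> Ck_on k S (\<lambda>x. frechet_derivative g (at x) v)" for v
    by (rule Suc.IH, rule fun_cong[OF frechet_derivative_cong_open[OF assms(1) _ Suc.prems]])
  ultimately show ?case by simp
qed

lemma Ck_on_subset: "Ck_on k S f \<Longrightarrow> T \<subseteq> S \<Longrightarrow> Ck_on k T f"
  by (induction k arbitrary: f) (auto intro: continuous_on_subset)

text \<open>\<open>frechet_derivative\<close> is a choice operator that agrees with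
  \<open>f'\<close> only on \<open>S\<close>; congruence on the open set \<open>S\<close> is what
  allows derivatives to be supplied by a formula.\<close>

lemma Ck_on_SucI:
  assumes "open S" "\<And>x. x \<in> S \<Longrightarrow> (f has_derivative f' x) (at x)" "\<And>v. Ck_on k S (\<lambda>x. f' x v)"
  shows "Ck_on (Suc k) S f"
proof -
  have "frechet_derivative f (at x) = f' x" if "x \<in> S" for x
    using frechet_derivative_at[OF assms(2)[OF that]] by simp
  then have "Ck_on k S (\<lambda>x. frechet_derivative f (at x) v)" for v
    using assms(3)[of v] Ck_on_cong[OF assms(1), of "\<lambda>x. frechet_derivative f (at x) v" "\<lambda>x. f' x v" k] by simp
  then show ?thesis using assms(2) by (auto simp: differentiable_def)
qed

lemma Ck_on_SucD:
  assumes "Ck_on (Suc k) S f" "x \<in> S"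
  shows "(f has_derivative frechet_derivative f (at x)) (at x)"
  using assms frechet_derivative_works by auto

lemma Ck_on_continuous: "Ck_on k S f \<Longrightarrow> continuous_on S f"
proof (cases k)
  case (Suc m)
  moreover assume "Ck_on k S f"
  ultimately have "f differentiable_on S" by (simp add: differentiable_at_imp_differentiable_on)
  then show ?thesis by (rule differentiable_imp_continuous_on)
qed simp

lemma Ck_on_down: "Ck_on (Suc k) S f \<Longrightarrow> Ck_on k S f"
proof (induction k arbitrary: f)
  case 0
  then have "continuous_on S f" by (rule Ck_on_continuous)
  then show ?case by simp
next
  case (Suc k)
  then show ?case by (metis Ck_on.simps(2))
qed

lemma Ck_on_local:
  assumes "\<And>x. x \<in> S \<Longrightarrow> \<exists>U. open U \<and> x \<in> U \<and> Ck_on k U f"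
  shows "Ck_on k S f"
  using assms
proof (induction k arbitrary: f)
  case 0
  show ?case unfolding Ck_on.simps
  proof (rule continuous_at_imp_continuous_on, rule ballI)
    fix x assume "x \<in> S"
    with 0 obtain U where "open U" "x \<in> U" "continuous_on U f" by auto
    then show "isCont f x" by (simp add: continuous_on_eq_continuous_at)
  qed
next
  case (Suc k)
  show ?case unfolding Ck_on.simps
  proof (intro conjI ballI allI)
    fix x assume "x \<in> S"
    with Suc.prems show "f differentiable at x" by auto
  next
    fix v show "Ck_on k S (\<lambda>x. frechet_derivative f (at x) v)"
    proof (rule Suc.IH)
      fix x assume "x \<in> S"
      then obtain U where "open U" "x \<in> U" "Ck_on (Suc k) U f" using Suc.prems by blast
      then show "\<exists>U. open U \<and> x \<in> U \<and> Ck_on k U (\<lambda>x. frechet_derivative f (at x) v)"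
        by (intro exI[of _ U]) simp
    qed
  qed
qed

lemma Ck_on_const: "Ck_on k S (\<lambda>_. c)"
proof (induction k arbitrary: c)
  case (Suc k)
  then show ?case by simp
qed simp

lemma Ck_on_bounded_linear:
  assumes "bounded_linear L" "open S" "Ck_on k S f"
  shows "Ck_on k S (\<lambda>x. L (f x))"
  using assms(3)
proof (induction k arbitrary: f)
  case 0
  then show ?case by (auto intro: bounded_linear.continuous_on[OF assms(1)])
next
  case (Suc k)
  show ?case
  proof (rule Ck_on_SucI[OF assms(2)])
    fix x assume "x \<in> S"
    then show "((\<lambda>x. L (f x)) has_derivative (\<lambda>v. L (frechet_derivative f (at x) v))) (at x)"
      using bounded_linear.has_derivative[OF assms(1) Ck_on_SucD[OF Suc.prems]] by blast
  next
    fix v show "Ck_on k S (\<lambda>x. L (frechet_derivative f (at x) v))"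
      using Suc by auto
  qed
qed

lemma Ck_on_id: "open S \<Longrightarrow> Ck_on k S (\<lambda>x. x)"
  by (cases k) (auto intro!: continuous_intros Ck_on_SucI[where f' = "\<lambda>_ v. v"] Ck_on_const)

lemma Ck_on_add:
  assumes "open S" "Ck_on k S f" "Ck_on k S g"
  shows "Ck_on k S (\<lambda>x. f x + g x)"
  using assms(2,3)
proof (induction k arbitrary: f g)
  case 0
  then show ?case by (auto intro: continuous_intros)
next
  case (Suc k)
  show ?case
  proof (rule Ck_on_SucI[OF assms(1)])
    fix x assume "x \<in> S"
    then show "((\<lambda>x. f x + g x) has_derivative (\<lambda>v. frechet_derivative f (at x) v + frechet_derivative g (at x) v)) (at x)"
      by (intro has_derivative_add Ck_on_SucD[OF Suc.prems(1)] Ck_on_SucD[OF Suc.prems(2)])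
  next
    fix v show "Ck_on k S (\<lambda>x. frechet_derivative f (at x) v + frechet_derivative g (at x) v)"
      using Suc by auto
  qed
qed

lemma Ck_on_sum:
  assumes "open S" "\<And>i. i \<in> I \<Longrightarrow> Ck_on k S (f i)"
  shows "Ck_on k S (\<lambda>x. \<Sum>i\<in>I. f i x)"
  using assms(2)
proof (induction I rule: infinite_finite_induct)
  case (insert i I)
  then show ?case by (simp add: Ck_on_add[OF assms(1)])
qed (auto intro: Ck_on_const)

lemma Ck_on_bilinear:
  assumes "bounded_bilinear pr" "open S" "Ck_on k S f" "Ck_on k S g"
  shows "Ck_on k S (\<lambda>x. pr (f x) (g x))"
  using assms(3,4)
proof (induction k arbitrary: f g)
  case 0
  then show ?case by (auto intro: bounded_bilinear.continuous_on[OF assms(1)])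
next
  case (Suc k)
  show ?case
  proof (rule Ck_on_SucI[OF assms(2)])
    fix x assume "x \<in> S"
    then show "((\<lambda>x. pr (f x) (g x)) has_derivative
       (\<lambda>v. pr (f x) (frechet_derivative g (at x) v) + pr (frechet_derivative f (at x) v) (g x))) (at x)"
      using bounded_bilinear.FDERIV[OF assms(1) Ck_on_SucD[OF Suc.prems(1)] Ck_on_SucD[OF Suc.prems(2)]] by blast
  next
    fix v show "Ck_on k S (\<lambda>x. pr (f x) (frechet_derivative g (at x) v) + pr (frechet_derivative f (at x) v) (g x))"
      by (intro Ck_on_add assms(2) Suc.IH Ck_on_down[OF Suc.prems(1)] Ck_on_down[OF Suc.prems(2)])
        (use Suc.prems in auto)
  qed
qed

lemma frechet_derivative_basis_expansion:
  fixes g :: "'a::euclidean_space \<Rightarrow> 'b::real_normed_vector"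
  assumes "g differentiable (at y)"
  shows "frechet_derivative g (at y) w = (\<Sum>b\<in>Basis. (w \<bullet> b) *\<^sub>R frechet_derivative g (at y) b)"
proof -
  interpret bounded_linear "frechet_derivative g (at y)"
    using assms frechet_derivative_works has_derivative_bounded_linear by blast
  have "frechet_derivative g (at y) w = frechet_derivative g (at y) (\<Sum>b\<in>Basis. (w \<bullet> b) *\<^sub>R b)"
    by (simp add: euclidean_representation)
  then show ?thesis by (simp add: sum scaleR)
qed

text \<open>The chain rule differentiates \<open>g\<close> in a direction that varies with
  \<open>x\<close>. Expanding this direction in the basis leaves derivatives of \<open>g\<close> in
  fixed directions, to which the induction hypothesis applies; this is why the middle space is
  Euclidean.\<close>

lemma Ck_on_compose:
  fixes f :: "'a::real_normed_vector \<Rightarrow> 'b::euclidean_space" and g :: "'b \<Rightarrow> 'c::real_normed_vector"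
  assumes "open S" "open T" "f ` S \<subseteq> T" "Ck_on k S f" "Ck_on k T g"
  shows "Ck_on k S (\<lambda>x. g (f x))"
  using assms(4,5)
proof (induction k arbitrary: g)
  case 0
  then show ?case using assms(3) by (auto intro: continuous_on_compose2)
next
  case (Suc k)
  have fx: "f x \<in> T" if "x \<in> S" for x using that assms(3) by auto
  show ?case
  proof (rule Ck_on_SucI[OF assms(1)])
    fix x assume "x \<in> S"
    have "((\<lambda>x. g (f x)) has_derivative (\<lambda>v. frechet_derivative g (at (f x)) (frechet_derivative f (at x) v))) (at x)"
      using diff_chain_at[OF Ck_on_SucD[OF Suc.prems(1) \<open>x \<in> S\<close>] Ck_on_SucD[OF Suc.prems(2) fx[OF \<open>x \<in> S\<close>]]]
      by (simp add: o_def)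
    also have "(\<lambda>v. frechet_derivative g (at (f x)) (frechet_derivative f (at x) v)) =
      (\<lambda>v. \<Sum>b\<in>Basis. (frechet_derivative f (at x) v \<bullet> b) *\<^sub>R frechet_derivative g (at (f x)) b)"
      using Suc.prems(2) fx[OF \<open>x \<in> S\<close>] by (intro ext frechet_derivative_basis_expansion) auto
    finally show "((\<lambda>x. g (f x)) has_derivative
       (\<lambda>v. \<Sum>b\<in>Basis. (frechet_derivative f (at x) v \<bullet> b) *\<^sub>R frechet_derivative g (at (f x)) b)) (at x)" .
  next
    fix v
    show "Ck_on k S (\<lambda>x. \<Sum>b\<in>Basis. (frechet_derivative f (at x) v \<bullet> b) *\<^sub>R frechet_derivative g (at (f x)) b)"
    proof (intro Ck_on_sum Ck_on_bilinear[OF bounded_bilinear_scaleR] assms(1) Suc.IH[OF Ck_on_down[OF Suc.prems(1)]])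
      fix b :: 'b
      show "Ck_on k S (\<lambda>x. frechet_derivative f (at x) v \<bullet> b)"
        using Suc.prems(1) by (intro Ck_on_bounded_linear[OF bounded_linear_inner_left] assms(1)) auto
      show "Ck_on k T (\<lambda>x. frechet_derivative g (at x) b)"
        using Suc.prems(2) by auto
    qed
  qed
qed

lemma smooth_on_cong:
  assumes "open S" "\<And>x. x \<in> S \<Longrightarrow> f x = g x" "smooth_on S g"
  shows "smooth_on S f"
  using assms(3) Ck_on_cong[OF assms(1,2)] by (simp add: smooth_on_def)

lemma smooth_on_subset: "smooth_on S f \<Longrightarrow> T \<subseteq> S \<Longrightarrow> smooth_on T f"
  unfolding smooth_on_def using Ck_on_subset by blast

lemma smooth_on_local:
  assumes "\<And>x. x \<in> S \<Longrightarrow> \<exists>U. open U \<and> x \<in> U \<and> smooth_on U f"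
  shows "smooth_on S f"
  unfolding smooth_on_def
proof
  fix k show "Ck_on k S f"
    by (rule Ck_on_local) (use assms in \<open>auto simp: smooth_on_def\<close>)
qed

lemma smooth_on_const: "smooth_on S (\<lambda>_. c)"
  by (simp add: smooth_on_def Ck_on_const)

lemma smooth_on_id: "open S \<Longrightarrow> smooth_on S (\<lambda>x. x)"
  by (simp add: smooth_on_def Ck_on_id)

lemma smooth_on_linear: "open S \<Longrightarrow> bounded_linear L \<Longrightarrow> smooth_on S L"
  using Ck_on_bounded_linear[of L S _ "\<lambda>x. x"] by (simp add: smooth_on_def Ck_on_id)

lemma smooth_on_add:
  "open S \<Longrightarrow> smooth_on S f \<Longrightarrow> smooth_on S g \<Longrightarrow> smooth_on S (\<lambda>x. f x + g x)"
  by (simp add: smooth_on_def Ck_on_add)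

lemma smooth_on_mult:
  fixes f g :: "'a::real_normed_vector \<Rightarrow> real"
  shows "open S \<Longrightarrow> smooth_on S f \<Longrightarrow> smooth_on S g \<Longrightarrow> smooth_on S (\<lambda>x. f x * g x)"
  by (simp add: smooth_on_def Ck_on_bilinear[OF bounded_bilinear_mult])

lemma smooth_on_diff:
  fixes f g :: "'a::real_normed_vector \<Rightarrow> real"
  shows "open S \<Longrightarrow> smooth_on S f \<Longrightarrow> smooth_on S g \<Longrightarrow> smooth_on S (\<lambda>x. f x - g x)"
  using smooth_on_add[of S f "\<lambda>x. (-1) * g x"] smooth_on_mult[OF _ smooth_on_const, of S g "-1"] by simp

lemma smooth_on_sum:
  "open S \<Longrightarrow> (\<And>i. i \<in> I \<Longrightarrow> smooth_on S (f i)) \<Longrightarrow> smooth_on S (\<lambda>x. \<Sum>i\<in>I. f i x)"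
  by (simp add: smooth_on_def Ck_on_sum)

lemma smooth_on_compose:
  fixes f :: "'a::real_normed_vector \<Rightarrow> 'b::euclidean_space" and g :: "'b \<Rightarrow> 'c::real_normed_vector"
  assumes "open S" "open T" "f ` S \<subseteq> T" "smooth_on S f" "smooth_on T g"
  shows "smooth_on S (\<lambda>x. g (f x))"
  using assms by (auto simp: smooth_on_def intro: Ck_on_compose)

lemma smooth_on_linear_arg:
  fixes L :: "'a::real_normed_vector \<Rightarrow> 'b::euclidean_space" and g :: "'b \<Rightarrow> 'c::real_normed_vector"
  assumes "open S" "bounded_linear L" "smooth_on T g" "open T" "L ` S \<subseteq> T"
  shows "smooth_on S (\<lambda>x. g (L x))"
  using smooth_on_compose[OF assms(1,4,5) smooth_on_linear[OF assms(1,2)] assms(3)] .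

lemma smooth_on_Pair:
  assumes "open S" "smooth_on S f" "smooth_on S g"
  shows "smooth_on S (\<lambda>x. (f x, g x))"
proof -
  have "Ck_on k S (\<lambda>x. (f x, 0) + (0, g x))" for k
    using assms
    by (intro Ck_on_add Ck_on_bounded_linear[OF bounded_linear_Pair[OF bounded_linear_ident bounded_linear_zero]]
      Ck_on_bounded_linear[OF bounded_linear_Pair[OF bounded_linear_zero bounded_linear_ident]])
     (auto simp: smooth_on_def)
  then have "smooth_on S (\<lambda>x. (f x, 0) + (0, g x))" by (simp add: smooth_on_def)
  then show ?thesis by simp
qed

lemma smooth_on_differentiable: "smooth_on S f \<Longrightarrow> x \<in> S \<Longrightarrow> f differentiable (at x)"
  using Ck_on_SucD[of 0 S f x] by (auto simp: smooth_on_def differentiable_def simp del: Ck_on.simps)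

lemma smooth_on_continuous: "smooth_on S f \<Longrightarrow> continuous_on S f"
  unfolding smooth_on_def using Ck_on_continuous by blast

lemma smooth_on_frechet: "smooth_on S f \<Longrightarrow> smooth_on S (\<lambda>x. frechet_derivative f (at x) v)"
  unfolding smooth_on_def by (rule allI, drule_tac x = "Suc k" in spec) simp

lemma smooth_on_norm_sq:
  fixes f :: "'a::real_normed_vector \<Rightarrow> 'b::euclidean_space"
  assumes "open S" "smooth_on S f" shows "smooth_on S (\<lambda>x. f x \<bullet> f x)"
  using assms Ck_on_bilinear[OF bounded_bilinear_inner assms(1), of _ f f] unfolding smooth_on_def by blast

section \<open>Real functions, Lipschitz bounds and primitives\<close>

lemma Ck_on_Suc_real:
  fixes f :: "real \<Rightarrow> real"
  assumes "open S" "\<And>x. x \<in> S \<Longrightarrow> (f has_real_derivative f' x) (at x)" "Ck_on k S f'"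
  shows "Ck_on (Suc k) S f"
proof (rule Ck_on_SucI[OF assms(1)])
  show "(f has_derivative (\<lambda>v. f' x * v)) (at x)" if "x \<in> S" for x
    using assms(2)[OF that] by (simp add: has_field_derivative_def)
  show "Ck_on k S (\<lambda>x. f' x * v)" for v
    by (intro Ck_on_bilinear[OF bounded_bilinear_mult] assms Ck_on_const)
qed

text \<open>Mean value inequality: compactness bounds the finitely many directional derivatives
  along the basis, and these bound the operator norm on \<open>K\<close>.\<close>

lemma smooth_on_lipschitz:
  fixes f :: "'a::euclidean_space \<Rightarrow> 'b::real_normed_vector"
  assumes "smooth_on S f" "compact K" "convex K" "K \<subseteq> S"
  shows "\<exists>L. L-lipschitz_on K f"
proof -
  have "\<exists>B. \<forall>x\<in>K. norm (frechet_derivative f (at x) b) \<le> B" for b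
  proof -
    have "compact ((\<lambda>x. frechet_derivative f (at x) b) ` K)"
      using smooth_on_continuous[OF smooth_on_frechet[OF assms(1)]] assms(2,4)
      by (intro compact_continuous_image) (auto intro: continuous_on_subset)
    then show ?thesis using compact_imp_bounded by (force simp: bounded_iff)
  qed
  then obtain B where B: "\<And>b x. x \<in> K \<Longrightarrow> norm (frechet_derivative f (at x) b) \<le> B b" by metis
  define L where "L = max 0 (\<Sum>b\<in>Basis. B b)"
  have der: "(f has_derivative frechet_derivative f (at x)) (at x)" if "x \<in> K" for x
    using smooth_on_differentiable[OF assms(1)] that assms(4) by (auto simp flip: frechet_derivative_works)
  have "onorm (frechet_derivative f (at x)) \<le> L" if "x \<in> K" for x
  proof (rule onorm_bound)
    show "0 \<le> L" by (simp add: L_def)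
    fix v
    have "norm (frechet_derivative f (at x) v) = norm (\<Sum>b\<in>Basis. (v \<bullet> b) *\<^sub>R frechet_derivative f (at x) b)"
      using arg_cong[OF frechet_derivative_basis_expansion[of f x v], of norm]
        smooth_on_differentiable[OF assms(1)] that assms(4) by blast
    also have "\<dots> \<le> (\<Sum>b\<in>Basis. norm v * B b)"
      using B[OF that] by (intro sum_norm_le) (auto intro!: mult_mono Basis_le_norm)
    also have "\<dots> \<le> L * norm v" unfolding L_def sum_distrib_left[symmetric]
      by (subst mult.commute, rule mult_right_mono) auto
    finally show "norm (frechet_derivative f (at x) v) \<le> L * norm v" .
  qed
  then have "norm (f x - f y) \<le> L * norm (x - y)" if "x \<in> K" "y \<in> K" for x y
    using differentiable_bound[OF assms(3) has_derivative_at_withinI[OF der], of L x y] that by blast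
  then have "L-lipschitz_on K f" by (auto simp: lipschitz_on_def dist_norm L_def)
  then show ?thesis ..
qed

lemma antiderivative_on_line:
  fixes f :: "real \<Rightarrow> real"
  assumes "continuous_on UNIV f"
  obtains F where "\<And>x::real. (F has_real_derivative f x) (at x)"
proof
  fix x :: real
  \<comment> \<open>One unit of slack on both sides puts \<open>x\<close> in the interior, where the
    derivative within the interval is two-sided; the oriented integral covers negative
    \<open>x\<close> as well.\<close>
  let ?a = "min 0 x - 1" and ?b = "max 0 x + 1"
  have "((\<lambda>u. LBINT y=0..u. f y) has_vector_derivative f x) (at x within {?a..?b})"
    using interval_integral_FTC2[of ?a 0 ?b f x] continuous_on_subset[OF assms, of "{?a..?b}"]
    by (simp add: zero_ereal_def)
  then show "((\<lambda>u. LBINT y=0..u. f y) has_real_derivative f x) (at x)"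
    by (subst (asm) at_within_interior) (auto simp: has_real_derivative_iff_has_vector_derivative)
qed

section \<open>Smooth steps\<close>

text \<open>The functions P(1/x) exp(-1/x), extended by 0, form a family closed under
  differentiation, so smoothness follows by one induction over all \<open>P\<close> simultaneously.
  \<open>flat 1\<close> is the classical flat function.\<close>

definition flat :: "real poly \<Rightarrow> real \<Rightarrow> real"
  where "flat P x = (if x > 0 then poly P (1 / x) * exp (- (1 / x)) else 0)"

lemma poly_exp_tendsto_0: "((\<lambda>y::real. poly P y * exp (- y)) \<longlongrightarrow> 0) at_top"
proof -
  have "((\<lambda>y::real. \<Sum>i\<le>degree P. coeff P i * (y ^ i / exp y)) \<longlongrightarrow> (\<Sum>i\<le>degree P. coeff P i * 0)) at_top"
    by (intro tendsto_sum tendsto_mult tendsto_const tendsto_power_div_exp_0)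
  then show ?thesis
    by (simp add: poly_altdef sum_divide_distrib exp_minus divide_inverse[symmetric])
qed

lemma flat_deriv:
  "(flat P has_real_derivative flat (monom 1 2 * (P - pderiv P)) x) (at x)"
proof (cases x "0::real" rule: linorder_cases)
  case less
  have "((\<lambda>_. 0) has_real_derivative 0) (at x)" by simp
  then show ?thesis using less
    by (auto simp: flat_def has_field_derivative_def
        intro!: has_derivative_transform_within_open[where s = "{..<0}" and f = "\<lambda>_. 0"])
next
  case greater
  have "((\<lambda>x. poly P (1 / x) * exp (- (1 / x))) has_real_derivative
      flat (monom 1 2 * (P - pderiv P)) x) (at x)"
    using greater
    by (auto intro!: derivative_eq_intros DERIV_chain2[where f = "poly P"] poly_DERIV
        simp: flat_def poly_monom power2_eq_square field_simps)
  then show ?thesis unfolding has_field_derivative_def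
    by (rule has_derivative_transform_within_open[where s = "{0<..}"]) (use greater in \<open>auto simp: flat_def\<close>)
next
  case equal
  have "((\<lambda>h. flat P h / h) \<longlongrightarrow> 0) (at_right 0)"
  proof -
    \<comment> \<open>Replacing \<open>P\<close> by \<open>pCons 0 P\<close> multiplies by 1/h,
      which makes the difference quotient another instance of the limit at infinity.\<close>
    have "((\<lambda>h::real. poly (pCons 0 P) (inverse h) * exp (- inverse h)) \<longlongrightarrow> 0) (at_right 0)"
      using filterlim_compose[OF poly_exp_tendsto_0 filterlim_inverse_at_top_right] .
    then show ?thesis
      by (rule Lim_transform_eventually)
        (auto simp: eventually_at_right_less flat_def field_simps eventually_at_filter)
  qed
  moreover have "((\<lambda>h. flat P h / h) \<longlongrightarrow> 0) (at_left 0)"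
    by (rule Lim_transform_eventually[OF tendsto_const])
      (auto simp: flat_def eventually_at_filter)
  ultimately have "((\<lambda>h. flat P h / h) \<longlongrightarrow> 0) (at 0)"
    using filterlim_at_split by blast
  then show ?thesis using equal by (simp add: DERIV_def flat_def)
qed

lemma Ck_on_flat: "Ck_on k UNIV (flat P)"
proof (induction k arbitrary: P)
  case 0
  show ?case using DERIV_isCont[OF flat_deriv] by (simp add: continuous_at_imp_continuous_on)
next
  case (Suc k)
  show ?case by (rule Ck_on_Suc_real[OF _ flat_deriv Suc]) auto
qed

lemma smooth_step_exists:
  obtains S :: "real \<Rightarrow> real" where "smooth_on UNIV S" "\<And>x. x \<le> 0 \<Longrightarrow> S x = 0" "\<And>x. x \<ge> 1 \<Longrightarrow> S x = 1"
    "\<And>x. 0 \<le> S x" "\<And>x. S x \<le> 1"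
proof
  define f where "f = flat 1"
  \<comment> \<open>Nesting the flat function keeps the denominator constant: the argument f 1 - f
    (1 - x) is nonpositive for x \<le> 0 and equals f 1 for x \<ge> 1.\<close>
  define S where "S x = f (f 1 - f (1 - x)) / f (f 1)" for x
  have f0: "f x = 0" if "x \<le> 0" for x using that by (simp add: f_def flat_def)
  have fp: "f x > 0" if "x > 0" for x using that by (simp add: f_def flat_def)
  have fm: "f x \<le> f y" if "x \<le> y" for x y
  proof (cases "x > 0")
    case True
    then have "1 / y \<le> 1 / x" using that by (simp add: frac_le)
    then show ?thesis using True that by (simp add: f_def flat_def)
  next
    case False
    then show ?thesis using fp[of y] f0[of x] f0[of y] by (cases "y > 0") auto
  qed
  have fs: "smooth_on UNIV f" by (simp add: smooth_on_def f_def Ck_on_flat)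
  have "smooth_on UNIV (\<lambda>x. 1 / f (f 1) * f (f 1 - f (1 - x)))"
    by (intro smooth_on_mult smooth_on_const smooth_on_compose[OF _ _ _ _ fs] smooth_on_diff smooth_on_id) auto
  then show "smooth_on UNIV S" by (simp add: S_def[abs_def])
  show "S x = 0" if "x \<le> 0" for x using f0[of "f 1 - f (1 - x)"] fm[of 1 "1-x"] that by (simp add: S_def)
  show "S x = 1" if "x \<ge> 1" for x using f0[of "1-x"] fp[OF fp[of 1]] that by (simp add: S_def)
  show "0 \<le> S x" for x using fp f0 by (metis S_def divide_nonneg_nonneg less_eq_real_def linorder_not_less)
  have "f (1 - x) \<ge> 0" for x using fp f0 by (metis less_eq_real_def linorder_not_less)
  then show "S x \<le> 1" for x using fm[of "f 1 - f (1 - x)" "f 1"] fp[OF fp[of 1]] by (simp add: S_def)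
qed

text \<open>A step whose slope is almost that of the linear ramp: the primitive of a plateau.\<close>

lemma smooth_ramp_exists:
  fixes c :: real
  assumes "c > 1"
  obtains Q Q' :: "real \<Rightarrow> real" where "\<And>x::real. (Q has_real_derivative Q' x) (at x)"
    "smooth_on UNIV Q" "smooth_on UNIV Q'" "\<And>x. x \<le> 0 \<Longrightarrow> Q x = 0" "\<And>x. x \<ge> 1 \<Longrightarrow> Q x = 1"
    "\<And>x. 0 \<le> Q x" "\<And>x. Q x \<le> 1" "\<And>x. 0 \<le> Q' x" "\<And>x. Q' x \<le> c" "\<And>x. x \<le> 0 \<or> x \<ge> 1 \<Longrightarrow> Q' x = 0"
proof -
  obtain S :: "real \<Rightarrow> real" where S: "smooth_on UNIV S" "\<And>x. x \<le> 0 \<Longrightarrow> S x = 0" "\<And>x. x \<ge> 1 \<Longrightarrow> S x = 1"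
    "\<And>x. 0 \<le> S x" "\<And>x. S x \<le> 1" using smooth_step_exists by metis
  \<comment> \<open>The plateau of \<open>P\<close> then has length 1 - 2 \<eta> = 1/c, so its
    integral \<open>I\<close> is at least 1/c and the normalised slope P/I is at most c.\<close>
  define \<eta> where "\<eta> = (1 - 1 / c) / 2"
  have \<eta>: "0 < \<eta>" "\<eta> < 1/2" "1 - 2 * \<eta> = 1 / c" using assms by (auto simp: \<eta>_def field_simps)
  define P where "P x = S (1/\<eta> * x) * S (1/\<eta> * (1 - x))" for x
  have Ps: "smooth_on UNIV P" unfolding P_def
    by (intro smooth_on_mult smooth_on_const smooth_on_compose[OF _ _ _ _ S(1)] smooth_on_diff smooth_on_id) auto
  have P01: "0 \<le> P x" "P x \<le> 1" for x using S by (auto simp: P_def intro: mult_le_one)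
  have P0: "P x = 0" if "x \<le> 0 \<or> x \<ge> 1" for x
    using that S(2)[of "1/\<eta> * x"] S(2)[of "1/\<eta> * (1 - x)"] \<eta>
    by (auto simp: P_def divide_le_0_iff)
  have P1: "P x = 1" if "\<eta> \<le> x" "x \<le> 1 - \<eta>" for x using that \<eta> by (simp add: P_def S(3) field_simps)
  obtain F where F: "\<And>x. (F has_real_derivative P x) (at x)"
    using antiderivative_on_line smooth_on_continuous[OF Ps] by metis
  have Fmono: "F x \<le> F y" if "x \<le> y" for x y
    using DERIV_nonneg_imp_nondecreasing[OF that, of F] F P01 by blast
  have F0: "F x = F 0" if "x \<le> 0" for x
  proof -
    have "\<exists>c. \<forall>x\<in>{..0}. F x = c"
    proof (rule has_field_derivative_zero_constant)
      fix x :: real assume "x \<in> {..0}"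
      then show "(F has_real_derivative 0) (at x within {..0})"
        using has_field_derivative_at_within[OF F[of x]] P0[of x] by simp
    qed simp
    then show ?thesis using that by auto
  qed
  have F1: "F x = F 1" if "x \<ge> 1" for x
  proof -
    have "\<exists>c. \<forall>x\<in>{1..}. F x = c"
    proof (rule has_field_derivative_zero_constant)
      fix x :: real assume "x \<in> {1..}"
      then show "(F has_real_derivative 0) (at x within {1..})"
        using has_field_derivative_at_within[OF F[of x]] P0[of x] by simp
    qed simp
    then show ?thesis using that by auto
  qed
  define I where "I = F 1 - F 0"
  have "F \<eta> - \<eta> \<le> F (1 - \<eta>) - (1 - \<eta>)"
  proof (rule DERIV_nonneg_imp_nondecreasing[where f = "\<lambda>a. F a - a" and a = \<eta> and b = "1 - \<eta>"])
    fix x assume "\<eta> \<le> x" "x \<le> 1 - \<eta>"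
    then have "P x = 1" by (rule P1)
    moreover have "((\<lambda>a. F a - a) has_real_derivative P x - 1) (at x)"
      by (rule DERIV_diff[OF F DERIV_ident])
    ultimately show "\<exists>y. ((\<lambda>a. F a - a) has_real_derivative y) (at x) \<and> 0 \<le> y" by auto
  qed (use \<eta> in auto)
  then have "I \<ge> 1 - 2 * \<eta>"
    using Fmono[of 0 \<eta>] Fmono[of "1-\<eta>" 1] \<eta> by (simp add: I_def)
  then have I: "I \<ge> 1 / c" "I > 0" using \<eta> assms by (auto intro: less_le_trans[of 0 "1/c"])
  define Q where "Q x = 1 / I * (F x - F 0)" for x
  have Q: "(Q has_real_derivative 1 / I * P x) (at x)" for x
    unfolding Q_def using F I by (auto intro!: derivative_eq_intros)
  have Q's: "smooth_on UNIV (\<lambda>x. 1 / I * P x)" by (intro smooth_on_mult smooth_on_const Ps) auto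
  have Qs: "smooth_on UNIV Q" unfolding smooth_on_def
  proof
    fix k show "Ck_on k UNIV Q"
      by (rule Ck_on_down, rule Ck_on_Suc_real[OF _ Q]) (use Q's in \<open>auto simp: smooth_on_def\<close>)
  qed
  show thesis
  proof (rule that[OF Q Qs Q's])
    show "Q x = 0" if "x \<le> 0" for x using F0[OF that] by (simp add: Q_def)
    show "Q x = 1" if "x \<ge> 1" for x using F1[OF that] I by (simp add: Q_def I_def)
    show "0 \<le> Q x" for x using Fmono[of 0 x] F0[of x] I by (cases "x \<ge> 0") (auto simp: Q_def)
    show "Q x \<le> 1" for x using Fmono[of x 1] F1[of x] I by (cases "x \<le> 1") (auto simp: Q_def I_def)
    show "0 \<le> 1 / I * P x" for x using P01 I by auto
    show "1 / I * P x \<le> c" for x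
    proof -
      have "P x \<le> c * I" using P01(2)[of x] I(1) assms by (simp add: field_simps)
      then show ?thesis using I(2) by (simp add: field_simps)
    qed
    show "1 / I * P x = 0" if "x \<le> 0 \<or> x \<ge> 1" for x using P0[OF that] by simp
  qed
qed

section \<open>Charts and cutoff functions\<close>

locale smooth_mfd =
  fixes M :: "('a, 'e::euclidean_space) mfd"
  assumes smooth_manifold: "smooth_manifold M"
begin

lemma Hausdorff: "Hausdorff_space (mtop M)"
  using smooth_manifold by (simp add: smooth_manifold_def)

lemma chart_cover: "x \<in> topspace (mtop M) \<Longrightarrow> \<exists>c\<in>atlas M. x \<in> fst c"
  using smooth_manifold by (auto simp: smooth_manifold_def)

context
  fixes c assumes c: "c \<in> atlas M"
begin

lemma openin_chart: "openin (mtop M) (fst c)"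
  using smooth_manifold c by (simp add: smooth_manifold_def)

lemma chart_subset: "fst c \<subseteq> topspace (mtop M)"
  using openin_chart openin_subset by blast

lemma open_chart_image: "open (chart_image c)"
  using smooth_manifold c by (simp add: smooth_manifold_def)

lemma chart_homeo:
  "homeomorphic_map (subtopology (mtop M) (fst c)) (top_of_set (chart_image c)) (snd c)"
  using smooth_manifold c by (simp add: smooth_manifold_def)

lemma topspace_chart: "topspace (subtopology (mtop M) (fst c)) = fst c"
  using chart_subset by auto

lemma inj_chart: "inj_on (snd c) (fst c)"
  using chart_homeo unfolding homeomorphic_eq_everything_map topspace_chart by simp

lemma chart_inv_left [simp]: "x \<in> fst c \<Longrightarrow> chart_inv c (snd c x) = x"
  by (simp add: chart_inv_def inj_chart)

lemma chart_inv_right [simp]: "y \<in> chart_image c \<Longrightarrow> snd c (chart_inv c y) = y"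
  by (simp add: chart_inv_def chart_image_def f_inv_into_f)

lemma chart_inv_mem [simp]: "y \<in> chart_image c \<Longrightarrow> chart_inv c y \<in> fst c"
  by (simp add: chart_inv_def chart_image_def inv_into_into)

lemma chart_mem [simp]: "x \<in> fst c \<Longrightarrow> snd c x \<in> chart_image c"
  by (simp add: chart_image_def)

lemma continuous_chart:
  "continuous_map (subtopology (mtop M) (fst c)) (top_of_set (chart_image c)) (snd c)"
  using chart_homeo homeomorphic_imp_continuous_map by blast

lemma continuous_chart_inv:
  "continuous_map (top_of_set (chart_image c)) (mtop M) (chart_inv c)"
proof -
  have "continuous_map (top_of_set (chart_image c)) (subtopology (mtop M) (fst c)) (chart_inv c)"
    unfolding continuous_map_openin_preimage_eq
  proof (intro conjI allI impI)
    show "chart_inv c \<in> topspace (top_of_set (chart_image c)) \<rightarrow> topspace (subtopology (mtop M) (fst c))"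
      unfolding topspace_chart by auto
    fix U assume U: "openin (subtopology (mtop M) (fst c)) U"
    then have Uc: "U \<subseteq> fst c" using topspace_chart openin_subset by metis
    have "topspace (top_of_set (chart_image c)) \<inter> chart_inv c -` U = snd c ` U"
    proof (intro equalityI subsetI)
      fix y assume "y \<in> topspace (top_of_set (chart_image c)) \<inter> chart_inv c -` U"
      then have "chart_inv c y \<in> U" "y = snd c (chart_inv c y)" by auto
      then show "y \<in> snd c ` U" by blast
    next
      fix y assume "y \<in> snd c ` U"
      then show "y \<in> topspace (top_of_set (chart_image c)) \<inter> chart_inv c -` U" using Uc by auto
    qed
    then show "openin (top_of_set (chart_image c)) (topspace (top_of_set (chart_image c)) \<inter> chart_inv c -` U)"
      using homeomorphic_imp_open_map[OF chart_homeo] U by (simp add: open_map_def)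
  qed
  then show ?thesis by (simp add: continuous_map_in_subtopology)
qed

lemma openin_chart_vimage:
  assumes "open B" shows "openin (mtop M) {x \<in> fst c. snd c x \<in> B}"
proof -
  have "openin (subtopology (mtop M) (fst c)) {x \<in> fst c. snd c x \<in> chart_image c \<inter> B}"
    using openin_continuous_map_preimage[OF continuous_chart, of "chart_image c \<inter> B"] assms
    unfolding topspace_chart by (simp add: openin_open_Int)
  moreover have "{x \<in> fst c. snd c x \<in> chart_image c \<inter> B} = {x \<in> fst c. snd c x \<in> B}" by auto
  ultimately show ?thesis using openin_trans_full[OF _ openin_chart] by simp
qed

lemma open_chart_transport:
  assumes "openin (mtop M) U" shows "open (snd c ` (fst c \<inter> U))"
proof -
  have "openin (subtopology (mtop M) (fst c)) (fst c \<inter> U)"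
    using assms by (auto simp: openin_subtopology)
  then have "openin (top_of_set (chart_image c)) (snd c ` (fst c \<inter> U))"
    using homeomorphic_imp_open_map[OF chart_homeo] by (simp add: open_map_def)
  then show ?thesis using open_chart_image openin_open_trans by blast
qed

lemma compactin_chart_inv:
  assumes "compact K" "K \<subseteq> chart_image c"
  shows "compactin (mtop M) (chart_inv c ` K)"
proof (rule image_compactin[OF _ continuous_chart_inv])
  show "compactin (top_of_set (chart_image c)) K" using assms by (simp add: compactin_subtopology)
qed

lemma closedin_chart_inv:
  assumes "compact K" "K \<subseteq> chart_image c"
  shows "closedin (mtop M) (chart_inv c ` K)"
  using compactin_imp_closedin[OF Hausdorff compactin_chart_inv[OF assms]] .

lemma smooth_transition:
  assumes "d \<in> atlas M" shows "smooth_on (snd c ` (fst c \<inter> fst d)) (snd d \<circ> chart_inv c)"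
  using smooth_manifold assms c unfolding smooth_manifold_def by blast

end

definition msmooth :: "('a \<Rightarrow> real) \<Rightarrow> bool"
  where "msmooth f \<longleftrightarrow> (\<forall>c\<in>atlas M. smooth_on (chart_image c) (f \<circ> chart_inv c))"

lemma msmooth_differentiable:
  "msmooth f \<Longrightarrow> c \<in> atlas M \<Longrightarrow> y \<in> chart_image c \<Longrightarrow> (f \<circ> chart_inv c) differentiable (at y)"
  using smooth_on_differentiable unfolding msmooth_def by blast

lemma msmooth_continuous:
  assumes "msmooth f" shows "continuous_map (mtop M) euclideanreal f"
  unfolding continuous_map_openin_preimage_eq
proof (intro conjI allI impI)
  fix V :: "real set" assume "openin euclideanreal V"
  then have V: "open V" by simp
  have "openin (mtop M) {x \<in> fst c. f x \<in> V}" if c: "c \<in> atlas M" for c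
  proof -
    let ?B = "chart_image c \<inter> (f \<circ> chart_inv c) -` V"
    have "open ?B"
      using continuous_open_preimage[OF smooth_on_continuous open_chart_image[OF c] V, of "f \<circ> chart_inv c"]
        assms c by (auto simp: msmooth_def)
    then have "openin (mtop M) {x \<in> fst c. snd c x \<in> ?B}" by (rule openin_chart_vimage[OF c])
    moreover have "{x \<in> fst c. snd c x \<in> ?B} = {x \<in> fst c. f x \<in> V}" using c by auto
    ultimately show ?thesis by simp
  qed
  then have "openin (mtop M) (\<Union>c\<in>atlas M. {x \<in> fst c. f x \<in> V})" by blast
  moreover have "(\<Union>c\<in>atlas M. {x \<in> fst c. f x \<in> V}) = topspace (mtop M) \<inter> f -` V"
    using chart_cover chart_subset by blast
  ultimately show "openin (mtop M) (topspace (mtop M) \<inter> f -` V)" by simp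
qed auto

lemma msmooth_sum:
  "(\<And>i. i \<in> I \<Longrightarrow> msmooth (f i)) \<Longrightarrow> msmooth (\<lambda>x. \<Sum>i\<in>I. f i x)"
  unfolding msmooth_def o_def by (intro ballI smooth_on_sum open_chart_image) auto

lemma msmooth_comp:
  assumes "msmooth f" "smooth_on UNIV g" shows "msmooth (\<lambda>x. g (f x))"
  unfolding msmooth_def
proof
  fix c assume c: "c \<in> atlas M"
  have "smooth_on (chart_image c) (\<lambda>y. g ((f \<circ> chart_inv c) y))"
    by (rule smooth_on_compose[OF open_chart_image[OF c] open_UNIV subset_UNIV _ assms(2)])
      (use assms(1) c in \<open>unfold msmooth_def, blast\<close>)
  then show "smooth_on (chart_image c) ((\<lambda>x. g (f x)) \<circ> chart_inv c)" by (simp add: o_def)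
qed

section \<open>Bump and cutoff functions on a manifold\<close>

lemma bump_exists:
  assumes x0: "x0 \<in> U" and U: "openin (mtop M) U"
  shows "\<exists>b V K. msmooth b \<and> (\<forall>x. 0 \<le> b x) \<and> openin (mtop M) V \<and> x0 \<in> V \<and>
    (\<forall>x\<in>V. b x = 1) \<and> compactin (mtop M) K \<and> K \<subseteq> U \<and> (\<forall>x. x \<notin> K \<longrightarrow> b x = 0)"
proof -
  obtain S :: "real \<Rightarrow> real" where S: "smooth_on UNIV S" "\<And>x. x \<le> 0 \<Longrightarrow> S x = 0" "\<And>x. x \<ge> 1 \<Longrightarrow> S x = 1"
    "\<And>x. 0 \<le> S x" "\<And>x. S x \<le> 1" using smooth_step_exists by metis
  have "x0 \<in> topspace (mtop M)" using x0 U openin_subset by blast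
  then obtain c where c: "c \<in> atlas M" and xc: "x0 \<in> fst c" using chart_cover by blast
  define y0 where "y0 = snd c x0"
  have "y0 \<in> snd c ` (fst c \<inter> U)" using x0 xc by (auto simp: y0_def)
  then obtain r where r: "r > 0" "cball y0 (2 * r) \<subseteq> snd c ` (fst c \<inter> U)"
    using open_chart_transport[OF c U] open_contains_cball by (metis mult_pos_pos half_gt_zero field_sum_of_halves mult_2 zero_less_numeral)
  define K where "K = chart_inv c ` cball y0 (2 * r)"
  have r': "cball y0 (2 * r) \<subseteq> chart_image c" using r(2) by (auto simp: chart_image_def)
  have KU: "K \<subseteq> fst c \<inter> U" using r(2) c by (auto simp: K_def)
  \<comment> \<open>The argument of \<open>S\<close> is at least 1 on the ball of radius r and at
    most 0 outside the ball of radius 2 r; squaring the norm keeps it smooth at the centre.\<close>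
  define q where "q y = S (2 - (1/r\<^sup>2) * ((y - y0) \<bullet> (y - y0)))" for y
  have qs: "smooth_on UNIV q" unfolding q_def
  proof (rule smooth_on_compose[OF _ _ _ _ S(1)])
    have "smooth_on UNIV (\<lambda>y. y + (- y0))" by (intro smooth_on_add smooth_on_id smooth_on_const) auto
    then have "smooth_on UNIV (\<lambda>y. y - y0)" by simp
    then show "smooth_on UNIV (\<lambda>y. 2 - (1/r\<^sup>2) * ((y - y0) \<bullet> (y - y0)))"
      by (intro smooth_on_diff smooth_on_mult smooth_on_const smooth_on_norm_sq) auto
  qed auto
  have q0: "q y = 0" if "y \<notin> cball y0 (2 * r)" for y
  proof -
    have "(2 * r)\<^sup>2 < (norm (y - y0))\<^sup>2" using that r(1) by (intro power_strict_mono) (auto simp: dist_norm norm_minus_commute)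
    moreover have "(2 * r)\<^sup>2 \<ge> 2 * r\<^sup>2" by (simp add: power_mult_distrib)
    ultimately have "2 * r\<^sup>2 \<le> (y - y0) \<bullet> (y - y0)"
      unfolding power2_norm_eq_inner by linarith
    then have "2 - (1/r\<^sup>2) * ((y - y0) \<bullet> (y - y0)) \<le> 0" using r(1) by (simp add: pos_le_divide_eq)
    then show ?thesis by (simp add: q_def S)
  qed
  have q1: "q y = 1" if "y \<in> ball y0 r" for y
  proof -
    have "(norm (y - y0))\<^sup>2 \<le> r\<^sup>2" using that r(1) by (intro power_mono) (auto simp: dist_norm norm_minus_commute)
    then have "2 - (1/r\<^sup>2) * ((y - y0) \<bullet> (y - y0)) \<ge> 1"
      using r(1) by (simp add: power2_norm_eq_inner[symmetric] field_simps power2_eq_square)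
    then show ?thesis by (simp add: q_def S)
  qed
  define b where "b x = (if x \<in> fst c then q (snd c x) else 0)" for x
  have bK: "b x = 0" if "x \<notin> K" for x
  proof (cases "x \<in> fst c \<and> snd c x \<in> cball y0 (2 * r)")
    case True
    then have "x \<in> K" unfolding K_def using c by (metis chart_inv_left image_eqI)
    then show ?thesis using that by simp
  next
    case False
    then show ?thesis using q0 by (auto simp: b_def)
  qed
  have bs: "msmooth b" unfolding msmooth_def
  proof (intro ballI)
    fix d assume d: "d \<in> atlas M"
    show "smooth_on (chart_image d) (b \<circ> chart_inv d)"
    proof (rule smooth_on_local)
      fix y assume y: "y \<in> chart_image d"
      show "\<exists>U. open U \<and> y \<in> U \<and> smooth_on U (b \<circ> chart_inv d)"
      proof (cases "chart_inv d y \<in> fst c")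
        case True
        let ?U = "snd d ` (fst d \<inter> fst c)"
        have oU: "open ?U" by (rule open_chart_transport[OF d openin_chart[OF c]])
        have "snd d (chart_inv d y) \<in> ?U" using True y d by (intro imageI) auto
        then have yU: "y \<in> ?U" using d y by simp
        have "smooth_on ?U (\<lambda>y. q ((snd c \<circ> chart_inv d) y))"
          by (rule smooth_on_compose[OF oU open_UNIV _ smooth_transition[OF d c] qs]) auto
        then have "smooth_on ?U (b \<circ> chart_inv d)"
          by (rule smooth_on_cong[OF oU, rotated]) (use d in \<open>auto simp: b_def\<close>)
        then show ?thesis using oU yU by blast
      next
        case False
        \<comment> \<open>A point outside the chart \<open>c\<close> lies off the compact set
          \<open>K\<close>, which is closed because M is Hausdorff; so \<open>b\<close> vanishes on
          a whole neighbourhood and is smooth there in any chart.\<close>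
        let ?V = "topspace (mtop M) - K"
        let ?U = "snd d ` (fst d \<inter> ?V)"
        have "openin (mtop M) ?V" using closedin_chart_inv[OF c compact_cball r'] by (auto simp: K_def)
        then have oU: "open ?U" by (rule open_chart_transport[OF d])
        have "snd d (chart_inv d y) \<in> ?U"
          using False y d KU chart_subset[OF d] chart_inv_mem[OF d y] by (intro imageI) auto
        then have yU: "y \<in> ?U" using d y by simp
        have "smooth_on ?U (b \<circ> chart_inv d)"
          by (rule smooth_on_cong[OF oU _ smooth_on_const[of _ 0]]) (use d bK in auto)
        then show ?thesis using oU yU by blast
      qed
    qed
  qed
  let ?V = "{x \<in> fst c. snd c x \<in> ball y0 r}"
  have "msmooth b \<and> (\<forall>x. 0 \<le> b x) \<and> openin (mtop M) ?V \<and> x0 \<in> ?V \<and>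
    (\<forall>x\<in>?V. b x = 1) \<and> compactin (mtop M) K \<and> K \<subseteq> U \<and> (\<forall>x. x \<notin> K \<longrightarrow> b x = 0)"
  proof (intro conjI)
    show "openin (mtop M) ?V" by (rule openin_chart_vimage[OF c open_ball])
    show "compactin (mtop M) K" unfolding K_def by (rule compactin_chart_inv[OF c compact_cball r'])
    show "x0 \<in> ?V" using r(1) xc by (simp add: y0_def)
    show "\<forall>x\<in>?V. b x = 1" using q1 by (simp add: b_def)
    show "\<forall>x. 0 \<le> b x" using S(4) by (simp add: b_def q_def)
  qed (use bs KU bK in auto)
  then show ?thesis by blast
qed

text \<open>Finitely many bumps suffice by compactness. Their sum is at least 1 on the union of the
  plateaus, and the step function flattens it to exactly 1 there. Constancy on an open neighbourhood
  of \<open>C\<close> is what later kills the differential of \<open>\<theta>\<close> near the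
  supports.\<close>

lemma cutoff_exists:
  assumes C: "compactin (mtop M) C" and U: "openin (mtop M) U" "C \<subseteq> U"
  obtains \<theta> V K where "msmooth \<theta>" "\<And>x. 0 \<le> \<theta> x" "\<And>x. \<theta> x \<le> 1" "openin (mtop M) V" "C \<subseteq> V"
    "\<And>x. x \<in> V \<Longrightarrow> \<theta> x = 1" "compactin (mtop M) K" "K \<subseteq> U" "\<And>x. x \<notin> K \<Longrightarrow> \<theta> x = 0"
proof -
  obtain S :: "real \<Rightarrow> real" where S: "smooth_on UNIV S" "\<And>x. x \<le> 0 \<Longrightarrow> S x = 0" "\<And>x. x \<ge> 1 \<Longrightarrow> S x = 1"
    "\<And>x. 0 \<le> S x" "\<And>x. S x \<le> 1" using smooth_step_exists by metis
  define good where "good x0 bVK \<longleftrightarrow> (case bVK of (b, V, K) \<Rightarrow> msmooth b \<and> (\<forall>x. 0 \<le> b x) \<and> openin (mtop M) V \<and> x0 \<in> V \<and>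
    (\<forall>x\<in>V. b x = 1) \<and> compactin (mtop M) K \<and> K \<subseteq> U \<and> (\<forall>x. x \<notin> K \<longrightarrow> b x = 0))" for x0 bVK
  have "\<forall>x0\<in>C. \<exists>bVK. good x0 bVK"
  proof
    fix x0 assume "x0 \<in> C"
    then have "x0 \<in> U" using U(2) by blast
    from bump_exists[OF this U(1)] obtain b V K where "good x0 (b, V, K)"
      unfolding good_def case_prod_conv by (elim exE)
    then show "\<exists>bVK. good x0 bVK" ..
  qed
  then obtain f where f: "\<forall>p\<in>C. good p (f p)" by (rule bchoice[THEN exE])
  define b V K where "b p = fst (f p)" and "V p = fst (snd (f p))" and "K p = snd (snd (f p))" for p
  have b: "\<And>p. p \<in> C \<Longrightarrow> msmooth (b p)" "\<And>p x. p \<in> C \<Longrightarrow> 0 \<le> b p x"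
    "\<And>p. p \<in> C \<Longrightarrow> openin (mtop M) (V p)" "\<And>p. p \<in> C \<Longrightarrow> p \<in> V p" "\<And>p x. p \<in> C \<Longrightarrow> x \<in> V p \<Longrightarrow> b p x = 1"
    "\<And>p. p \<in> C \<Longrightarrow> compactin (mtop M) (K p)" "\<And>p. p \<in> C \<Longrightarrow> K p \<subseteq> U" "\<And>p x. p \<in> C \<Longrightarrow> x \<notin> K p \<Longrightarrow> b p x = 0"
    using f by (auto simp: good_def b_def V_def K_def case_prod_unfold)
  have "\<exists>\<F>. finite \<F> \<and> \<F> \<subseteq> V ` C \<and> C \<subseteq> \<Union>\<F>"
    by (rule compactinD[OF C]) (use b(3,4) in auto)
  then obtain F where F: "finite F" "F \<subseteq> C" "C \<subseteq> (\<Union>p\<in>F. V p)"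
    by (metis finite_subset_image)
  define \<sigma> where "\<sigma> x = (\<Sum>p\<in>F. b p x)" for x
  have \<sigma>1: "\<sigma> x \<ge> 1" if "x \<in> V p" "p \<in> F" for x p
  proof -
    have "b p x \<le> \<sigma> x" unfolding \<sigma>_def
      by (rule member_le_sum) (use that F b(2) in auto)
    then show ?thesis using b(5)[of p x] that F by auto
  qed
  show thesis
  proof
    have "msmooth \<sigma>" unfolding \<sigma>_def by (rule msmooth_sum) (use b(1) F in auto)
    then show "msmooth (\<lambda>x. S (\<sigma> x))" by (rule msmooth_comp[OF _ S(1)])
    show "openin (mtop M) (\<Union>p\<in>F. V p)" using b(3) F by blast
    show "S (\<sigma> x) = 1" if "x \<in> (\<Union>p\<in>F. V p)" for x using that \<sigma>1 S(3) by auto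
    show "compactin (mtop M) (\<Union>p\<in>F. K p)" using compactin_Union[of "K ` F"] F b(6) by auto
    show "(\<Union>p\<in>F. K p) \<subseteq> U" using b(7) F by blast
    show "S (\<sigma> x) = 0" if "x \<notin> (\<Union>p\<in>F. K p)" for x
    proof -
      have "\<sigma> x = 0" unfolding \<sigma>_def by (rule sum.neutral) (use that b(8) F in auto)
      then show ?thesis by (simp add: S(2))
    qed
  qed (use S F in auto)
qed

end

section \<open>Hamiltonian vector fields\<close>

locale symp_mfd =
  fixes M :: "('a, 'e::euclidean_space) mfd" and \<omega> :: "('a, 'e) form2"
  assumes symplectic: "symplectic_manifold M \<omega>"

sublocale symp_mfd \<subseteq> smooth_mfd
  using symplectic by unfold_locales (simp add: symplectic_manifold_def)

context symp_mfd
begin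

lemma form_bilinear: "c \<in> atlas M \<Longrightarrow> y \<in> chart_image c \<Longrightarrow> bilinear (\<omega> c y)"
  using symplectic by (simp add: symplectic_manifold_def smooth_2form_def)

lemma form_alt: "c \<in> atlas M \<Longrightarrow> y \<in> chart_image c \<Longrightarrow> \<omega> c y v v = 0"
  using symplectic by (simp add: symplectic_manifold_def smooth_2form_def)

lemma form_smooth: "c \<in> atlas M \<Longrightarrow> smooth_on (chart_image c) (\<lambda>y. \<omega> c y v w)"
  using symplectic by (simp add: symplectic_manifold_def smooth_2form_def)

lemma form_transform:
  assumes "c \<in> atlas M" "d \<in> atlas M" "p \<in> fst c" "p \<in> fst d"
  shows "\<omega> c (snd c p) v w = \<omega> d (snd d p)
    (frechet_derivative (snd d \<circ> chart_inv c) (at (snd c p)) v) (frechet_derivative (snd d \<circ> chart_inv c) (at (snd c p)) w)"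
proof -
  have "\<forall>c\<in>atlas M. \<forall>d\<in>atlas M. \<forall>p\<in>fst c \<inter> fst d.
       let D = frechet_derivative (snd d \<circ> chart_inv c) (at (snd c p))
       in \<forall>v w. \<omega> c (snd c p) v w = \<omega> d (snd d p) (D v) (D w)"
    using symplectic by (simp add: symplectic_manifold_def smooth_2form_def)
  then show ?thesis using assms unfolding Let_def by blast
qed

lemma form_nondegenerate:
  assumes "c \<in> atlas M" "y \<in> chart_image c" "\<And>w. \<omega> c y v w = 0" shows "v = 0"
proof -
  have "nondegenerate_2form M \<omega>" using symplectic by (simp add: symplectic_manifold_def)
  then show ?thesis using assms unfolding nondegenerate_2form_def by blast
qed

lemma form_linear1: "c \<in> atlas M \<Longrightarrow> y \<in> chart_image c \<Longrightarrow> linear (\<lambda>v. \<omega> c y v w)"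
  using form_bilinear by (simp add: bilinear_def)

lemma form_linear2: "c \<in> atlas M \<Longrightarrow> y \<in> chart_image c \<Longrightarrow> linear (\<omega> c y v)"
  using form_bilinear by (simp add: bilinear_def)

lemma form_antisym:
  assumes "c \<in> atlas M" "y \<in> chart_image c" shows "\<omega> c y v w = - \<omega> c y w v"
proof -
  interpret l: linear "\<omega> c y (v + w)" using form_linear2 assms .
  interpret l1: linear "\<lambda>v'. \<omega> c y v' v" using form_linear1 assms .
  interpret l2: linear "\<lambda>v'. \<omega> c y v' w" using form_linear1 assms .
  have "0 = \<omega> c y (v + w) (v + w)" using form_alt assms by simp
  also have "\<dots> = \<omega> c y v v + \<omega> c y w v + (\<omega> c y v w + \<omega> c y w w)"
    by (simp only: l.add l1.add l2.add)
  finally show ?thesis using form_alt assms by simp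
qed

lemma form_expand2:
  assumes "c \<in> atlas M" "y \<in> chart_image c"
  shows "\<omega> c y v w = (\<Sum>b\<in>Basis. (w \<bullet> b) * \<omega> c y v b)"
proof -
  interpret l: linear "\<omega> c y v" using form_linear2 assms .
  have "\<omega> c y v w = \<omega> c y v (\<Sum>b\<in>Basis. (w \<bullet> b) *\<^sub>R b)" by (simp add: euclidean_representation)
  then show ?thesis by (simp add: l.sum l.scale)
qed

lemma form_expand1:
  assumes "c \<in> atlas M" "y \<in> chart_image c"
  shows "\<omega> c y v w = (\<Sum>b\<in>Basis. (v \<bullet> b) * \<omega> c y b w)"
proof -
  have "\<omega> c y v w = (\<Sum>b\<in>Basis. (v \<bullet> b) * - \<omega> c y w b)"
    unfolding form_antisym[OF assms, of v w] form_expand2[OF assms, of w v] by (simp add: sum_negf)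
  then show ?thesis unfolding form_antisym[OF assms, of _ w, symmetric] .
qed

lemma ham_vector_unique:
  assumes "c \<in> atlas M" "y \<in> chart_image c" "\<And>w. \<omega> c y v w = \<omega> c y v' w" shows "v = v'"
proof -
  interpret l1: linear "\<lambda>v. \<omega> c y v w" for w using form_linear1 assms(1,2) .
  have "\<omega> c y (v - v') w = 0" for w using l1.diff[of v v' w] assms(3) by simp
  then have "v - v' = 0" by (rule form_nondegenerate[OF assms(1,2)])
  then show ?thesis by simp
qed

text \<open>Nondegeneracy makes the map from v to the vector of the numbers \<omega>(v, b), b in the
  basis, injective, hence surjective by dimension.\<close>

lemma ham_vector_exists:
  assumes "c \<in> atlas M" "y \<in> chart_image c" "linear l"
  shows "\<exists>v. \<forall>w. \<omega> c y v w = - l w"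
proof -
  interpret l: linear l by fact
  interpret l1: linear "\<lambda>v. \<omega> c y v w" for w using form_linear1 assms(1,2) .
  define T where "T v = (\<Sum>b\<in>Basis. \<omega> c y v b *\<^sub>R b)" for v
  have Tb: "T v \<bullet> b = \<omega> c y v b" if "b \<in> Basis" for v b using that by (simp add: T_def)
  have "linear T" unfolding T_def
    by (rule linearI) (simp_all add: l1.add l1.scale scaleR_add_left sum.distrib scaleR_sum_right)
  moreover have "inj T"
  proof (rule injI)
    fix v v' assume "T v = T v'"
    then have "\<omega> c y v b = \<omega> c y v' b" if "b \<in> Basis" for b using Tb that by metis
    then have "\<omega> c y v w = \<omega> c y v' w" for w
      unfolding form_expand2[OF assms(1,2), of v w] form_expand2[OF assms(1,2), of v' w] by simp
    then show "v = v'" by (rule ham_vector_unique[OF assms(1,2)])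
  qed
  ultimately have "surj T" using linear_injective_imp_surjective by blast
  then obtain v where v: "T v = (\<Sum>b\<in>Basis. - l b *\<^sub>R b)" by (metis surjD)
  have "\<omega> c y v w = - l w" for w
  proof -
    have "\<omega> c y v b = - l b" if "b \<in> Basis" for b
      using Tb[OF that, of v] unfolding v inner_sum_left_Basis[OF that] by simp
    then have "\<omega> c y v w = (\<Sum>b\<in>Basis. (w \<bullet> b) * - l b)"
      unfolding form_expand2[OF assms(1,2), of v w] by simp
    also have "\<dots> = - l (\<Sum>b\<in>Basis. (w \<bullet> b) *\<^sub>R b)" by (simp add: l.sum l.scale sum_negf)
    finally show ?thesis by (simp add: euclidean_representation)
  qed
  then show ?thesis by blast
qed

lemma ham_vf_eq:
  assumes "c \<in> atlas M" "y \<in> chart_image c" "(h \<circ> chart_inv c) differentiable (at y)"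
  shows "\<omega> c y (ham_vf \<omega> h c y) w = - frechet_derivative (h \<circ> chart_inv c) (at y) w"
proof -
  have "linear (frechet_derivative (h \<circ> chart_inv c) (at y))"
    using assms(3) linear_frechet_derivative by blast
  from ham_vector_exists[OF assms(1,2) this] obtain v
    where v: "\<forall>w. \<omega> c y v w = - frechet_derivative (h \<circ> chart_inv c) (at y) w" by blast
  have "\<forall>w. \<omega> c y (ham_vf \<omega> h c y) w = - frechet_derivative (h \<circ> chart_inv c) (at y) w"
    unfolding ham_vf_def
    by (rule theI[where P = "\<lambda>v. \<forall>w. \<omega> c y v w = - frechet_derivative (h \<circ> chart_inv c) (at y) w" and a = v])
      (use v ham_vector_unique[OF assms(1,2)] in auto)
  then show ?thesis by blast
qed

lemma ham_vf_eqI: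
  assumes "c \<in> atlas M" "y \<in> chart_image c" "(h \<circ> chart_inv c) differentiable (at y)"
    "\<And>w. \<omega> c y v w = - frechet_derivative (h \<circ> chart_inv c) (at y) w"
  shows "ham_vf \<omega> h c y = v"
  by (rule ham_vector_unique[OF assms(1,2)]) (simp add: ham_vf_eq[OF assms(1-3)] assms(4))

text \<open>The differential of the coordinate change is invertible because it carries \<omega> to
  \<omega>: a vector in its kernel pairs to zero with everything. With surjectivity, every test
  vector in \<open>d\<close> comes from one in \<open>c\<close>, and the defining equation is
  transported.\<close>

lemma ham_vf_transform:
  assumes cd: "c \<in> atlas M" "d \<in> atlas M" "p \<in> fst c" "p \<in> fst d"
    and h: "(h \<circ> chart_inv d) differentiable (at (snd d p))"
  shows "ham_vf \<omega> h d (snd d p) =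
    frechet_derivative (snd d \<circ> chart_inv c) (at (snd c p)) (ham_vf \<omega> h c (snd c p))"
proof -
  let ?\<tau> = "snd d \<circ> chart_inv c" and ?y = "snd c p" and ?z = "snd d p"
  let ?D = "frechet_derivative ?\<tau> (at ?y)"
  let ?U = "snd c ` (fst c \<inter> fst d)"
  have U: "open ?U" "?y \<in> ?U" using open_chart_transport[OF cd(1) openin_chart[OF cd(2)]] cd by auto
  have \<tau>: "(?\<tau> has_derivative ?D) (at ?y)"
    using smooth_on_differentiable[OF smooth_transition[OF cd(1,2)] U(2)] frechet_derivative_works by blast
  have y: "?y \<in> chart_image c" "?z \<in> chart_image d" "?\<tau> ?y = ?z" using cd by auto
  let ?H = "frechet_derivative (h \<circ> chart_inv d) (at ?z)"
  have "((h \<circ> chart_inv d) has_derivative ?H) (at (?\<tau> ?y))"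
    unfolding y(3) using h frechet_derivative_works by blast
  from diff_chain_at[OF \<tau> this] have "((h \<circ> chart_inv d) \<circ> ?\<tau> has_derivative ?H \<circ> ?D) (at ?y)" .
  then have der: "(h \<circ> chart_inv c has_derivative ?H \<circ> ?D) (at ?y)"
    by (rule has_derivative_transform_within_open[OF _ U]) (use cd in auto)
  have diff: "(h \<circ> chart_inv c) differentiable (at ?y)" using der by (auto simp: differentiable_def)
  have lin: "linear ?D" using \<tau> has_derivative_linear by blast
  interpret D: linear ?D by fact
  have "inj ?D" unfolding linear_injective_0[OF lin]
  proof (intro allI impI)
    fix v assume "?D v = 0"
    interpret l1: linear "\<lambda>v. \<omega> d ?z v w" for w using form_linear1 cd(2) y(2) .
    show "v = 0" by (rule form_nondegenerate[OF cd(1) y(1)])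
      (simp add: form_transform[OF cd] \<open>?D v = 0\<close> l1.zero)
  qed
  then have surj: "surj ?D" using linear_injective_imp_surjective[OF lin] by blast
  show ?thesis
  proof (rule ham_vf_eqI[OF cd(2) y(2) h])
    fix w
    obtain w' where w': "w = ?D w'" using surj by (metis surjD)
    have "\<omega> d ?z (?D (ham_vf \<omega> h c ?y)) w = \<omega> c ?y (ham_vf \<omega> h c ?y) w'"
      unfolding w' by (rule form_transform[OF cd, symmetric])
    also have "\<dots> = - frechet_derivative (h \<circ> chart_inv c) (at ?y) w'" by (rule ham_vf_eq[OF cd(1) y(1) diff])
    also have "\<dots> = - ?H w" using frechet_derivative_at[OF der] w' by (metis comp_apply)
    finally show "\<omega> d ?z (?D (ham_vf \<omega> h c ?y)) w = - ?H w" .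
  qed
qed

text \<open>Only the differentials at the single point \<open>y\<close> are compared. This
  generality matters for the cutoff \<open>\<theta>\<close>, whose contribution is discarded at
  points where it is merely critical and possibly not locally constant.\<close>

lemma ham_vf_scale:
  assumes "c \<in> atlas M" "y \<in> chart_image c" "(h \<circ> chart_inv c) differentiable (at y)"
    "(g \<circ> chart_inv c) differentiable (at y)"
    "\<And>w. frechet_derivative (g \<circ> chart_inv c) (at y) w = r * frechet_derivative (h \<circ> chart_inv c) (at y) w"
  shows "ham_vf \<omega> g c y = r *\<^sub>R ham_vf \<omega> h c y"
proof (rule ham_vf_eqI[OF assms(1,2,4)])
  fix w
  interpret l1: linear "\<lambda>v. \<omega> c y v w" using form_linear1 assms(1,2) .
  show "\<omega> c y (r *\<^sub>R ham_vf \<omega> h c y) w = - frechet_derivative (g \<circ> chart_inv c) (at y) w"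
    by (simp add: l1.scale ham_vf_eq[OF assms(1-3)] assms(5))
qed

end

section \<open>Ordinary differential equations in Euclidean space\<close>

text \<open>Contraction principle among bounded continuous functions on the line. The initial time
  \<open>s\<close> may be interior, so two integrals from \<open>a\<close> are subtracted; each
  changes by at most a quarter of the distance, whence the 4 in the hypothesis and the contraction
  factor 1/2.\<close>

lemma picard_fixed_point:
  fixes W :: "real \<Rightarrow> 'e::euclidean_space \<Rightarrow> 'e"
  assumes ab: "a \<le> s" "s \<le> b" and L: "0 \<le> L" "4 * (L * (b - a)) \<le> 1"
    and lip: "\<And>t y z. t \<in> {a..b} \<Longrightarrow> norm (W t y - W t z) \<le> L * norm (y - z)"
    and bd: "\<And>t y. t \<in> {a..b} \<Longrightarrow> norm (W t y) \<le> B"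
    and cont: "\<And>f. continuous_on {a..b} f \<Longrightarrow> continuous_on {a..b} (\<lambda>t. W t (f t))"
  shows "\<exists>u. continuous_on {a..b} u \<and> (\<forall>t\<in>{a..b}. u t = y + integral {a..t} (\<lambda>\<tau>. W \<tau> (u \<tau>))
    - integral {a..s} (\<lambda>\<tau>. W \<tau> (u \<tau>)))"
proof -
  have ab': "a \<le> b" using ab by simp
  \<comment> \<open>Clamping time to [a, b] turns functions on the interval into functions on the
    line.\<close>
  define cl where "cl t = max a (min b t)" for t
  have cl: "cl t \<in> {a..b}" for t using ab by (auto simp: cl_def)
  have cl_id: "cl t = t" if "t \<in> {a..b}" for t using that by (auto simp: cl_def)
  define J where "J f t = integral {a..t} (\<lambda>\<tau>. W \<tau> (f \<tau>))" for f :: "real \<Rightarrow> 'e" and t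
  define T where "T f t = y + J f (cl t) - J f s" for f :: "real \<Rightarrow> 'e" and t
  have Jcont: "continuous_on {a..b} (J f)" if "continuous_on {a..b} f" for f
    unfolding J_def by (intro indefinite_integral_continuous_1 integrable_continuous_real cont that)
  have sub: "continuous_on {a..t} (\<lambda>\<tau>. W \<tau> (f \<tau>))" if "continuous_on {a..b} f" "t \<in> {a..b}" for f t
    by (rule continuous_on_subset[OF cont[OF that(1)]]) (use that in auto)
  have B0: "0 \<le> B" using bd[of a y] ab' norm_ge_zero[of "W a y"] by (simp add: order_trans[OF norm_ge_zero])
  have Jbd: "norm (J f t) \<le> B * (b - a)" if "continuous_on {a..b} f" "t \<in> {a..b}" for f t
  proof -
    have "norm (J f t) \<le> B * (t - a)" unfolding J_def
      by (rule integral_bound[OF _ sub[OF that]]) (use that bd in auto)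
    also have "\<dots> \<le> B * (b - a)" using that B0 by (intro mult_left_mono) auto
    finally show ?thesis .
  qed
  have Tb: "T f \<in> bcontfun" if "continuous_on {a..b} f" for f
  proof (rule bcontfun_normI)
    have "continuous_on UNIV cl" unfolding cl_def by (intro continuous_intros)
    then have "continuous_on UNIV (\<lambda>t. J f (cl t))"
      by (rule continuous_on_compose2[OF Jcont[OF that]]) (use cl in blast)
    then show "continuous_on UNIV (T f)" unfolding T_def by (intro continuous_intros)
    fix t
    have "norm (T f t) \<le> norm y + norm (J f (cl t)) + norm (J f s)"
      unfolding T_def by (meson add_mono_thms_linordered_semiring(3) norm_triangle_ineq norm_triangle_ineq4 order_trans)
    also have "\<dots> \<le> norm y + B * (b - a) + B * (b - a)"
      using Jbd[OF that cl[of t]] Jbd[OF that, of s] ab by simp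
    finally show "norm (T f t) \<le> norm y + B * (b - a) + B * (b - a)" .
  qed
  define P where "P F = Bcontfun (T (apply_bcontfun F))" for F :: "real \<Rightarrow>\<^sub>C 'e"
  have Papp: "apply_bcontfun (P F) = T (apply_bcontfun F)" for F
    unfolding P_def by (rule Bcontfun_inverse[OF Tb]) simp
  have "dist (P F) (P G) \<le> 1/2 * dist F G" for F G
  proof (rule dist_bound)
    fix t
    let ?d = "dist F G"
    have Jd: "norm (J F t - J G t) \<le> ?d / 4" if t: "t \<in> {a..b}" for t
    proof -
      have c: "continuous_on {a..t} (\<lambda>\<tau>. W \<tau> (F \<tau>))" "continuous_on {a..t} (\<lambda>\<tau>. W \<tau> (G \<tau>))"
        by (rule sub[OF _ t], simp)+
      have "J F t - J G t = integral {a..t} (\<lambda>\<tau>. W \<tau> (F \<tau>) - W \<tau> (G \<tau>))"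
        unfolding J_def by (rule integral_diff[symmetric]) (rule integrable_continuous_real, fact)+
      also have "norm \<dots> \<le> (L * ?d) * (t - a)"
      proof (rule integral_bound)
        show "continuous_on {a..t} (\<lambda>\<tau>. W \<tau> (F \<tau>) - W \<tau> (G \<tau>))" by (intro continuous_on_diff c)
        fix \<tau> assume "\<tau> \<in> {a..t}"
        then have "norm (W \<tau> (F \<tau>) - W \<tau> (G \<tau>)) \<le> L * norm (F \<tau> - G \<tau>)" using lip t by auto
        also have "\<dots> \<le> L * ?d" using dist_bounded[of F \<tau> G] L(1) by (intro mult_left_mono) (auto simp: dist_norm)
        finally show "norm (W \<tau> (F \<tau>) - W \<tau> (G \<tau>)) \<le> L * ?d" .
      qed (use t in auto)
      also have "\<dots> \<le> (L * ?d) * (b - a)" using t L(1) by (intro mult_left_mono) auto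
      also have "\<dots> = (L * (b - a)) * ?d" by simp
      also have "\<dots> \<le> (1/4) * ?d" using L(2) by (intro mult_right_mono) auto
      finally show ?thesis by simp
    qed
    have "dist (P F t) (P G t) = norm ((J F (cl t) - J G (cl t)) - (J F s - J G s))"
      by (simp add: Papp T_def dist_norm algebra_simps)
    also have "\<dots> \<le> norm (J F (cl t) - J G (cl t)) + norm (J F s - J G s)" by (rule norm_triangle_ineq4)
    also have "\<dots> \<le> ?d / 4 + ?d / 4" using Jd[OF cl[of t]] Jd[of s] ab by simp
    finally show "dist (P F t) (P G t) \<le> 1/2 * ?d" by simp
  qed
  then have "\<exists>!F. P F = F" by (intro banach_fix_type[of "1/2"]) auto
  then obtain F where F: "P F = F" by blast
  show ?thesis
  proof (intro exI[of _ "apply_bcontfun F"] conjI ballI)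
    fix t assume t: "t \<in> {a..b}"
    have "F t = T F t" using Papp[of F] F by simp
    then show "F t = y + integral {a..t} (\<lambda>\<tau>. W \<tau> (F \<tau>)) - integral {a..s} (\<lambda>\<tau>. W \<tau> (F \<tau>))"
      by (simp add: T_def J_def cl_id[OF t])
  qed simp
qed

text \<open>The field is first replaced by its composition with the nearest-point projection to the
  ball, which does not increase distances, so that it becomes globally Lipschitz and bounded. Over a
  short time the solution moves by at most r, remains in the larger ball, and there solves the
  original equation. The length \<open>d\<close> is uniform in \<open>y\<close> and in the position
  of \<open>s\<close>, as later gluing requires.\<close>

lemma picard_local:
  fixes V :: "real \<Rightarrow> 'e::euclidean_space \<Rightarrow> 'e"
  assumes lip: "L-lipschitz_on ({A..B} \<times> cball y0 (2 * r)) (\<lambda>(t, y). V t y)" and r: "r > 0"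
  shows "\<exists>d>0. \<forall>a b s y. A \<le> a \<longrightarrow> a \<le> s \<longrightarrow> s \<le> b \<longrightarrow> b \<le> B \<longrightarrow> b - a < d \<longrightarrow> y \<in> cball y0 r \<longrightarrow>
    (\<exists>u. u s = y \<and> (\<forall>t\<in>{a..b}. u t \<in> cball y0 (2 * r) \<and> (u has_vector_derivative V t (u t)) (at t within {a..b})))"
proof -
  define C where "C = cball y0 (2 * r)"
  have C: "convex C" "closed C" "C \<noteq> {}" "y0 \<in> C" using r by (auto simp: C_def)
  have L0: "0 \<le> L" using lip lipschitz_on_nonneg by blast
  have lip': "norm (V t y - V t' z) \<le> L * norm ((t, y) - (t', z))" if "t \<in> {A..B}" "t' \<in> {A..B}" "y \<in> C" "z \<in> C" for t t' y z
    using lipschitz_onD[OF lip, of "(t, y)" "(t', z)"] that by (simp add: C_def dist_norm)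
  define M where "M = norm (V A y0) + L * ((B - A) + 2 * r)"
  have bd: "norm (V t y) \<le> M" if "t \<in> {A..B}" "y \<in> C" for t y
  proof -
    have "norm (V t y - V A y0) \<le> L * norm ((t, y) - (A, y0))" using that C by (intro lip') auto
    also have "norm ((t, y) - (A, y0)) \<le> norm (t - A) + norm (y - y0)"
      using norm_Pair_le[of "t - A" "y - y0"] by simp
    also have "\<dots> \<le> (B - A) + 2 * r" using that by (auto simp: C_def dist_norm norm_minus_commute)
    finally have "norm (V t y - V A y0) \<le> L * ((B - A) + 2 * r)" using L0 by (simp add: mult_left_mono)
    then show ?thesis using norm_triangle_ineq2[of "V t y" "V A y0"] unfolding M_def by linarith
  qed
  define W where "W t y = V t (closest_point C y)" for t y
  have cpC: "closest_point C y \<in> C" for y using closest_point_in_set C by blast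
  \<comment> \<open>The first bound makes the iteration contract, the second keeps each of the two
    integrals below r/2. Adding 1 avoids division by zero.\<close>
  define d where "d = min (1 / (4 * (L + 1))) (r / (2 * (\<bar>M\<bar> + 1)))"
  have d0: "d > 0" using L0 r by (simp add: d_def)
  show ?thesis
  proof (rule exI[of _ d], intro conjI d0 allI impI)
    fix a b s y
    assume ab: "A \<le> a" "a \<le> s" "s \<le> b" "b \<le> B" "b - a < d" and y: "y \<in> cball y0 r"
    have AB: "t \<in> {A..B}" if "t \<in> {a..b}" for t using that ab by auto
    have "L * (b - a) \<le> (L + 1) * (1 / (4 * (L + 1)))"
      using ab L0 by (intro mult_mono) (auto simp: d_def)
    also have "\<dots> = 1 / 4" using L0 by simp
    finally have Ld: "4 * (L * (b - a)) \<le> 1" by simp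
    have "(\<bar>M\<bar> + 1) * (b - a) \<le> (\<bar>M\<bar> + 1) * (r / (2 * (\<bar>M\<bar> + 1)))"
      using ab by (intro mult_left_mono) (auto simp: d_def)
    also have "\<dots> = r / 2"
    proof -
      have "m * (r / (2 * m)) = r / 2" if "m > 0" for m using that by simp
      then show ?thesis by (metis abs_ge_zero add_nonneg_pos zero_less_one)
    qed
    finally have Md: "2 * ((\<bar>M\<bar> + 1) * (b - a)) \<le> r" by simp
    have contW: "continuous_on {a..b} (\<lambda>t. W t (f t))" if f: "continuous_on {a..b} f" for f
    proof -
      have "continuous_on {a..b} (\<lambda>t. closest_point C (f t))"
        using continuous_on_compose2[OF continuous_on_closest_point[OF C(1-3)] f subset_UNIV] .
      then have "continuous_on {a..b} (\<lambda>t. (t, closest_point C (f t)))" by (intro continuous_on_Pair continuous_on_id)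
      from continuous_on_compose2[OF lipschitz_on_continuous_on[OF lip] this]
      show ?thesis unfolding W_def using AB cpC by (force simp: C_def)
    qed
    have "\<exists>u. continuous_on {a..b} u \<and> (\<forall>t\<in>{a..b}. u t = y + integral {a..t} (\<lambda>\<tau>. W \<tau> (u \<tau>))
      - integral {a..s} (\<lambda>\<tau>. W \<tau> (u \<tau>)))"
    proof (rule picard_fixed_point[OF ab(2,3) L0 Ld])
      fix t y z assume "t \<in> {a..b}"
      then have "norm (W t y - W t z) \<le> L * norm (closest_point C y - closest_point C z)"
        using lip'[of t t "closest_point C y" "closest_point C z"] AB cpC by (simp add: W_def)
      also have "\<dots> \<le> L * norm (y - z)"
        using closest_point_lipschitz[OF C(1-3), of y z] L0 by (intro mult_left_mono) (auto simp: dist_norm)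
      finally show "norm (W t y - W t z) \<le> L * norm (y - z)" .
    next
      fix t y assume "t \<in> {a..b}"
      then show "norm (W t y) \<le> M" unfolding W_def using bd AB cpC by blast
    qed (rule contW)
    then obtain u where u: "continuous_on {a..b} u" "\<And>t. t \<in> {a..b} \<Longrightarrow> u t = y + integral {a..t} (\<lambda>\<tau>. W \<tau> (u \<tau>))
      - integral {a..s} (\<lambda>\<tau>. W \<tau> (u \<tau>))" by blast
    have J: "norm (integral {a..t} (\<lambda>\<tau>. W \<tau> (u \<tau>))) \<le> (\<bar>M\<bar> + 1) * (b - a)" if t: "t \<in> {a..b}" for t
    proof -
      have "norm (integral {a..t} (\<lambda>\<tau>. W \<tau> (u \<tau>))) \<le> (\<bar>M\<bar> + 1) * (t - a)"
      proof (rule integral_bound)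
        show "continuous_on {a..t} (\<lambda>\<tau>. W \<tau> (u \<tau>))"
          by (rule continuous_on_subset[OF contW[OF u(1)]]) (use t in auto)
        fix \<tau> assume "\<tau> \<in> {a..t}"
        then have "norm (W \<tau> (u \<tau>)) \<le> M" unfolding W_def using bd[OF AB cpC] t by auto
        then show "norm (W \<tau> (u \<tau>)) \<le> \<bar>M\<bar> + 1" by simp
      qed (use t in auto)
      also have "\<dots> \<le> (\<bar>M\<bar> + 1) * (b - a)" using t by (intro mult_left_mono) auto
      finally show ?thesis .
    qed
    have uC: "u t \<in> C" if t: "t \<in> {a..b}" for t
    proof -
      have "norm (u t - y0) = norm ((y - y0) + (integral {a..t} (\<lambda>\<tau>. W \<tau> (u \<tau>)) - integral {a..s} (\<lambda>\<tau>. W \<tau> (u \<tau>))))"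
        by (subst u(2)[OF t]) (simp add: algebra_simps)
      also have "\<dots> \<le> norm (y - y0) + (norm (integral {a..t} (\<lambda>\<tau>. W \<tau> (u \<tau>))) + norm (integral {a..s} (\<lambda>\<tau>. W \<tau> (u \<tau>))))"
        by (rule order_trans[OF norm_triangle_ineq]) (rule add_left_mono, rule norm_triangle_ineq4)
      also have "\<dots> \<le> r + r" using J[OF t] J[of s] ab Md y by (auto simp: dist_norm norm_minus_commute)
      finally show ?thesis by (simp add: C_def dist_norm norm_minus_commute)
    qed
    have ud: "(u has_vector_derivative V t (u t)) (at t within {a..b})" if t: "t \<in> {a..b}" for t
    proof (rule has_vector_derivative_transform[OF t])
      show "u t = y - integral {a..s} (\<lambda>\<tau>. W \<tau> (u \<tau>)) + integral {a..t} (\<lambda>\<tau>. W \<tau> (u \<tau>))" if "t \<in> {a..b}" for t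
        using u(2)[OF that] by simp
      have "((\<lambda>t. integral {a..t} (\<lambda>\<tau>. W \<tau> (u \<tau>))) has_vector_derivative W t (u t)) (at t within {a..b})"
        by (rule integral_has_vector_derivative[OF contW[OF u(1)] t])
      then have "((\<lambda>t. (y - integral {a..s} (\<lambda>\<tau>. W \<tau> (u \<tau>))) + integral {a..t} (\<lambda>\<tau>. W \<tau> (u \<tau>)))
          has_vector_derivative 0 + W t (u t)) (at t within {a..b})"
        by (rule has_vector_derivative_add[OF has_vector_derivative_const])
      then show "((\<lambda>t. y - integral {a..s} (\<lambda>\<tau>. W \<tau> (u \<tau>)) + integral {a..t} (\<lambda>\<tau>. W \<tau> (u \<tau>)))
          has_vector_derivative V t (u t)) (at t within {a..b})"
        by (simp add: W_def closest_point_self[OF uC[OF t]])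
    qed
    show "\<exists>u. u s = y \<and> (\<forall>t\<in>{a..b}. u t \<in> cball y0 (2 * r) \<and> (u has_vector_derivative V t (u t)) (at t within {a..b}))"
      using uC ud u(2)[of s] ab by (intro exI[of _ u]) (auto simp: C_def)
  qed
qed

text \<open>Multiplied by exp (- A (t - a)), the function e + B/A is nonincreasing.\<close>

lemma gronwall:
  fixes e e' :: "real \<Rightarrow> real"
  assumes ab: "a \<le> b" and cont: "continuous_on {a..b} e"
    and der: "\<And>t. a < t \<Longrightarrow> t < b \<Longrightarrow> (e has_real_derivative e' t) (at t)"
    and le: "\<And>t. a < t \<Longrightarrow> t < b \<Longrightarrow> e' t \<le> A * e t + B" and A: "A > 0"
  shows "e b + B / A \<le> (e a + B / A) * exp (A * (b - a))"
proof -
  define g where "g t = (e t + B / A) * exp (- (A * (t - a)))" for t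
  have "g a \<ge> g b"
  proof (rule DERIV_nonpos_imp_decreasing_open[OF ab])
    show "continuous_on {a..b} g" unfolding g_def by (intro continuous_intros cont)
    fix t assume t: "a < t" "t < b"
    let ?E = "exp (- (A * (t - a)))"
    have "(g has_real_derivative (e' t * ?E + (e t + B / A) * (- A * ?E))) (at t)"
      unfolding g_def using der[OF t] by (auto intro!: derivative_eq_intros)
    moreover have "e' t * ?E + (e t + B / A) * (- A * ?E) = (e' t - (A * e t + B)) * ?E"
      using A by (simp add: field_simps)
    moreover have "(e' t - (A * e t + B)) * ?E \<le> 0"
      using le[OF t] by (intro mult_nonpos_nonneg) auto
    ultimately show "\<exists>y. (g has_real_derivative y) (at t) \<and> y \<le> 0" by metis
  qed
  then have "(e b + B / A) * exp (- (A * (b - a))) \<le> e a + B / A" by (simp add: g_def)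
  then have "(e b + B / A) * exp (- (A * (b - a))) * exp (A * (b - a)) \<le> (e a + B / A) * exp (A * (b - a))"
    by (rule mult_right_mono) simp
  then show ?thesis by (simp add: mult.assoc exp_add[symmetric])
qed

text \<open>The squared distance is used because the distance itself need not be differentiable
  where the curves meet. Splitting 2 n \<epsilon> \<le> n^2 + \<epsilon>^2 gives the rate 2 L + 1
  and the inhomogeneity \<epsilon>^2.\<close>

lemma perturbed_ode_estimate:
  fixes y g V :: "real \<Rightarrow> 'e::euclidean_space"
  assumes ab: "a \<le> b" and cy: "continuous_on {a..b} y" and cg: "continuous_on {a..b} g"
    and dy: "\<And>t. a < t \<Longrightarrow> t < b \<Longrightarrow> (y has_vector_derivative y' t) (at t)"
    and dg: "\<And>t. a < t \<Longrightarrow> t < b \<Longrightarrow> (g has_vector_derivative g' t) (at t)"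
    and le: "\<And>t. a < t \<Longrightarrow> t < b \<Longrightarrow> norm (y' t - g' t) \<le> L * norm (y t - g t) + \<epsilon>" and L: "L \<ge> 0"
  shows "(norm (y b - g b))\<^sup>2 \<le> ((norm (y a - g a))\<^sup>2 + \<epsilon>\<^sup>2) * exp ((2 * L + 1) * (b - a))"
proof -
  define e where "e t = (y t - g t) \<bullet> (y t - g t)" for t
  have e: "e t = (norm (y t - g t))\<^sup>2" for t by (simp add: e_def power2_norm_eq_inner)
  let ?e' = "\<lambda>t. 2 * ((y t - g t) \<bullet> (y' t - g' t))"
  have "e b + \<epsilon>\<^sup>2 / (2 * L + 1) \<le> (e a + \<epsilon>\<^sup>2 / (2 * L + 1)) * exp ((2 * L + 1) * (b - a))"
  proof (rule gronwall[OF ab])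
    show "continuous_on {a..b} e" unfolding e_def by (intro continuous_intros cy cg)
    fix t assume t: "a < t" "t < b"
    have "((\<lambda>t. y t - g t) has_vector_derivative (y' t - g' t)) (at t)"
      by (intro has_vector_derivative_diff dy dg t)
    then have "((\<lambda>t. y t - g t) has_derivative (\<lambda>h. h *\<^sub>R (y' t - g' t))) (at t)"
      by (simp add: has_vector_derivative_def)
    from has_derivative_inner[OF this this]
    have "(e has_derivative (\<lambda>h. (y t - g t) \<bullet> (h *\<^sub>R (y' t - g' t)) + (h *\<^sub>R (y' t - g' t)) \<bullet> (y t - g t))) (at t)"
      unfolding e_def .
    moreover have "(\<lambda>h. (y t - g t) \<bullet> (h *\<^sub>R (y' t - g' t)) + (h *\<^sub>R (y' t - g' t)) \<bullet> (y t - g t)) = (*) (?e' t)"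
      by (intro ext) (simp add: inner_commute algebra_simps)
    ultimately show "(e has_real_derivative ?e' t) (at t)" unfolding has_field_derivative_def by simp
    let ?n = "norm (y t - g t)"
    have "?e' t \<le> 2 * (?n * (L * ?n + \<epsilon>))"
      using norm_cauchy_schwarz[of "y t - g t" "y' t - g' t"] mult_left_mono[OF le[OF t] norm_ge_zero[of "y t - g t"]]
      by linarith
    also have "\<dots> = 2 * L * ?n\<^sup>2 + 2 * ?n * \<epsilon>" by (simp add: power2_eq_square algebra_simps)
    also have "\<dots> \<le> 2 * L * ?n\<^sup>2 + (?n\<^sup>2 + \<epsilon>\<^sup>2)" using sum_squares_bound[of ?n \<epsilon>] by simp
    also have "\<dots> = (2 * L + 1) * e t + \<epsilon>\<^sup>2" unfolding e by (simp add: algebra_simps)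
    finally show "?e' t \<le> (2 * L + 1) * e t + \<epsilon>\<^sup>2" .
  qed (use L in auto)
  moreover have "\<epsilon>\<^sup>2 / (2 * L + 1) \<ge> 0" "\<epsilon>\<^sup>2 / (2 * L + 1) \<le> \<epsilon>\<^sup>2"
    using L by (auto simp: divide_le_eq mult_le_cancel_left1)
  moreover have "(e a + \<epsilon>\<^sup>2 / (2 * L + 1)) * exp ((2 * L + 1) * (b - a)) \<le> (e a + \<epsilon>\<^sup>2) * exp ((2 * L + 1) * (b - a))"
    using calculation(3) by (intro mult_right_mono) auto
  ultimately show ?thesis unfolding e[symmetric] by linarith
qed

section \<open>Time-dependent Hamiltonians and Lipschitz bounds for their vector fields\<close>

context symp_mfd
begin

text \<open>Time runs through the line and not the circle, since Hamiltonians are going to be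
  reparametrised and reversed in time.\<close>

definition tsmooth :: "(real \<Rightarrow> 'a \<Rightarrow> real) \<Rightarrow> bool"
  where "tsmooth h \<longleftrightarrow> (\<forall>c\<in>atlas M. smooth_on (UNIV \<times> chart_image c) (\<lambda>(t, y). h t (chart_inv c y)))"

lemma tsmooth_msmooth: assumes "tsmooth h" shows "msmooth (h t)"
  unfolding msmooth_def
proof
  fix c assume c: "c \<in> atlas M"
  have "smooth_on (chart_image c) (\<lambda>y. (\<lambda>(t, y). h t (chart_inv c y)) (t, y))"
  proof (rule smooth_on_compose[OF open_chart_image[OF c] open_Times[OF open_UNIV open_chart_image[OF c]]])
    show "smooth_on (chart_image c) (\<lambda>y. (t, y))"
      by (intro smooth_on_Pair open_chart_image c smooth_on_const smooth_on_id)
    show "smooth_on (UNIV \<times> chart_image c) (\<lambda>(t, y). h t (chart_inv c y))"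
      using assms c unfolding tsmooth_def by blast
  qed auto
  then show "smooth_on (chart_image c) (h t \<circ> chart_inv c)" by (simp add: o_def)
qed

lemma tsmooth_differentiable:
  "tsmooth h \<Longrightarrow> c \<in> atlas M \<Longrightarrow> y \<in> chart_image c \<Longrightarrow> (h t \<circ> chart_inv c) differentiable (at y)"
  using msmooth_differentiable tsmooth_msmooth by blast

text \<open>The spatial derivative in direction b is the full derivative in direction (0, b), and so
  inherits joint smoothness in time and space.\<close>

lemma smooth_on_space_derivative:
  assumes "tsmooth h" "c \<in> atlas M"
  shows "smooth_on (UNIV \<times> chart_image c) (\<lambda>(t, y). frechet_derivative (h t \<circ> chart_inv c) (at y) b)"
proof -
  let ?F = "\<lambda>(t, y). h t (chart_inv c y)"
  have o: "open (UNIV \<times> chart_image c)" using open_chart_image[OF assms(2)] by (intro open_Times) auto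
  have F: "smooth_on (UNIV \<times> chart_image c) ?F" using assms unfolding tsmooth_def by blast
  have "frechet_derivative (h t \<circ> chart_inv c) (at y) b = frechet_derivative ?F (at (t, y)) (0, b)"
    if y: "y \<in> chart_image c" for t y
  proof -
    have "(?F has_derivative frechet_derivative ?F (at (t, y))) (at (t, y))"
      using smooth_on_differentiable[OF F, of "(t, y)"] y frechet_derivative_works by blast
    moreover have "((\<lambda>y. (t, y)) has_derivative (\<lambda>v. (0, v))) (at y)"
      by (auto intro!: derivative_eq_intros)
    ultimately have "(?F \<circ> (\<lambda>y. (t, y)) has_derivative frechet_derivative ?F (at (t, y)) \<circ> (\<lambda>v. (0, v))) (at y)"
      by (intro diff_chain_at) 
    moreover have "?F \<circ> (\<lambda>y. (t, y)) = h t \<circ> chart_inv c" by (auto simp: o_def)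
    ultimately have "frechet_derivative ?F (at (t, y)) \<circ> (\<lambda>v. (0, v)) = frechet_derivative (h t \<circ> chart_inv c) (at y)"
      using frechet_derivative_at by metis
    then show ?thesis by (metis comp_apply)
  qed
  then show ?thesis
    by (intro smooth_on_cong[OF o _ smooth_on_frechet[OF F, of "(0, b)"]]) auto
qed

text \<open>Quantitative nondegeneracy: a continuous function that is positive on the compact set K
  times the unit sphere has a positive minimum, and homogeneity extends the bound to all
  vectors.\<close>

lemma form_lower_bound:
  assumes c: "c \<in> atlas M" and K: "compact K" "K \<subseteq> chart_image c"
  shows "\<exists>\<kappa>>0. \<forall>y\<in>K. \<forall>v. \<kappa> * norm v \<le> (\<Sum>b\<in>Basis. \<bar>\<omega> c y v b\<bar>)"
proof (cases "K = {}")
  case True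
  then show ?thesis by (intro exI[of _ 1]) auto
next
  case False
  \<comment> \<open>Expanded in the first slot, because continuity in y is known for the
    coefficients with both vectors fixed.\<close>
  define \<phi> where "\<phi> = (\<lambda>(y, v::'e). \<Sum>b\<in>Basis. \<bar>\<Sum>b'\<in>Basis. (v \<bullet> b') * \<omega> c y b' b\<bar>)"
  have \<phi>: "\<phi> (y, v) = (\<Sum>b\<in>Basis. \<bar>\<omega> c y v b\<bar>)" if "y \<in> K" for y v
    unfolding \<phi>_def using that K(2) form_expand1[OF c, of y v] by (auto intro!: sum.cong)
  have "continuous_on (K \<times> sphere 0 1) \<phi>"
  proof -
    have "continuous_on (K \<times> sphere 0 1) (\<lambda>x. \<omega> c (fst x) b' b)" for b' b
      by (rule continuous_on_compose2[OF smooth_on_continuous[OF form_smooth[OF c]] continuous_on_fst[OF continuous_on_id]])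
        (use K in auto)
    then show ?thesis unfolding \<phi>_def case_prod_unfold by (intro continuous_intros)
  qed
  moreover have "compact (K \<times> sphere (0::'e) 1)" and "K \<times> sphere (0::'e) 1 \<noteq> {}"
    using K False by (auto intro: compact_Times)
  ultimately obtain x where "x \<in> K \<times> sphere 0 1" "\<forall>z\<in>K \<times> sphere 0 1. \<phi> x \<le> \<phi> z"
    using continuous_attains_inf[of "K \<times> sphere (0::'e) 1" \<phi>] by blast
  moreover obtain y0 v0 where "x = (y0, v0)" by fastforce
  ultimately have m: "y0 \<in> K" "norm v0 = 1" "\<And>y v. y \<in> K \<Longrightarrow> norm v = 1 \<Longrightarrow> \<phi> (y0, v0) \<le> \<phi> (y, v)"
    by auto
  define \<kappa> where "\<kappa> = \<phi> (y0, v0)"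
  have y0: "y0 \<in> chart_image c" using m K by auto
  have "\<kappa> \<ge> 0" unfolding \<kappa>_def \<phi>[OF m(1)] by (simp add: sum_nonneg)
  moreover have "\<kappa> \<noteq> 0"
  proof
    assume "\<kappa> = 0"
    then have "\<omega> c y0 v0 b = 0" if "b \<in> Basis" for b
      using that unfolding \<kappa>_def \<phi>[OF m(1)] by (simp add: sum_nonneg_eq_0_iff)
    then have "\<omega> c y0 v0 w = 0" for w unfolding form_expand2[OF c y0, of v0 w] by simp
    then have "v0 = 0" by (rule form_nondegenerate[OF c y0])
    then show False using m(2) by simp
  qed
  ultimately have "\<kappa> > 0" by simp
  moreover have "\<kappa> * norm v \<le> (\<Sum>b\<in>Basis. \<bar>\<omega> c y v b\<bar>)" if y: "y \<in> K" for y v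
  proof (cases "v = 0")
    case True
    then show ?thesis by (simp add: sum_nonneg)
  next
    case False
    let ?u = "(1 / norm v) *\<^sub>R v"
    have yc: "y \<in> chart_image c" using y K by auto
    have "\<kappa> \<le> (\<Sum>b\<in>Basis. \<bar>\<omega> c y ?u b\<bar>)" using m(3)[OF y, of ?u] False unfolding \<phi>[OF y] \<kappa>_def by simp
    also have "\<dots> = (\<Sum>b\<in>Basis. \<bar>\<omega> c y v b\<bar> / norm v)"
      using linear_scale[OF form_linear1[OF c yc], of "1 / norm v" v] by (simp add: abs_mult)
    also have "\<dots> = (\<Sum>b\<in>Basis. \<bar>\<omega> c y v b\<bar>) / norm v" by (simp add: sum_divide_distrib)
    finally show ?thesis using False by (simp add: field_simps)
  qed
  ultimately show ?thesis by blast
qed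

text \<open>The defining equations at two points are subtracted: \<omega>_y applied to the
  difference of the field values is the variation of dh minus the variation of the form at a fixed
  vector. Both are Lipschitz, and the lower bound for \<omega> converts this into a bound for the
  difference itself.\<close>

lemma ham_vf_lipschitz:
  assumes h: "tsmooth h" and c: "c \<in> atlas M" and K: "compact K" "convex K" "K \<subseteq> chart_image c"
  shows "\<exists>L. L-lipschitz_on ({A..B} \<times> K) (\<lambda>(t, y). ham_vf \<omega> (h t) c y)"
proof -
  define V where "V t y = ham_vf \<omega> (h t) c y" for t y
  define D where "D b = (\<lambda>(t, y). frechet_derivative (h t \<circ> chart_inv c) (at y) b)" for b
  let ?Q = "{A..B} \<times> K"
  have Q: "compact ?Q" "convex ?Q" "?Q \<subseteq> UNIV \<times> chart_image c"
    using K by (auto intro: compact_Times convex_Times)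
  have Vw: "\<omega> c y (V t y) b = - D b (t, y)" if "y \<in> K" for t y b
    unfolding V_def D_def using ham_vf_eq[OF c _ tsmooth_differentiable[OF h c]] that K(3) by auto
  obtain \<kappa> where \<kappa>: "\<kappa> > 0" "\<And>y v. y \<in> K \<Longrightarrow> \<kappa> * norm v \<le> (\<Sum>b\<in>Basis. \<bar>\<omega> c y v b\<bar>)"
    using form_lower_bound[OF c K(1,3)] by blast
  have Ds: "smooth_on (UNIV \<times> chart_image c) (D b)" for b
    unfolding D_def by (rule smooth_on_space_derivative[OF h c])
  have "\<exists>L. L-lipschitz_on ?Q (D b)" for b by (rule smooth_on_lipschitz[OF Ds Q])
  then obtain LD where LD: "\<And>b. (LD b)-lipschitz_on ?Q (D b)" by metis
  have "\<exists>L. L-lipschitz_on K (\<lambda>y. \<omega> c y b' b)" for b' b by (rule smooth_on_lipschitz[OF form_smooth[OF c] K])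
  then obtain LW where LW: "\<And>b' b. (LW b' b)-lipschitz_on K (\<lambda>y. \<omega> c y b' b)" by metis
  have "\<exists>m. \<forall>p\<in>?Q. norm (D b p) \<le> m" for b
  proof -
    have "compact (D b ` ?Q)"
      by (rule compact_continuous_image[OF continuous_on_subset[OF smooth_on_continuous[OF Ds] Q(3)] Q(1)])
    then show ?thesis using compact_imp_bounded by (force simp: bounded_iff)
  qed
  then obtain m where m: "\<And>b p. p \<in> ?Q \<Longrightarrow> norm (D b p) \<le> m b" by metis
  define M0 where "M0 = \<bar>\<Sum>b\<in>Basis. m b\<bar> / \<kappa>"
  have M0: "norm (V t y) \<le> M0" if "t \<in> {A..B}" "y \<in> K" for t y
  proof -
    have "\<kappa> * norm (V t y) \<le> (\<Sum>b\<in>Basis. \<bar>D b (t, y)\<bar>)" using \<kappa>(2)[OF that(2), of "V t y"] by (simp add: Vw[OF that(2)])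
    also have "\<dots> \<le> (\<Sum>b\<in>Basis. m b)" using m[of "(t, y)"] that by (intro sum_mono) auto
    finally show ?thesis using \<kappa>(1) unfolding M0_def by (simp add: field_simps)
  qed
  define L where "L = (\<Sum>b\<in>Basis. LD b + M0 * (\<Sum>b'\<in>Basis. LW b' b)) / \<kappa>"
  have M00: "M0 \<ge> 0" using \<kappa>(1) by (simp add: M0_def)
  have LD0: "0 \<le> LD b" and LW0: "0 \<le> LW b' b" for b b'
    using LD LW lipschitz_on_nonneg by blast+
  have "L-lipschitz_on ?Q (\<lambda>(t, y). V t y)"
  proof (rule lipschitz_onI)
    show "0 \<le> L" unfolding L_def using \<kappa>(1) M00 LD0 LW0 by (intro divide_nonneg_pos sum_nonneg add_nonneg_nonneg mult_nonneg_nonneg) auto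
    fix p q assume "p \<in> ?Q" "q \<in> ?Q"
    then obtain t y t' z where p: "p = (t, y)" "q = (t', z)" "t \<in> {A..B}" "t' \<in> {A..B}" "y \<in> K" "z \<in> K" by auto
    have yc: "y \<in> chart_image c" "z \<in> chart_image c" using p K by auto
    let ?V = "V t y" and ?V' = "V t' z"
    have *: "\<bar>\<omega> c y (?V - ?V') b\<bar> \<le> (LD b + M0 * (\<Sum>b'\<in>Basis. LW b' b)) * dist p q" if b: "b \<in> Basis" for b
    proof -
      have e: "\<omega> c y (?V - ?V') b = (D b q - D b p) - (\<omega> c y ?V' b - \<omega> c z ?V' b)"
        using linear_diff[OF form_linear1[OF c yc(1)], of ?V ?V' b] Vw[of y t b] Vw[of z t' b] p by simp
      have "\<bar>D b q - D b p\<bar> \<le> LD b * dist p q"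
        using lipschitz_onD[OF LD, of q p b] \<open>p \<in> ?Q\<close> \<open>q \<in> ?Q\<close> by (simp add: dist_real_def dist_commute)
      moreover have "\<bar>\<omega> c y ?V' b - \<omega> c z ?V' b\<bar> \<le> (M0 * (\<Sum>b'\<in>Basis. LW b' b)) * dist p q"
      proof -
        have "\<omega> c y ?V' b - \<omega> c z ?V' b = (\<Sum>b'\<in>Basis. (?V' \<bullet> b') * (\<omega> c y b' b - \<omega> c z b' b))"
          unfolding form_expand1[OF c yc(1), of ?V' b] form_expand1[OF c yc(2), of ?V' b]
          by (simp add: sum_subtractf right_diff_distrib)
        also have "\<bar>\<dots>\<bar> \<le> (\<Sum>b'\<in>Basis. M0 * (LW b' b * dist p q))"
        proof (rule order_trans[OF sum_abs], rule sum_mono)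
          fix b' :: 'e assume b': "b' \<in> Basis"
          have "\<bar>?V' \<bullet> b'\<bar> \<le> M0" using Basis_le_norm[OF b', of ?V'] M0[OF p(4,6)] by simp
          moreover have "\<bar>\<omega> c y b' b - \<omega> c z b' b\<bar> \<le> LW b' b * dist p q"
          proof -
            have "\<bar>\<omega> c y b' b - \<omega> c z b' b\<bar> \<le> LW b' b * dist y z"
              using lipschitz_onD[OF LW, of y z b' b] p by (simp add: dist_real_def)
            also have "\<dots> \<le> LW b' b * dist p q"
              using dist_snd_le[of p q] LW0 p by (intro mult_left_mono) auto
            finally show ?thesis .
          qed
          ultimately show "\<bar>(?V' \<bullet> b') * (\<omega> c y b' b - \<omega> c z b' b)\<bar> \<le> M0 * (LW b' b * dist p q)"
            unfolding abs_mult using M00 by (intro mult_mono) auto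
        qed
        also have "\<dots> = (M0 * (\<Sum>b'\<in>Basis. LW b' b)) * dist p q" by (simp add: sum_distrib_left sum_distrib_right mult.assoc)
        finally show ?thesis .
      qed
      ultimately show ?thesis unfolding e distrib_right by linarith
    qed
    have "\<kappa> * norm (?V - ?V') \<le> (\<Sum>b\<in>Basis. \<bar>\<omega> c y (?V - ?V') b\<bar>)" using \<kappa>(2) p by blast
    also have "\<dots> \<le> (\<Sum>b\<in>Basis. (LD b + M0 * (\<Sum>b'\<in>Basis. LW b' b)) * dist p q)" by (rule sum_mono) (rule *)
    also have "\<dots> = (\<kappa> * L) * dist p q" using \<kappa>(1) by (simp add: L_def sum_distrib_right)
    finally have "norm (?V - ?V') \<le> L * dist p q" using \<kappa>(1) by (simp add: mult.assoc)
    then show "dist (case p of (t, y) \<Rightarrow> V t y) (case q of (t, y) \<Rightarrow> V t y) \<le> L * dist p q"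
      by (simp add: p dist_norm)
  qed
  then show ?thesis unfolding V_def by blast
qed

end

section \<open>Hamiltonian curves: stability and uniqueness\<close>

lemma eventually_interval_nbhd:
  fixes t0 :: real
  assumes "openin (top_of_set T) S" "t0 \<in> S"
  shows "\<exists>d>0. \<forall>t\<in>T. \<bar>t - t0\<bar> < d \<longrightarrow> t \<in> S"
proof -
  obtain U where U: "open U" "S = T \<inter> U" using assms(1) openin_open by blast
  then obtain d where "d > 0" "\<And>t. dist t t0 < d \<Longrightarrow> t \<in> U" using assms(2) by (metis IntD2 open_dist)
  then show ?thesis using U(2) by (auto simp: dist_real_def)
qed

context symp_mfd
begin

text \<open>For \<open>T = UNIV\<close> this is \<^const>\<open>ham_curve\<close>.\<close>

definition sol :: "(real \<Rightarrow> 'a \<Rightarrow> real) \<Rightarrow> real set \<Rightarrow> (real \<Rightarrow> 'a) \<Rightarrow> bool"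
  where "sol h T x \<longleftrightarrow> continuous_map (top_of_set T) (mtop M) x \<and>
    (\<forall>t\<in>T. \<forall>c\<in>atlas M. x t \<in> fst c \<longrightarrow>
      (snd c \<circ> x has_vector_derivative ham_vf \<omega> (h t) c (snd c (x t))) (at t within T))"

lemma sol_continuous: "sol h T x \<Longrightarrow> continuous_map (top_of_set T) (mtop M) x"
  by (simp add: sol_def)

lemma sol_derivative:
  "sol h T x \<Longrightarrow> t \<in> T \<Longrightarrow> c \<in> atlas M \<Longrightarrow> x t \<in> fst c \<Longrightarrow>
    (snd c \<circ> x has_vector_derivative ham_vf \<omega> (h t) c (snd c (x t))) (at t within T)"
  by (simp add: sol_def)

lemma sol_mem: assumes "sol h T x" "t \<in> T" shows "x t \<in> topspace (mtop M)"
  using continuous_map_funspace[OF sol_continuous[OF assms(1)]] assms(2) by auto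

lemma sol_subset:
  assumes "sol h T x" "S \<subseteq> T" shows "sol h S x"
proof -
  have "continuous_map (top_of_set S) (mtop M) x"
    using continuous_map_from_subtopology_mono[OF sol_continuous[OF assms(1)] assms(2)] .
  then show ?thesis
    using sol_derivative[OF assms(1)] has_vector_derivative_within_subset assms(2) unfolding sol_def by blast
qed

lemma sol_openin:
  assumes "continuous_map (top_of_set T) (mtop M) x" "openin (mtop M) U"
  shows "openin (top_of_set T) {t \<in> T. x t \<in> U}"
  using openin_continuous_map_preimage[OF assms] by simp

lemma sol_chart_continuous:
  assumes x: "continuous_map (top_of_set T) (mtop M) x" and c: "c \<in> atlas M"
    and S: "S \<subseteq> T" "\<And>t. t \<in> S \<Longrightarrow> x t \<in> fst c"
  shows "continuous_on S (snd c \<circ> x)"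
proof -
  have "continuous_map (top_of_set S) (mtop M) x"
    using continuous_map_from_subtopology_mono[OF x S(1)] .
  then have "continuous_map (top_of_set S) (subtopology (mtop M) (fst c)) x"
    by (rule continuous_map_into_subtopology) (use S in auto)
  from continuous_map_compose[OF this continuous_chart[OF c]]
  have "continuous_map (top_of_set S) euclidean (snd c \<circ> x)" by (rule continuous_map_into_fulltopology)
  then show ?thesis by simp
qed

section \<open>Stability of solutions under small perturbations\<close>

lemma ham_vf_add:
  assumes "c \<in> atlas M" "y \<in> chart_image c" "msmooth h" "msmooth \<beta>"
  shows "ham_vf \<omega> (\<lambda>p. h p + s * \<beta> p) c y = ham_vf \<omega> h c y + s *\<^sub>R ham_vf \<omega> \<beta> c y"
proof (rule ham_vf_eqI[OF assms(1,2)])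
  let ?h = "h \<circ> chart_inv c" and ?b = "\<beta> \<circ> chart_inv c"
  have d: "?h differentiable (at y)" "?b differentiable (at y)"
    using msmooth_differentiable assms by blast+
  have eq: "(\<lambda>p. h p + s * \<beta> p) \<circ> chart_inv c = (\<lambda>y. ?h y + s * ?b y)" by (simp add: o_def)
  have D: "((\<lambda>y. ?h y + s * ?b y) has_derivative
     (\<lambda>w. frechet_derivative ?h (at y) w + s * frechet_derivative ?b (at y) w)) (at y)"
    using d unfolding frechet_derivative_works by (intro has_derivative_add has_derivative_mult_right)
  then show "((\<lambda>p. h p + s * \<beta> p) \<circ> chart_inv c) differentiable (at y)"
    unfolding eq by (auto simp: differentiable_def)
  fix w
  interpret l: linear "\<lambda>v. \<omega> c y v w" using form_linear1 assms(1,2) .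
  show "\<omega> c y (ham_vf \<omega> h c y + s *\<^sub>R ham_vf \<omega> \<beta> c y) w
    = - frechet_derivative ((\<lambda>p. h p + s * \<beta> p) \<circ> chart_inv c) (at y) w"
    unfolding eq frechet_derivative_at[OF D, symmetric]
    by (simp add: l.add l.scale ham_vf_eq[OF assms(1,2) d(1)] ham_vf_eq[OF assms(1,2) d(2)])
qed

lemma tsmooth_const: "msmooth \<beta> \<Longrightarrow> tsmooth (\<lambda>_. \<beta>)"
  unfolding tsmooth_def
proof
  fix c assume b: "msmooth \<beta>" and c: "c \<in> atlas M"
  have "smooth_on (UNIV \<times> chart_image c) (\<lambda>p. (\<beta> \<circ> chart_inv c) (snd p))"
  proof (rule smooth_on_linear_arg[OF _ bounded_linear_snd _ open_chart_image[OF c]])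
    show "smooth_on (chart_image c) (\<beta> \<circ> chart_inv c)" using b c unfolding msmooth_def by blast
  qed (auto intro!: open_Times open_chart_image[OF c])
  then show "smooth_on (UNIV \<times> chart_image c) (\<lambda>(t, y). \<beta> (chart_inv c y))"
    by (simp add: case_prod_unfold)
qed

lemma msmooth_const: "msmooth (\<lambda>_. k)"
  by (simp add: msmooth_def o_def smooth_on_const)

text \<open>Continuity, at the starting point of \<gamma> and at s = 0, of the end point as a
  function of the starting point and of s. It is phrased for arbitrary solutions \<open>x\<close>,
  without presupposing a flow, so that uniqueness can be deduced from it.\<close>

definition stable :: "(real \<Rightarrow> 'a \<Rightarrow> real) \<Rightarrow> ('a \<Rightarrow> real) \<Rightarrow> (real \<Rightarrow> 'a) \<Rightarrow> real \<Rightarrow> real \<Rightarrow> bool"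
  where "stable h \<beta> \<gamma> a b \<longleftrightarrow> (\<forall>W. openin (mtop M) W \<longrightarrow> \<gamma> b \<in> W \<longrightarrow>
    (\<exists>V \<eta>. openin (mtop M) V \<and> \<gamma> a \<in> V \<and> \<eta> > 0 \<and>
      (\<forall>s x. \<bar>s\<bar> \<le> \<eta> \<longrightarrow> sol (\<lambda>t p. h t p + s * \<beta> p) {a..b} x \<longrightarrow> x a \<in> V \<longrightarrow> x b \<in> W)))"

lemma stableE:
  assumes "stable h \<beta> \<gamma> a b" "openin (mtop M) W" "\<gamma> b \<in> W"
  obtains V \<eta> where "openin (mtop M) V" "\<gamma> a \<in> V" "\<eta> > 0"
    "\<forall>s x. \<bar>s\<bar> \<le> \<eta> \<longrightarrow> sol (\<lambda>t p. h t p + s * \<beta> p) {a..b} x \<longrightarrow> x a \<in> V \<longrightarrow> x b \<in> W"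
  using assms(1)[unfolded stable_def, rule_format, OF assms(2,3)] by (elim exE conjE) (rule that)

text \<open>A continuity argument: as long as \<open>x\<close> stays in the chart within \<rho> of
  \<gamma>, the Gronwall estimate improves this to \<rho>/2, so there is no first time at which the
  bound \<rho> fails.\<close>

lemma stable_in_chart:
  assumes h: "tsmooth h" and \<beta>: "msmooth \<beta>" and \<gamma>: "sol h {a..b} \<gamma>" and ab: "a \<le> b"
    and c: "c \<in> atlas M" and r: "r > 0" "cball y0 (2 * r) \<subseteq> chart_image c"
    and \<gamma>r: "\<And>t. t \<in> {a..b} \<Longrightarrow> \<gamma> t \<in> fst c \<and> snd c (\<gamma> t) \<in> ball y0 r"
  shows "stable h \<beta> \<gamma> a b"
  unfolding stable_def
proof (intro allI impI)
  fix W assume W: "openin (mtop M) W" "\<gamma> b \<in> W"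
  define K where "K = cball y0 (2 * r)"
  have K: "compact K" "convex K" "K \<subseteq> chart_image c" using r(2) by (auto simp: K_def)
  define g where "g t = snd c (\<gamma> t)" for t
  have gK: "g t \<in> ball y0 r" if "t \<in> {a..b}" for t using \<gamma>r that by (simp add: g_def)
  obtain L where L: "L-lipschitz_on ({a..b} \<times> K) (\<lambda>(t, y). ham_vf \<omega> (h t) c y)"
    using ham_vf_lipschitz[OF h c K] by blast
  have L0: "L \<ge> 0" using L lipschitz_on_nonneg by blast
  obtain L' where L': "L'-lipschitz_on ({0..0} \<times> K) (\<lambda>(t::real, y). ham_vf \<omega> \<beta> c y)"
    using ham_vf_lipschitz[OF tsmooth_const[OF \<beta>] c K] by blast
  define B where "B = norm (ham_vf \<omega> \<beta> c y0) + L' * (2 * r)"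
  have B: "norm (ham_vf \<omega> \<beta> c y) \<le> B" if "y \<in> K" for y
  proof -
    have "dist (ham_vf \<omega> \<beta> c y) (ham_vf \<omega> \<beta> c y0) \<le> L' * dist (0::real, y) (0, y0)"
      using lipschitz_onD[OF L', of "(0, y)" "(0, y0)"] that r(1) by (simp add: K_def)
    also have "\<dots> \<le> L' * (2 * r)" using that lipschitz_on_nonneg[OF L']
      by (intro mult_left_mono) (auto simp: K_def dist_Pair_Pair dist_commute)
    finally show ?thesis using norm_triangle_ineq2[of "ham_vf \<omega> \<beta> c y" "ham_vf \<omega> \<beta> c y0"]
      unfolding B_def dist_norm by linarith
  qed
  have B0: "B \<ge> 0" using order_trans[OF norm_ge_zero B[of y0]] r(1) by (simp add: K_def)
  have "g b \<in> snd c ` (fst c \<inter> W)" using \<gamma>r[of b] ab W(2) by (auto simp: g_def)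
  then obtain \<rho>' where \<rho>': "\<rho>' > 0" "ball (g b) \<rho>' \<subseteq> snd c ` (fst c \<inter> W)"
    using open_chart_transport[OF c W(1)] open_contains_ball by blast
  \<comment> \<open>The curve \<gamma> keeps within r of \<open>y0\<close>; with \<rho> \<le> r
    anything \<rho>-close to it remains in \<open>K\<close>, where the Lipschitz constants are
    valid.\<close>
  define \<rho> where "\<rho> = min \<rho>' r"
  have \<rho>: "\<rho> > 0" "\<rho> \<le> r" "ball (g b) \<rho> \<subseteq> snd c ` (fst c \<inter> W)" using \<rho>' r(1) by (auto simp: \<rho>_def)
  define X where "X = exp ((2 * L + 1) * (b - a))"
  have X: "X \<ge> 1" using L0 ab by (simp add: X_def)
  \<comment> \<open>Both the initial distance and the perturbation are kept below \<delta>, so the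
    squared distance grows to at most 2 \<delta>^2 X = \<rho>^2 / (8 X), which is below
    (\<rho>/2)^2. The choice of \<eta> makes s times the field of \<beta> at most \<delta>.\<close>
  define \<delta> where "\<delta> = \<rho> / (4 * X)"
  define \<eta> where "\<eta> = \<delta> / (B + 1)"
  have \<delta>: "\<delta> > 0" using \<rho>(1) X by (simp add: \<delta>_def)
  have \<eta>: "\<eta> > 0" "\<eta> * B \<le> \<delta>" using \<delta> B0 by (auto simp: \<eta>_def field_simps)
  have \<delta>X: "(\<delta>\<^sup>2 + \<delta>\<^sup>2) * X \<le> (\<rho> / 2)\<^sup>2"
  proof -
    have "(\<delta>\<^sup>2 + \<delta>\<^sup>2) * X = \<rho>\<^sup>2 / (8 * X)" using X by (simp add: \<delta>_def power2_eq_square field_simps)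
    also have "\<dots> \<le> \<rho>\<^sup>2 / 8" using X \<rho>(1) by (intro divide_left_mono) auto
    also have "\<dots> \<le> (\<rho> / 2)\<^sup>2" by (simp add: power2_eq_square)
    finally show ?thesis .
  qed
  have \<delta>\<rho>: "\<delta> < \<rho>" using \<rho>(1) X by (simp add: \<delta>_def field_simps)
  let ?V = "{p \<in> fst c. snd c p \<in> ball (g a) \<delta>}"
  show "\<exists>V \<eta>. openin (mtop M) V \<and> \<gamma> a \<in> V \<and> \<eta> > 0 \<and>
      (\<forall>s x. \<bar>s\<bar> \<le> \<eta> \<longrightarrow> sol (\<lambda>t p. h t p + s * \<beta> p) {a..b} x \<longrightarrow> x a \<in> V \<longrightarrow> x b \<in> W)"
  proof (intro exI[of _ ?V] exI[of _ \<eta>] conjI allI impI)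
    show "openin (mtop M) ?V" by (rule openin_chart_vimage[OF c open_ball])
    show "\<gamma> a \<in> ?V" using \<gamma>r[of a] ab \<delta> by (simp add: g_def)
    show "\<eta> > 0" by (rule \<eta>(1))
    fix s x assume s: "\<bar>s\<bar> \<le> \<eta>" and x: "sol (\<lambda>t p. h t p + s * \<beta> p) {a..b} x" and xa: "x a \<in> ?V"
    define y where "y t = snd c (x t)" for t
    define P where "P t \<longleftrightarrow> x t \<in> fst c \<and> norm (y t - g t) < \<rho>" for t
    have gc: "continuous_on {a..b} g"
      using sol_chart_continuous[OF sol_continuous[OF \<gamma>] c order_refl] \<gamma>r by (simp add: g_def[abs_def] o_def)
    have yc: "continuous_on S y" if "S \<subseteq> {a..b}" "\<And>t. t \<in> S \<Longrightarrow> x t \<in> fst c" for S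
      using sol_chart_continuous[OF sol_continuous[OF x] c that] by (simp add: y_def[abs_def] o_def)
    have yK: "y t \<in> K" if "P t" "t \<in> {a..b}" for t
    proof -
      have "dist (g t) (y t) < r" "dist y0 (g t) < r"
        using that gK[of t] \<rho>(2) by (auto simp: P_def dist_norm norm_minus_commute)
      then show ?thesis using dist_triangle[of y0 "y t" "g t"] by (simp add: K_def)
    qed
    have est: "norm (y t - g t) \<le> \<rho> / 2" if t: "t \<in> {a..b}" and Pt: "\<And>\<tau>. a \<le> \<tau> \<Longrightarrow> \<tau> \<le> t \<Longrightarrow> P \<tau>" for t
    proof -
      have "(norm (y t - g t))\<^sup>2 \<le> ((norm (y a - g a))\<^sup>2 + \<delta>\<^sup>2) * exp ((2 * L + 1) * (t - a))"
      proof (rule perturbed_ode_estimate[where y' = "\<lambda>t. ham_vf \<omega> (\<lambda>p. h t p + s * \<beta> p) c (y t)"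
            and g' = "\<lambda>t. ham_vf \<omega> (h t) c (g t)"])
        show "continuous_on {a..t} y" by (rule yc) (use t Pt in \<open>auto simp: P_def\<close>)
        show "continuous_on {a..t} g" by (rule continuous_on_subset[OF gc]) (use t in auto)
        fix \<tau> assume \<tau>: "a < \<tau>" "\<tau> < t"
        then have \<tau>': "\<tau> \<in> {a..b}" "at \<tau> within {a..b} = at \<tau>" using t
          by (auto simp: at_within_Icc_at)
        have P\<tau>: "P \<tau>" using Pt \<tau> by simp
        show "(y has_vector_derivative ham_vf \<omega> (\<lambda>p. h \<tau> p + s * \<beta> p) c (y \<tau>)) (at \<tau>)"
          using sol_derivative[OF x \<tau>'(1) c] P\<tau> unfolding \<tau>'(2) by (simp add: P_def y_def[abs_def] o_def)
        show "(g has_vector_derivative ham_vf \<omega> (h \<tau>) c (g \<tau>)) (at \<tau>)"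
          using sol_derivative[OF \<gamma> \<tau>'(1) c] \<gamma>r[OF \<tau>'(1)] unfolding \<tau>'(2) by (simp add: g_def[abs_def] o_def)
        have yK': "y \<tau> \<in> K" by (rule yK[OF P\<tau> \<tau>'(1)])
        have gK': "g \<tau> \<in> K" using gK[OF \<tau>'(1)] r(1) by (auto simp: K_def)
        have yc': "y \<tau> \<in> chart_image c" using yK' K by auto
        have "ham_vf \<omega> (\<lambda>p. h \<tau> p + s * \<beta> p) c (y \<tau>) - ham_vf \<omega> (h \<tau>) c (g \<tau>)
          = (ham_vf \<omega> (h \<tau>) c (y \<tau>) - ham_vf \<omega> (h \<tau>) c (g \<tau>)) + s *\<^sub>R ham_vf \<omega> \<beta> c (y \<tau>)"
          by (simp add: ham_vf_add[OF c yc' tsmooth_msmooth[OF h] \<beta>])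
        also have "norm \<dots> \<le> norm (ham_vf \<omega> (h \<tau>) c (y \<tau>) - ham_vf \<omega> (h \<tau>) c (g \<tau>)) + norm (s *\<^sub>R ham_vf \<omega> \<beta> c (y \<tau>))"
          by (rule norm_triangle_ineq)
        also have "\<dots> \<le> L * norm (y \<tau> - g \<tau>) + \<delta>"
        proof (rule add_mono)
          show "norm (ham_vf \<omega> (h \<tau>) c (y \<tau>) - ham_vf \<omega> (h \<tau>) c (g \<tau>)) \<le> L * norm (y \<tau> - g \<tau>)"
            using lipschitz_onD[OF L, of "(\<tau>, y \<tau>)" "(\<tau>, g \<tau>)"] yK' gK' \<tau>'(1) by (simp add: dist_norm dist_Pair_Pair)
          have "norm (s *\<^sub>R ham_vf \<omega> \<beta> c (y \<tau>)) \<le> \<eta> * B"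
            using s B[OF yK'] \<eta>(1) by (simp add: mult_mono)
          then show "norm (s *\<^sub>R ham_vf \<omega> \<beta> c (y \<tau>)) \<le> \<delta>" using \<eta>(2) by simp
        qed
        finally show "norm (ham_vf \<omega> (\<lambda>p. h \<tau> p + s * \<beta> p) c (y \<tau>) - ham_vf \<omega> (h \<tau>) c (g \<tau>)) \<le> L * norm (y \<tau> - g \<tau>) + \<delta>" .
      qed (use t L0 in auto)
      also have "\<dots> \<le> (\<delta>\<^sup>2 + \<delta>\<^sup>2) * X"
      proof (rule mult_mono)
        have "norm (y a - g a) < \<delta>" using xa by (simp add: y_def dist_norm norm_minus_commute)
        then show "(norm (y a - g a))\<^sup>2 + \<delta>\<^sup>2 \<le> \<delta>\<^sup>2 + \<delta>\<^sup>2" by (intro add_right_mono power_mono) auto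
        show "exp ((2 * L + 1) * (t - a)) \<le> X" unfolding X_def using t L0 by (intro exp_mono mult_left_mono) auto
      qed auto
      also have "\<dots> \<le> (\<rho> / 2)\<^sup>2" by (rule \<delta>X)
      finally show ?thesis by (rule power2_le_imp_le) (use \<rho>(1) in simp)
    qed
    have Popen: "openin (top_of_set {a..b}) {t \<in> {a..b}. P t}"
    proof -
      let ?S = "{t \<in> {a..b}. x t \<in> fst c}"
      have S: "openin (top_of_set {a..b}) ?S" by (rule sol_openin[OF sol_continuous[OF x] openin_chart[OF c]])
      have "continuous_on ?S y" by (rule yc) auto
      moreover have "continuous_on ?S g" by (rule continuous_on_subset[OF gc]) auto
      ultimately have "continuous_on ?S (\<lambda>t. norm (y t - g t))" by (intro continuous_intros)
      then have "openin (top_of_set ?S) (?S \<inter> (\<lambda>t. norm (y t - g t)) -` {..<\<rho>})"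
        by (rule continuous_openin_preimage_gen) auto
      moreover have "?S \<inter> (\<lambda>t. norm (y t - g t)) -` {..<\<rho>} = {t \<in> {a..b}. P t}" by (auto simp: P_def)
      ultimately show ?thesis using openin_trans[OF _ S] by simp
    qed
    have "\<forall>t\<in>{a..b}. P t"
    proof (rule ccontr)
      assume "\<not> (\<forall>t\<in>{a..b}. P t)"
      \<comment> \<open>The good times form a relatively open set, so a nonempty set of bad times is
        compact and has a least element.\<close>
      define Z where "Z = {a..b} - {t \<in> {a..b}. P t}"
      have "closedin (top_of_set {a..b}) Z" unfolding Z_def using Popen by (simp add: closedin_diff)
      then have "compact Z" using closedin_compact compact_Icc by blast
      moreover have "Z \<noteq> {}" using \<open>\<not> (\<forall>t\<in>{a..b}. P t)\<close> by (auto simp: Z_def)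
      ultimately obtain t1 where t1: "t1 \<in> Z" "\<And>t. t \<in> Z \<Longrightarrow> t1 \<le> t" using compact_attains_inf by metis
      have t1': "t1 \<in> {a..b}" "\<not> P t1" using t1(1) by (auto simp: Z_def)
      have before: "P t" if "a \<le> t" "t < t1" for t using t1(2)[of t] that t1' by (auto simp: Z_def)
      have "P a" using xa \<delta>\<rho> by (auto simp: P_def y_def dist_norm norm_minus_commute)
      then have "a < t1" using t1' by (cases "t1 = a") auto
      have est': "norm (y t - g t) \<le> \<rho> / 2" if "t \<in> {a..<t1}" for t
        using est[of t] before that t1'(1) by auto
      have "t1 \<in> closure {a..<t1}" using \<open>a < t1\<close> by simp
      \<comment> \<open>At \<open>t1\<close> itself \<open>x\<close> might have left the chart. It
        has not: before \<open>t1\<close> it lies in the compact image of \<open>K\<close>, which is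
        closed in M by the Hausdorff property.\<close>
      have "x t1 \<in> chart_inv c ` K"
      proof -
        have cl: "closedin (top_of_set {a..b}) {t \<in> {a..b}. x t \<in> chart_inv c ` K}"
          using closedin_continuous_map_preimage[OF sol_continuous[OF x] closedin_chart_inv[OF c K(1,3)]] by simp
        then have "closed {t \<in> {a..b}. x t \<in> chart_inv c ` K}" using closedin_closed_trans by blast
        moreover have "{a..<t1} \<subseteq> {t \<in> {a..b}. x t \<in> chart_inv c ` K}"
        proof
          fix t assume t: "t \<in> {a..<t1}"
          then have "P t" "t \<in> {a..b}" using before t1' by auto
          then have "x t = chart_inv c (y t)" "y t \<in> K" using yK c by (auto simp: P_def y_def)
          then show "t \<in> {t \<in> {a..b}. x t \<in> chart_inv c ` K}" using \<open>t \<in> {a..b}\<close> by blast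
        qed
        ultimately have "closure {a..<t1} \<subseteq> {t \<in> {a..b}. x t \<in> chart_inv c ` K}" by (rule closure_minimal[rotated])
        then show ?thesis using \<open>t1 \<in> closure {a..<t1}\<close> by blast
      qed
      then have xt1: "x t1 \<in> fst c" using K(3) chart_inv_mem[OF c] by auto
      have "continuous_on {a..t1} y"
      proof (rule yc)
        fix t assume "t \<in> {a..t1}"
        then show "x t \<in> fst c" using before[of t] xt1 by (cases "t = t1") (auto simp: P_def)
      qed (use t1' in auto)
      moreover have "continuous_on {a..t1} g" by (rule continuous_on_subset[OF gc]) (use t1' in auto)
      ultimately have "continuous_on (closure {a..<t1}) (\<lambda>t. norm (y t - g t))"
        using \<open>a < t1\<close> by (auto intro!: continuous_intros)
      then have "norm (y t1 - g t1) \<le> \<rho> / 2"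
        by (rule continuous_le_on_closure[OF _ \<open>t1 \<in> closure {a..<t1}\<close> est'])
      then show False using t1'(2) xt1 \<rho>(1) by (simp add: P_def)
    qed
    then have "P b" using ab by simp
    then have "y b \<in> snd c ` (fst c \<inter> W)" using \<rho>(3) by (auto simp: P_def dist_norm norm_minus_commute subset_iff)
    then obtain p where p: "p \<in> fst c" "p \<in> W" "snd c p = snd c (x b)" by (auto simp: y_def)
    then have "p = x b" using inj_chart[OF c] \<open>P b\<close> by (auto simp: P_def inj_on_def)
    then show "x b \<in> W" using p by simp
  qed
qed

text \<open>Stability passes to the concatenation of adjacent intervals and holds on short
  intervals, where \<gamma> stays in one chart; bisection spreads it over the whole
  interval.\<close>

lemma stable_solution:
  assumes h: "tsmooth h" and \<beta>: "msmooth \<beta>" and \<gamma>: "sol h {A..B} \<gamma>" and AB: "A \<le> B"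
  shows "stable h \<beta> \<gamma> A B"
proof -
  have "A \<le> A \<longrightarrow> B \<le> B \<longrightarrow> stable h \<beta> \<gamma> A B"
    using AB
  proof (rule Bolzano[where P = "\<lambda>a b. A \<le> a \<longrightarrow> b \<le> B \<longrightarrow> stable h \<beta> \<gamma> a b"])
    fix a b c
    assume 1: "A \<le> a \<longrightarrow> b \<le> B \<longrightarrow> stable h \<beta> \<gamma> a b" and 2: "A \<le> b \<longrightarrow> c \<le> B \<longrightarrow> stable h \<beta> \<gamma> b c"
      and abc: "a \<le> b" "b \<le> c"
    show "A \<le> a \<longrightarrow> c \<le> B \<longrightarrow> stable h \<beta> \<gamma> a c"
      unfolding stable_def
    proof (intro impI allI)
      fix W assume "A \<le> a" "c \<le> B" and W: "openin (mtop M) W" "\<gamma> c \<in> W"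
      then have st: "stable h \<beta> \<gamma> a b" "stable h \<beta> \<gamma> b c" using 1 2 abc by auto
      obtain V \<eta> where V: "openin (mtop M) V" "\<gamma> b \<in> V" "\<eta> > 0"
        "\<forall>s x. \<bar>s\<bar> \<le> \<eta> \<longrightarrow> sol (\<lambda>t p. h t p + s * \<beta> p) {b..c} x \<longrightarrow> x b \<in> V \<longrightarrow> x c \<in> W"
        by (rule stableE[OF st(2) W])
      obtain V' \<eta>' where V': "openin (mtop M) V'" "\<gamma> a \<in> V'" "\<eta>' > 0"
        "\<forall>s x. \<bar>s\<bar> \<le> \<eta>' \<longrightarrow> sol (\<lambda>t p. h t p + s * \<beta> p) {a..b} x \<longrightarrow> x a \<in> V' \<longrightarrow> x b \<in> V"
        by (rule stableE[OF st(1) V(1,2)])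
      show "\<exists>V \<eta>. openin (mtop M) V \<and> \<gamma> a \<in> V \<and> \<eta> > 0 \<and>
        (\<forall>s x. \<bar>s\<bar> \<le> \<eta> \<longrightarrow> sol (\<lambda>t p. h t p + s * \<beta> p) {a..c} x \<longrightarrow> x a \<in> V \<longrightarrow> x c \<in> W)"
      proof (intro exI[of _ V'] exI[of _ "min \<eta> \<eta>'"] conjI allI impI V'(1,2))
        show "min \<eta> \<eta>' > 0" using V V' by simp
        fix s x assume s: "\<bar>s\<bar> \<le> min \<eta> \<eta>'" and x: "sol (\<lambda>t p. h t p + s * \<beta> p) {a..c} x" and xa: "x a \<in> V'"
        have "sol (\<lambda>t p. h t p + s * \<beta> p) {a..b} x" "sol (\<lambda>t p. h t p + s * \<beta> p) {b..c} x"
          by (rule sol_subset[OF x], use abc in auto)+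
        then show "x c \<in> W" using V(4)[rule_format, of s x] V'(4)[rule_format, of s x] s xa by simp
      qed
    qed
  next
    fix t0 assume t0: "A \<le> t0" "t0 \<le> B"
    have "\<gamma> t0 \<in> topspace (mtop M)" using sol_mem[OF \<gamma>] t0 by simp
    then obtain c where c: "c \<in> atlas M" "\<gamma> t0 \<in> fst c" using chart_cover by blast
    define y0 where "y0 = snd c (\<gamma> t0)"
    have "y0 \<in> chart_image c" using c by (simp add: y0_def)
    then obtain e where e: "e > 0" "cball y0 e \<subseteq> chart_image c"
      using open_chart_image[OF c(1)] open_contains_cball by blast
    define r where "r = e / 2"
    have r: "r > 0" "cball y0 (2 * r) \<subseteq> chart_image c" using e by (auto simp: r_def)
    let ?U = "{p \<in> fst c. snd c p \<in> ball y0 r}"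
    have "openin (mtop M) ?U" by (rule openin_chart_vimage[OF c(1) open_ball])
    then have "openin (top_of_set {A..B}) {t \<in> {A..B}. \<gamma> t \<in> ?U}" by (rule sol_openin[OF sol_continuous[OF \<gamma>]])
    moreover have "t0 \<in> {t \<in> {A..B}. \<gamma> t \<in> ?U}" using t0 c r(1) by (simp add: y0_def)
    ultimately have "\<exists>d>0. \<forall>t\<in>{A..B}. \<bar>t - t0\<bar> < d \<longrightarrow> t \<in> {t \<in> {A..B}. \<gamma> t \<in> ?U}"
      by (rule eventually_interval_nbhd)
    then obtain d where d: "d > 0" "\<And>t. t \<in> {A..B} \<Longrightarrow> \<bar>t - t0\<bar> < d \<Longrightarrow> \<gamma> t \<in> ?U" by blast
    show "\<exists>d>0. \<forall>a b. a \<le> t0 \<and> t0 \<le> b \<and> b - a < d \<longrightarrow> A \<le> a \<longrightarrow> b \<le> B \<longrightarrow> stable h \<beta> \<gamma> a b"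
    proof (intro exI[of _ d] conjI d(1) allI impI)
      fix a b assume ab: "a \<le> t0 \<and> t0 \<le> b \<and> b - a < d" "A \<le> a" "b \<le> B"
      show "stable h \<beta> \<gamma> a b"
      proof (rule stable_in_chart[OF h \<beta> _ _ c(1) r])
        show "sol h {a..b} \<gamma>" by (rule sol_subset[OF \<gamma>]) (use ab in auto)
        fix t assume "t \<in> {a..b}"
        then have "\<gamma> t \<in> ?U" using ab by (intro d(2)) auto
        then show "\<gamma> t \<in> fst c \<and> snd c (\<gamma> t) \<in> ball y0 r" by simp
      qed (use ab in auto)
    qed
  qed
  then show ?thesis by simp
qed

text \<open>If the end points differed, disjoint neighbourhoods would separate them; but stability
  of \<open>x\<close> under zero perturbation forces every solution with the same start into the
  neighbourhood of \<open>x t\<close>.\<close>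

lemma sol_unique_forward:
  assumes h: "tsmooth h" and x: "sol h {a..b} x" and y: "sol h {a..b} y" and eq: "x a = y a"
    and t: "a \<le> t" "t \<le> b"
  shows "x t = y t"
proof (rule ccontr)
  assume "x t \<noteq> y t"
  have x': "sol h {a..t} x" and y': "sol h {a..t} y" using t by (auto intro: sol_subset[OF x] sol_subset[OF y])
  have "x t \<in> topspace (mtop M)" "y t \<in> topspace (mtop M)" using sol_mem[OF x'] sol_mem[OF y'] t by auto
  then obtain U W where U: "openin (mtop M) U" "x t \<in> U" "openin (mtop M) W" "y t \<in> W" "disjnt U W"
    using Hausdorff \<open>x t \<noteq> y t\<close> unfolding Hausdorff_space_def by blast
  have "stable h (\<lambda>_. 0) x a t" by (rule stable_solution[OF h msmooth_const x' t(1)])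
  then obtain V \<eta> where V: "openin (mtop M) V" "x a \<in> V" "\<eta> > 0"
    "\<forall>s z. \<bar>s\<bar> \<le> \<eta> \<longrightarrow> sol (\<lambda>t p. h t p + s * 0) {a..t} z \<longrightarrow> z a \<in> V \<longrightarrow> z t \<in> U"
    using stableE[of h "\<lambda>_. 0" x a t U, OF _ U(1,2)] by blast
  have "y t \<in> U" by (rule V(4)[rule_format, of 0 y]) (use V(2,3) y' eq in auto)
  then show False using U by (auto simp: disjnt_def)
qed

lemma tsmooth_reverse: assumes "tsmooth h" shows "tsmooth (\<lambda>t p. - h (- t) p)"
  unfolding tsmooth_def
proof
  fix c assume c: "c \<in> atlas M"
  let ?F = "\<lambda>(t, y). h t (chart_inv c y)"
  have o: "open (UNIV \<times> chart_image c)" using open_chart_image[OF c] by (intro open_Times) auto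
  have "bounded_linear (\<lambda>p::real \<times> 'e. (- fst p, snd p))"
    by (intro bounded_linear_Pair bounded_linear_minus bounded_linear_fst bounded_linear_snd)
  then have "smooth_on (UNIV \<times> chart_image c) (\<lambda>p. ?F (- fst p, snd p))"
    by (rule smooth_on_linear_arg[OF o _ _ o]) (use assms c in \<open>auto simp: tsmooth_def\<close>)
  from smooth_on_mult[OF o smooth_on_const[of _ "-1"] this]
  show "smooth_on (UNIV \<times> chart_image c) (\<lambda>(t, y). - h (- t) (chart_inv c y))"
    by (simp add: case_prod_unfold)
qed

text \<open>Running time backwards negates the vector field, which is the field of the negated
  Hamiltonian. This turns forward uniqueness into backward uniqueness.\<close>

lemma sol_reverse:
  assumes h: "tsmooth h" and x: "sol h {a..b} x"
  shows "sol (\<lambda>t p. - h (- t) p) {- b..- a} (\<lambda>t. x (- t))"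
  unfolding sol_def
proof (intro conjI ballI impI)
  have "continuous_map (top_of_set {- b..- a}) (top_of_set {a..b}) uminus"
    by (auto simp: continuous_map_in_subtopology intro!: continuous_intros)
  from continuous_map_compose[OF this sol_continuous[OF x]]
  show "continuous_map (top_of_set {- b..- a}) (mtop M) (\<lambda>t. x (- t))" by (simp add: o_def)
  fix t c assume t: "t \<in> {- b..- a}" and c: "c \<in> atlas M" "x (- t) \<in> fst c"
  have im: "uminus ` {- b..- a} = {a..b}" by force
  have "(uminus has_vector_derivative (-1)) (at t within {- b..- a})"
    by (auto intro!: derivative_eq_intros)
  moreover have "(snd c \<circ> x has_vector_derivative ham_vf \<omega> (h (- t)) c (snd c (x (- t)))) (at (- t) within uminus ` {- b..- a})"
    unfolding im using sol_derivative[OF x _ c] t by simp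
  ultimately have "((snd c \<circ> x) \<circ> uminus has_vector_derivative (-1) *\<^sub>R ham_vf \<omega> (h (- t)) c (snd c (x (- t))))
    (at t within {- b..- a})" by (rule vector_diff_chain_within)
  moreover have "ham_vf \<omega> (\<lambda>p. - h (- t) p) c (snd c (x (- t))) = (-1) *\<^sub>R ham_vf \<omega> (h (- t)) c (snd c (x (- t)))"
  proof (rule ham_vf_scale[OF c(1) chart_mem[OF c]])
    let ?H = "h (- t) \<circ> chart_inv c" and ?y = "snd c (x (- t))"
    show d: "?H differentiable (at ?y)" by (rule tsmooth_differentiable[OF h c(1) chart_mem[OF c]])
    have eq: "(\<lambda>p. - h (- t) p) \<circ> chart_inv c = (\<lambda>y. - ?H y)" by (simp add: o_def)
    have D: "((\<lambda>y. - ?H y) has_derivative (\<lambda>w. - frechet_derivative ?H (at ?y) w)) (at ?y)"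
      using d unfolding frechet_derivative_works by (rule has_derivative_minus)
    then show "((\<lambda>p. - h (- t) p) \<circ> chart_inv c) differentiable (at ?y)" unfolding eq by (auto simp: differentiable_def)
    show "frechet_derivative ((\<lambda>p. - h (- t) p) \<circ> chart_inv c) (at ?y) w = - 1 * frechet_derivative ?H (at ?y) w" for w
      unfolding eq frechet_derivative_at[OF D, symmetric] by simp
  qed
  ultimately show "(snd c \<circ> (\<lambda>t. x (- t)) has_vector_derivative ham_vf \<omega> (\<lambda>p. - h (- t) p) c (snd c (x (- t)))) (at t within {- b..- a})"
    by (simp add: o_def)
qed

lemma sol_unique:
  assumes h: "tsmooth h" and x: "sol h {a..b} x" and y: "sol h {a..b} y" and eq: "x s = y s"
    and s: "s \<in> {a..b}" and t: "t \<in> {a..b}"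
  shows "x t = y t"
proof (cases "s \<le> t")
  case True
  have "sol h {s..b} x" "sol h {s..b} y" using s by (auto intro: sol_subset[OF x] sol_subset[OF y])
  from sol_unique_forward[of h s b x y t, OF h this eq True] t show ?thesis by simp
next
  case False
  have "sol h {a..s} x" "sol h {a..s} y" using s by (auto intro: sol_subset[OF x] sol_subset[OF y])
  from sol_reverse[OF h this(1)] sol_reverse[OF h this(2)]
  have "(\<lambda>t. x (- t)) (- t) = (\<lambda>t. y (- t)) (- t)"
    by (rule sol_unique_forward[of "\<lambda>t p. - h (- t) p" "- s" "- a" "\<lambda>t. x (- t)" "\<lambda>t. y (- t)" "- t", OF tsmooth_reverse[OF h]])
      (use False t eq in auto)
  then show ?thesis by simp
qed

end

section \<open>Hamiltonian curves: existence and robust displacement\<close>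

lemma has_vector_derivative_Un:
  assumes "(f has_vector_derivative v) (at t within S)" "(f has_vector_derivative v) (at t within T)"
  shows "(f has_vector_derivative v) (at t within S \<union> T)"
  using assms unfolding has_vector_derivative_def has_derivative_within by (auto simp: Lim_Un)

context symp_mfd
begin

text \<open>At the junction both one-sided derivatives equal the same vector, because the field
  depends only on time and position.\<close>

lemma sol_glue:
  assumes x: "sol h {a..b} x" and y: "sol h {b..c} y" and eq: "x b = y b" and ab: "a \<le> b" "b \<le> c"
  shows "sol h {a..c} (\<lambda>t. if t \<le> b then x t else y t)"
proof -
  define z where "z t = (if t \<le> b then x t else y t)" for t
  have zx: "z t = x t" if "t \<in> {a..b}" for t using that by (simp add: z_def)
  have zy: "z t = y t" if "t \<in> {b..c}" for t using that eq by (auto simp: z_def)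
  have L: "(snd d \<circ> z has_vector_derivative ham_vf \<omega> (h t) d (snd d (z t))) (at t within {a..b})"
    if "t \<in> {a..b}" "d \<in> atlas M" "z t \<in> fst d" for t d
    using sol_derivative[OF x that(1,2)] that zx
    by (intro has_vector_derivative_transform[of t "{a..b}" "snd d \<circ> z" "snd d \<circ> x"]) auto
  have R: "(snd d \<circ> z has_vector_derivative ham_vf \<omega> (h t) d (snd d (z t))) (at t within {b..c})"
    if "t \<in> {b..c}" "d \<in> atlas M" "z t \<in> fst d" for t d
    using sol_derivative[OF y that(1,2)] that zy
    by (intro has_vector_derivative_transform[of t "{b..c}" "snd d \<circ> z" "snd d \<circ> y"]) auto
  have "sol h {a..c} z"
    unfolding sol_def
  proof (intro conjI ballI impI)
    show "continuous_map (top_of_set {a..c}) (mtop M) z"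
      unfolding z_def
    proof (rule continuous_map_cases_le)
      have "subtopology (top_of_set {a..c}) {t \<in> topspace (top_of_set {a..c}). t \<le> b} = top_of_set {a..b}"
        unfolding subtopology_subtopology using ab by (intro arg_cong[of _ _ top_of_set]) auto
      then show "continuous_map (subtopology (top_of_set {a..c}) {t \<in> topspace (top_of_set {a..c}). t \<le> b}) (mtop M) x"
        using sol_continuous[OF x] by simp
      have "subtopology (top_of_set {a..c}) {t \<in> topspace (top_of_set {a..c}). b \<le> t} = top_of_set {b..c}"
        unfolding subtopology_subtopology using ab by (intro arg_cong[of _ _ top_of_set]) auto
      then show "continuous_map (subtopology (top_of_set {a..c}) {t \<in> topspace (top_of_set {a..c}). b \<le> t}) (mtop M) y"
        using sol_continuous[OF y] by simp
    qed (use eq in auto)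
    fix t d assume t: "t \<in> {a..c}" and d: "d \<in> atlas M" "z t \<in> fst d"
    consider "t < b" | "t = b" | "t > b" by linarith
    then show "(snd d \<circ> z has_vector_derivative ham_vf \<omega> (h t) d (snd d (z t))) (at t within {a..c})"
    proof cases
      case 1
      have "at t within {a..c} = at t within {a..b}"
        by (rule at_within_nhd[of t "{..<b}"]) (use 1 ab in auto)
      then show ?thesis using L[OF _ d] 1 t by simp
    next
      case 2
      have "{a..c} = {a..b} \<union> {b..c}" using ab by auto
      then show ?thesis using has_vector_derivative_Un[OF L[OF _ d] R[OF _ d]] 2 ab by simp
    next
      case 3
      have "at t within {a..c} = at t within {b..c}"
        by (rule at_within_nhd[of t "{b<..}"]) (use 3 ab in auto)
      then show ?thesis using R[OF _ d] 3 t by simp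
    qed
  qed
  then show ?thesis unfolding z_def .
qed

text \<open>A solution found in one chart satisfies the equation in all charts by the transformation
  rule for Hamiltonian fields. Neighbourhood and time length are uniform in the starting data, which
  prepares the compactness argument.\<close>

lemma sol_exists_in_chart:
  assumes h: "tsmooth h" and p: "p \<in> topspace (mtop M)"
  shows "\<exists>Nb d. openin (mtop M) Nb \<and> p \<in> Nb \<and> d > 0 \<and> (\<forall>a b s q. A \<le> a \<longrightarrow> a \<le> s \<longrightarrow> s \<le> b \<longrightarrow> b \<le> B \<longrightarrow>
    b - a < d \<longrightarrow> q \<in> Nb \<longrightarrow> (\<exists>\<gamma>. sol h {a..b} \<gamma> \<and> \<gamma> s = q))"
proof -
  obtain c where c: "c \<in> atlas M" "p \<in> fst c" using chart_cover p by blast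
  define y0 where "y0 = snd c p"
  have "y0 \<in> chart_image c" using c by (simp add: y0_def)
  then obtain e where e: "e > 0" "cball y0 e \<subseteq> chart_image c"
    using open_chart_image[OF c(1)] open_contains_cball by blast
  define r where "r = e / 2"
  have r: "r > 0" "cball y0 (2 * r) \<subseteq> chart_image c" using e by (auto simp: r_def)
  obtain L where L: "L-lipschitz_on ({A..B} \<times> cball y0 (2 * r)) (\<lambda>(t, y). ham_vf \<omega> (h t) c y)"
    using ham_vf_lipschitz[OF h c(1) compact_cball convex_cball r(2)] by blast
  obtain d where d: "d > 0" "\<forall>a b s y. A \<le> a \<longrightarrow> a \<le> s \<longrightarrow> s \<le> b \<longrightarrow> b \<le> B \<longrightarrow> b - a < d \<longrightarrow> y \<in> cball y0 r \<longrightarrow>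
    (\<exists>u. u s = y \<and> (\<forall>t\<in>{a..b}. u t \<in> cball y0 (2 * r) \<and> (u has_vector_derivative ham_vf \<omega> (h t) c (u t)) (at t within {a..b})))"
    using picard_local[OF L r(1)] by blast
  let ?Nb = "{q \<in> fst c. snd c q \<in> ball y0 r}"
  show ?thesis
  proof (intro exI[of _ ?Nb] exI[of _ d] conjI d(1) allI impI)
    show "openin (mtop M) ?Nb" by (rule openin_chart_vimage[OF c(1) open_ball])
    show "p \<in> ?Nb" using c r(1) by (simp add: y0_def)
    fix a b s q
    assume ab: "A \<le> a" "a \<le> s" "s \<le> b" "b \<le> B" "b - a < d" and q: "q \<in> ?Nb"
    then have "snd c q \<in> cball y0 r" by auto
    with d(2) ab obtain u where u: "u s = snd c q" "\<And>t. t \<in> {a..b} \<Longrightarrow> u t \<in> cball y0 (2 * r)"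
      "\<And>t. t \<in> {a..b} \<Longrightarrow> (u has_vector_derivative ham_vf \<omega> (h t) c (u t)) (at t within {a..b})" by metis
    have uc: "u t \<in> chart_image c" if "t \<in> {a..b}" for t using u(2)[OF that] r(2) by blast
    define \<gamma> where "\<gamma> = chart_inv c \<circ> u"
    have "continuous_on {a..b} u"
      using u(3) has_vector_derivative_continuous continuous_on_eq_continuous_within by blast
    then have "continuous_map (top_of_set {a..b}) (top_of_set (chart_image c)) u"
      using uc by (auto simp: continuous_map_in_subtopology)
    then have "continuous_map (top_of_set {a..b}) (mtop M) \<gamma>"
      unfolding \<gamma>_def by (rule continuous_map_compose[OF _ continuous_chart_inv[OF c(1)]])
    moreover have "(snd d \<circ> \<gamma> has_vector_derivative ham_vf \<omega> (h t) d (snd d (\<gamma> t))) (at t within {a..b})"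
      if t: "t \<in> {a..b}" and d: "d \<in> atlas M" "\<gamma> t \<in> fst d" for t d
    proof -
      let ?\<tau> = "snd d \<circ> chart_inv c"
      have \<gamma>c: "\<gamma> t \<in> fst c" "snd c (\<gamma> t) = u t" using uc[OF t] c(1) by (auto simp: \<gamma>_def)
      have "u t \<in> snd c ` (fst c \<inter> fst d)" using \<gamma>c d by (metis IntI imageI)
      then have "?\<tau> differentiable (at (u t))"
        using smooth_on_differentiable[OF smooth_transition[OF c(1) d(1)]] by blast
      then have "(?\<tau> has_derivative frechet_derivative ?\<tau> (at (u t))) (at (u t) within u ` {a..b})"
        using frechet_derivative_works has_derivative_at_withinI by blast
      from vector_derivative_diff_chain_within[OF u(3)[OF t] this]
      have "(?\<tau> \<circ> u has_vector_derivative frechet_derivative ?\<tau> (at (u t)) (ham_vf \<omega> (h t) c (u t))) (at t within {a..b})" .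
      moreover have "ham_vf \<omega> (h t) d (snd d (\<gamma> t)) = frechet_derivative ?\<tau> (at (u t)) (ham_vf \<omega> (h t) c (u t))"
        using ham_vf_transform[OF c(1) d(1) \<gamma>c(1) d(2) tsmooth_differentiable[OF h d(1) chart_mem[OF d]]]
        unfolding \<gamma>c(2) .
      ultimately show ?thesis by (simp add: \<gamma>_def o_assoc)
    qed
    ultimately have "sol h {a..b} \<gamma>" unfolding sol_def by blast
    moreover have "\<gamma> s = q" using u(1) q c(1) by (simp add: \<gamma>_def)
    ultimately show "\<exists>\<gamma>. sol h {a..b} \<gamma> \<and> \<gamma> s = q" by blast
  qed
qed

lemma ham_vf_zero:
  assumes "c \<in> atlas M" "q \<in> fst c" "openin (mtop M) U" "q \<in> U" "\<And>p. p \<in> U \<Longrightarrow> f p = 0"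
  shows "ham_vf \<omega> f c (snd c q) = 0"
proof -
  let ?y = "snd c q" and ?U = "snd c ` (fst c \<inter> U)"
  have U: "open ?U" "?y \<in> ?U" using open_chart_transport[OF assms(1,3)] assms(2,4) by auto
  have D: "(f \<circ> chart_inv c has_derivative (\<lambda>_. 0)) (at ?y)"
    by (rule has_derivative_transform_within_open[OF has_derivative_const[of 0] U]) (use assms(1,5) in auto)
  have y: "?y \<in> chart_image c" using assms by simp
  show ?thesis
  proof (rule ham_vf_eqI[OF assms(1) y])
    show "f \<circ> chart_inv c differentiable at ?y" using D by (auto simp: differentiable_def)
    show "\<omega> c ?y 0 w = - frechet_derivative (f \<circ> chart_inv c) (at ?y) w" for w
      using linear_0[OF form_linear1[OF assms(1) y], of w] fun_cong[OF frechet_derivative_at[OF D], of w] by simp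
  qed
qed

lemma sol_const:
  assumes C: "closedin (mtop M) C" "\<And>t p. p \<notin> C \<Longrightarrow> h t p = 0" and p: "p \<in> topspace (mtop M)" "p \<notin> C"
  shows "sol h T (\<lambda>_. p)"
  unfolding sol_def
proof (intro conjI ballI impI)
  show "continuous_map (top_of_set T) (mtop M) (\<lambda>_. p)" using p by simp
  fix t c assume "t \<in> T" "c \<in> atlas M" "p \<in> fst c"
  then have "ham_vf \<omega> (h t) c (snd c p) = 0"
    by (intro ham_vf_zero[of c p "topspace (mtop M) - C"]) (use C p in auto)
  then show "(snd c \<circ> (\<lambda>_. p) has_vector_derivative ham_vf \<omega> (h t) c (snd c p)) (at t within T)"
    by (simp add: o_def)
qed

text \<open>On the compact support, finitely many local existence times have a positive minimum; off
  the support constant curves are solutions. The resulting uniform step is propagated by bisection.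
  The initial time may be anywhere in the interval, so that pieces can be attached on either
  side.\<close>

lemma sol_exists_interval:
  assumes h: "tsmooth h" and C: "compactin (mtop M) C" "\<And>t p. p \<notin> C \<Longrightarrow> h t p = 0"
    and AB: "A \<le> B"
  shows "\<forall>s\<in>{A..B}. \<forall>q\<in>topspace (mtop M). \<exists>\<gamma>. sol h {A..B} \<gamma> \<and> \<gamma> s = q"
proof -
  define P where "P a b \<longleftrightarrow> a \<le> b \<longrightarrow> (\<forall>s\<in>{a..b}. \<forall>q\<in>topspace (mtop M). \<exists>\<gamma>. sol h {a..b} \<gamma> \<and> \<gamma> s = q)" for a b
  have Ccl: "closedin (mtop M) C" by (rule compactin_imp_closedin[OF Hausdorff C(1)])
  have "P A B"
  proof (rule Bolzano[OF AB])
    fix a b c assume P: "P a b" "P b c" and abc: "a \<le> b" "b \<le> c"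
    show "P a c" unfolding P_def
    proof (intro impI ballI)
      fix s q assume s: "s \<in> {a..c}" and q: "q \<in> topspace (mtop M)"
      show "\<exists>\<gamma>. sol h {a..c} \<gamma> \<and> \<gamma> s = q"
      proof (cases "s \<le> b")
        case True
        obtain \<gamma> where \<gamma>: "sol h {a..b} \<gamma>" "\<gamma> s = q" using P(1)[unfolded P_def, rule_format, of s q] True s q abc by auto
        obtain \<gamma>' where \<gamma>': "sol h {b..c} \<gamma>'" "\<gamma>' b = \<gamma> b"
          using P(2)[unfolded P_def, rule_format, of b "\<gamma> b"] sol_mem[OF \<gamma>(1), of b] abc by auto
        show ?thesis
          by (rule exI, rule conjI, rule sol_glue[OF \<gamma>(1) \<gamma>'(1) \<gamma>'(2)[symmetric] abc]) (use True \<gamma> in simp)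
      next
        case False
        obtain \<gamma>' where \<gamma>': "sol h {b..c} \<gamma>'" "\<gamma>' s = q" using P(2)[unfolded P_def, rule_format, of s q] False s q abc by auto
        obtain \<gamma> where \<gamma>: "sol h {a..b} \<gamma>" "\<gamma> b = \<gamma>' b"
          using P(1)[unfolded P_def, rule_format, of b "\<gamma>' b"] sol_mem[OF \<gamma>'(1), of b] abc by auto
        show ?thesis
          by (rule exI, rule conjI, rule sol_glue[OF \<gamma>(1) \<gamma>'(1) \<gamma>(2) abc]) (use False \<gamma>' in simp)
      qed
    qed
  next
    fix t0 assume "A \<le> t0" "t0 \<le> B"
    define good where "good Od \<longleftrightarrow> openin (mtop M) (fst Od) \<and> snd Od > 0 \<and>
      (\<forall>a b s q. t0 - 1 \<le> a \<longrightarrow> a \<le> s \<longrightarrow> s \<le> b \<longrightarrow> b \<le> t0 + 1 \<longrightarrow>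
      b - a < snd Od \<longrightarrow> q \<in> fst Od \<longrightarrow> (\<exists>\<gamma>. sol h {a..b} \<gamma> \<and> \<gamma> s = q))" for Od
    have "\<exists>Od. good Od \<and> p \<in> fst Od" if p: "p \<in> C" for p
    proof -
      have "p \<in> topspace (mtop M)" using compactin_subset_topspace[OF C(1)] p by blast
      from sol_exists_in_chart[OF h this, of "t0 - 1" "t0 + 1"]
      obtain U d where "good (U, d)" "p \<in> U" unfolding good_def fst_conv snd_conv by blast
      then show ?thesis by (intro exI[of _ "(U, d)"]) simp
    qed
    then have cov: "C \<subseteq> \<Union> (fst ` {Od. good Od})" by blast
    have "\<exists>\<F>. finite \<F> \<and> \<F> \<subseteq> fst ` {Od. good Od} \<and> C \<subseteq> \<Union>\<F>"
      by (rule compactinD[OF C(1) _ cov]) (auto simp: good_def)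
    then obtain \<F> where \<F>: "finite \<F>" "\<F> \<subseteq> fst ` {Od. good Od}" "C \<subseteq> \<Union>\<F>" by blast
    obtain G where G: "finite G" "G \<subseteq> {Od. good Od}" "\<F> = fst ` G" using finite_subset_image[OF \<F>(1,2)] by blast
    \<comment> \<open>The added 1 makes the minimum exist when \<open>G\<close> is empty and keeps
      [a, b] inside the window [t0 - 1, t0 + 1] of the local existence statement.\<close>
    define d where "d = Min (insert 1 (snd ` G))"
    have d: "d > 0" "d \<le> 1" "\<And>Od. Od \<in> G \<Longrightarrow> d \<le> snd Od"
      using G by (auto simp: d_def good_def subset_iff)
    show "\<exists>d>0. \<forall>a b. a \<le> t0 \<and> t0 \<le> b \<and> b - a < d \<longrightarrow> P a b"
    proof (intro exI[of _ d] conjI d(1) allI impI)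
      fix a b assume ab: "a \<le> t0 \<and> t0 \<le> b \<and> b - a < d"
      show "P a b" unfolding P_def
      proof (intro impI ballI)
        fix s q assume s: "s \<in> {a..b}" and q: "q \<in> topspace (mtop M)"
        show "\<exists>\<gamma>. sol h {a..b} \<gamma> \<and> \<gamma> s = q"
        proof (cases "q \<in> C")
          case True
          then obtain Od where Od: "Od \<in> G" "q \<in> fst Od" using \<F>(3) G(3) by blast
          then have "good Od" "b - a < snd Od" using G(2) d(3)[OF Od(1)] ab by auto
          then show ?thesis using s ab d(2) Od(2) unfolding good_def by auto
        next
          case False
          then have "sol h {a..b} (\<lambda>_. q)" by (intro sol_const[where C = C and h = h]) (use Ccl C(2) q in auto)
          then show ?thesis by blast
        qed
      qed
    qed
  qed
  then show ?thesis unfolding P_def using AB by simp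
qed

text \<open>Solutions on the intervals [-n, n] agree by uniqueness and exhaust the line.\<close>

lemma sol_exists:
  assumes h: "tsmooth h" and C: "compactin (mtop M) C" "\<And>t p. p \<notin> C \<Longrightarrow> h t p = 0"
    and q: "q \<in> topspace (mtop M)"
  shows "\<exists>\<gamma>. sol h UNIV \<gamma> \<and> \<gamma> 0 = q"
proof -
  have "\<exists>\<gamma>. sol h {- real n..real n} \<gamma> \<and> \<gamma> 0 = q" for n
    using sol_exists_interval[OF h C, of "- real n" "real n"] q by auto
  then obtain g where g: "\<And>n. sol h {- real n..real n} (g n)" "\<And>n. g n 0 = q" by metis
  \<comment> \<open>The successor puts t strictly inside the interval, where the one-interval
    derivative is two-sided.\<close>
  define N where "N t = Suc (nat \<lceil>\<bar>t\<bar>\<rceil>)" for t :: real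
  define \<gamma> where "\<gamma> t = g (N t) t" for t
  have N: "\<bar>t\<bar> < real (N t)" for t unfolding N_def by linarith
  have agree: "\<gamma> t = g n t" if "t \<in> {- real n..real n}" for t n
  proof -
    define m where "m = min n (N t)"
    have t: "t \<in> {- real m..real m}" using that N[of t] by (auto simp: m_def min_def)
    have "sol h {- real m..real m} (g (N t))" "sol h {- real m..real m} (g n)"
      by (rule sol_subset[OF g(1)], auto simp: m_def)+
    from sol_unique[OF h this _ _ t, of 0] show ?thesis by (simp add: \<gamma>_def g(2))
  qed
  have "sol h UNIV \<gamma>" unfolding sol_def
  proof (intro conjI ballI impI)
    show "continuous_map (top_of_set UNIV) (mtop M) \<gamma>"
    proof (rule pasting_lemma[where I = UNIV and T = "\<lambda>n. {- real n<..<real n}" and f = g])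
      show "continuous_map (subtopology (top_of_set UNIV) {- real n<..<real n}) (mtop M) (g n)" for n
        using continuous_map_from_subtopology_mono[OF sol_continuous[OF g(1)[of n]], of "{- real n<..<real n}"]
        by (simp add: subset_iff)
      fix n m t assume "t \<in> topspace (top_of_set UNIV) \<inter> {- real n<..<real n} \<inter> {- real m<..<real m}"
      then show "g n t = g m t" using agree[of t n] agree[of t m] by simp
    next
      fix t :: real
      show "\<exists>n. n \<in> UNIV \<and> t \<in> {- real n<..<real n} \<and> \<gamma> t = g n t"
        using N[of t] by (intro exI[of _ "N t"]) (auto simp: \<gamma>_def)
    qed simp
    fix t :: real and c assume c: "c \<in> atlas M" "\<gamma> t \<in> fst c"
    define n where "n = N t"
    have t: "t \<in> {- real n<..<real n}" using N[of t] by (auto simp: n_def)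
    have agree': "(snd c \<circ> g n) y = (snd c \<circ> \<gamma>) y" if "y \<in> {- real n<..<real n}" for y
      using agree[of y n] that by simp
    have \<gamma>t: "\<gamma> t = g n t" using agree[of t n] t by simp
    have "(snd c \<circ> g n has_vector_derivative ham_vf \<omega> (h t) c (snd c (\<gamma> t))) (at t within {- real n..real n})"
      using sol_derivative[OF g(1)[of n] _ c(1), of t] c(2) t unfolding \<gamma>t by simp
    then have "(snd c \<circ> g n has_vector_derivative ham_vf \<omega> (h t) c (snd c (\<gamma> t))) (at t)"
      using t by (simp add: at_within_Icc_at)
    then show "(snd c \<circ> \<gamma> has_vector_derivative ham_vf \<omega> (h t) c (snd c (\<gamma> t))) (at t within UNIV)"
      by (rule has_vector_derivative_transform_within_open[OF _ open_greaterThanLessThan t]) (rule agree')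
  qed
  moreover have "\<gamma> 0 = q" by (simp add: \<gamma>_def g)
  ultimately show ?thesis by blast
qed

lemma sol_unique_global:
  assumes h: "tsmooth h" and "sol h UNIV x" "sol h UNIV y" "x 0 = y 0"
  shows "x = y"
proof
  fix t
  have "sol h {- \<bar>t\<bar>..\<bar>t\<bar>} x" "sol h {- \<bar>t\<bar>..\<bar>t\<bar>} y"
    using sol_subset assms by blast+
  moreover have "0 \<in> {- \<bar>t\<bar>..\<bar>t\<bar>}" "t \<in> {- \<bar>t\<bar>..\<bar>t\<bar>}" by auto
  ultimately show "x t = y t" using sol_unique[of h _ _ x y 0 t] h assms(4) by blast
qed

text \<open>Each orbit starting in \<open>D\<close> ends at a point that can be separated from the
  compact set \<open>D\<close>; by stability, nearby perturbed orbits still end in the separating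
  neighbourhood, and compactness makes finitely many choices enough. It serves twice: with \<beta> =
  0 it thickens the displaced set, and with the bump as \<beta> it absorbs the bump.\<close>

lemma robust_displacement:
  assumes h: "tsmooth h" and C: "compactin (mtop M) C" "\<And>t p. p \<notin> C \<Longrightarrow> h t p = 0" and \<beta>: "msmooth \<beta>"
    and D: "compactin (mtop M) D" and disp: "\<And>\<gamma>. sol h {0..1} \<gamma> \<Longrightarrow> \<gamma> 0 \<in> D \<Longrightarrow> \<gamma> 1 \<notin> D"
  shows "\<exists>U \<eta>. openin (mtop M) U \<and> D \<subseteq> U \<and> \<eta> > 0 \<and>
    (\<forall>s x. \<bar>s\<bar> \<le> \<eta> \<longrightarrow> sol (\<lambda>t p. h t p + s * \<beta> p) {0..1} x \<longrightarrow> x 0 \<in> U \<longrightarrow> x 1 \<notin> U)"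
proof -
  define good where "good V Nb \<eta> \<longleftrightarrow> openin (mtop M) V \<and> openin (mtop M) Nb \<and> D \<subseteq> Nb \<and> \<eta> > 0 \<and>
    (\<forall>s x. \<bar>s\<bar> \<le> \<eta> \<longrightarrow> sol (\<lambda>t p. h t p + s * \<beta> p) {0..1} x \<longrightarrow> x 0 \<in> V \<longrightarrow> x 1 \<notin> Nb)" for V Nb and \<eta> :: real
  have Dcl: "D \<subseteq> topspace (mtop M)" by (rule compactin_subset_topspace[OF D])
  have ex: "\<exists>V Nb \<eta>. good V Nb \<eta> \<and> p \<in> V" if p: "p \<in> D" for p
  proof -
    obtain \<gamma> where \<gamma>: "sol h {0..1} \<gamma>" "\<gamma> 0 = p"
      using sol_exists_interval[OF h C, of 0 1, rule_format, of 0 p] subsetD[OF Dcl p] by auto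
    have "\<gamma> 1 \<notin> D" using disp[OF \<gamma>(1)] \<gamma>(2) p by simp
    moreover have "\<gamma> 1 \<in> topspace (mtop M)" using sol_mem[OF \<gamma>(1)] by simp
    ultimately have "\<exists>W Nb. openin (mtop M) W \<and> openin (mtop M) Nb \<and> {\<gamma> 1} \<subseteq> W \<and> D \<subseteq> Nb \<and> disjnt W Nb"
      using Hausdorff_space_compact_sets[THEN iffD1, OF Hausdorff, rule_format, of "{\<gamma> 1}" D] D
      by (auto simp: disjnt_def)
    then obtain W Nb where W: "openin (mtop M) W" "openin (mtop M) Nb" "\<gamma> 1 \<in> W" "D \<subseteq> Nb" "disjnt W Nb" by auto
    have "stable h \<beta> \<gamma> 0 1" by (rule stable_solution[OF h \<beta> \<gamma>(1)]) simp
    then obtain V \<eta> where V: "openin (mtop M) V" "\<gamma> 0 \<in> V" "\<eta> > 0"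
      "\<forall>s x. \<bar>s\<bar> \<le> \<eta> \<longrightarrow> sol (\<lambda>t p. h t p + s * \<beta> p) {0..1} x \<longrightarrow> x 0 \<in> V \<longrightarrow> x 1 \<in> W"
      using stableE[of h \<beta> \<gamma> 0 1 W, OF _ W(1,3)] by blast
    have "good V Nb \<eta>" unfolding good_def using V W by (auto simp: disjnt_def)
    then show ?thesis using V(2) \<gamma>(2) by blast
  qed
  then have cov: "D \<subseteq> \<Union> {V. \<exists>Nb \<eta>. good V Nb \<eta>}" by blast
  have "\<exists>\<F>. finite \<F> \<and> \<F> \<subseteq> {V. \<exists>Nb \<eta>. good V Nb \<eta>} \<and> D \<subseteq> \<Union>\<F>"
    by (rule compactinD[OF D _ cov]) (auto simp: good_def)
  then obtain \<F> where \<F>: "finite \<F>" "\<F> \<subseteq> {V. \<exists>Nb \<eta>. good V Nb \<eta>}" "D \<subseteq> \<Union>\<F>" by blast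
  then have "\<forall>V\<in>\<F>. \<exists>Nb \<eta>. good V Nb \<eta>" by blast
  then obtain Nb \<eta> where Nb: "\<And>V. V \<in> \<F> \<Longrightarrow> good V (Nb V) (\<eta> V)" by metis
  \<comment> \<open>The union is where orbits are allowed to start, the intersection is what they
    are known to miss at time 1; \<open>U\<close> has to play both roles.\<close>
  define U where "U = \<Union>\<F> \<inter> (topspace (mtop M) \<inter> \<Inter>(Nb ` \<F>))"
  define e where "e = Min (insert 1 (\<eta> ` \<F>))"
  have e: "e > 0" "\<And>V. V \<in> \<F> \<Longrightarrow> e \<le> \<eta> V" using \<F>(1) Nb by (auto simp: e_def good_def)
  show ?thesis
  proof (intro exI[of _ U] exI[of _ e] conjI e(1) allI impI)
    show "openin (mtop M) U"
    proof (cases "\<F> = {}")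
      case False
      then have "openin (mtop M) (\<Inter>(Nb ` \<F>))" using \<F>(1) Nb by (intro openin_Inter) (auto simp: good_def)
      moreover have "openin (mtop M) (\<Union>\<F>)" using Nb by (intro openin_Union) (auto simp: good_def)
      ultimately show ?thesis unfolding U_def by (intro openin_Int) auto
    qed (simp add: U_def)
    have "D \<subseteq> Nb V" if "V \<in> \<F>" for V using Nb[OF that] unfolding good_def by blast
    then show "D \<subseteq> U" using \<F>(3) Dcl unfolding U_def by blast
    fix s x assume s: "\<bar>s\<bar> \<le> e" and x: "sol (\<lambda>t p. h t p + s * \<beta> p) {0..1} x" "x 0 \<in> U"
    then obtain V where V: "V \<in> \<F>" "x 0 \<in> V" by (auto simp: U_def)
    have "\<forall>s x. \<bar>s\<bar> \<le> \<eta> V \<longrightarrow> sol (\<lambda>t p. h t p + s * \<beta> p) {0..1} x \<longrightarrow> x 0 \<in> V \<longrightarrow> x 1 \<notin> Nb V"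
      using Nb[OF V(1)] unfolding good_def by blast
    from this[rule_format, of s x] have "x 1 \<notin> Nb V" using x(1) s e(2)[OF V(1)] V(2) by simp
    then show "x 1 \<notin> U" using V(1) by (auto simp: U_def)
  qed
qed

end

section \<open>The circle and the torus\<close>

lemma circle_of_eq_iff: "circle_of s = circle_of t \<longleftrightarrow> s - t \<in> \<int>"
  by transfer simp

lemma circle_of_surj: "\<exists>t. circle_of t = x"
proof transfer
  fix x :: real
  show "\<exists>t. t - x \<in> \<int>" by (rule exI[of _ x]) simp
qed

lemma circle_of_surj_unit: "\<exists>t\<in>{0..1}. circle_of t = x"
proof -
  obtain s where s: "circle_of s = x" using circle_of_surj by blast
  have "circle_of (frac s) = circle_of s" unfolding circle_of_eq_iff by (simp add: frac_def)
  then show ?thesis using s frac_ge_0[of s] frac_lt_1[of s] by (intro bexI[of _ "frac s"]) auto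
qed

lemma circle_mult_of [simp]: "circle_mult k (circle_of t) = circle_of (of_int k * t)"
  by transfer simp

lemma continuous_circle_of: "continuous_on S circle_of"
proof -
  have "continuous_on UNIV circle_of"
    by (simp add: continuous_on_open_vimage open_circle_def)
  then show ?thesis using continuous_on_subset by blast
qed

lemma continuous_from_circle:
  fixes f :: "circle \<Rightarrow> 'b::topological_space"
  assumes "continuous_on UNIV (\<lambda>t. f (circle_of t))" shows "continuous_on UNIV f"
  using assms by (simp add: continuous_on_open_vimage open_circle_def vimage_def)

lemma compact_circle: "compact (UNIV :: circle set)"
proof -
  have "x \<in> circle_of ` {0..1}" for x using circle_of_surj_unit[of x] by auto
  then have "UNIV = circle_of ` {0..1}" by blast
  then show ?thesis using compact_continuous_image[OF continuous_circle_of compact_Icc] by metis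
qed

definition circle_fun :: "(real \<Rightarrow> 'b) \<Rightarrow> circle \<Rightarrow> 'b"
  where "circle_fun f x = f (SOME t. circle_of t = x)"

lemma circle_fun:
  assumes "\<And>s t. s - t \<in> \<int> \<Longrightarrow> f s = f t" shows "circle_fun f (circle_of t) = f t"
proof -
  have "circle_of (SOME s. circle_of s = circle_of t) = circle_of t"
    by (rule someI[of "\<lambda>s. circle_of s = circle_of t" t]) simp
  then show ?thesis using assms unfolding circle_fun_def circle_of_eq_iff by blast
qed

lemma inj_on_circle_of: "inj_on circle_of {a<..<a+1}"
proof (rule inj_onI)
  fix s t assume st: "s \<in> {a<..<a+1}" "t \<in> {a<..<a+1}" "circle_of s = circle_of t"
  then have "s - t \<in> \<int>" "\<bar>s - t\<bar> < 1" by (auto simp: circle_of_eq_iff)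
  then have "s - t = 0" using Ints_nonzero_abs_less1 by blast
  then show "s = t" by simp
qed

lemma torus_of_nth [simp]: "torus_of x $ i = circle_of (x $ i)"
  by (simp add: torus_of_def)

lemma torus_of_eq_iff: "torus_of x = torus_of y \<longleftrightarrow> (\<forall>i. x $ i - y $ i \<in> \<int>)"
  by (simp add: vec_eq_iff circle_of_eq_iff)

lemma continuous_torus_of: "continuous_on S torus_of"
  unfolding continuous_on_def torus_of_def
proof (intro ballI tendsto_vec_lambda)
  fix x i assume "x \<in> S"
  have "continuous_on S (\<lambda>x. circle_of (x $ i))"
    by (rule continuous_on_compose2[OF continuous_circle_of[of UNIV]]) (auto intro: continuous_intros)
  then show "((\<lambda>x. circle_of (x $ i)) \<longlongrightarrow> circle_of (x $ i)) (at x within S)"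
    using \<open>x \<in> S\<close> by (simp add: continuous_on_def)
qed

lemma compact_torus: "compact (UNIV :: (circle ^ 'n) set)"
proof -
  have "\<exists>x\<in>cbox 0 1. torus_of x = q" for q :: "circle ^ 'n"
  proof -
    have "\<forall>i. \<exists>t. t \<in> {0..1} \<and> circle_of t = q $ i" using circle_of_surj_unit by blast
    then obtain f where f: "\<And>i. f i \<in> {0..1}" "\<And>i. circle_of (f i) = q $ i" by metis
    have "torus_of (\<chi> i. f i) = q" using f(2) by (simp add: vec_eq_iff)
    moreover have "(\<chi> i. f i) \<in> cbox 0 1" using f(1) by (simp add: mem_box_cart)
    ultimately show ?thesis by blast
  qed
  then have "q \<in> torus_of ` cbox 0 1" for q :: "circle ^ 'n" by (metis imageI)
  then have "(UNIV :: (circle ^ 'n) set) = torus_of ` cbox 0 1" by blast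
  then show ?thesis using compact_continuous_image[OF continuous_torus_of compact_cbox] by metis
qed

lemma inj_on_torus_of: "inj_on torus_of (unit_box a)"
proof (rule inj_onI)
  fix x y assume xy: "x \<in> unit_box a" "y \<in> unit_box a" "torus_of x = torus_of y"
  show "x = y" unfolding vec_eq_iff
  proof
    fix i
    have "x $ i \<in> {a $ i<..<a $ i + 1}" "y $ i \<in> {a $ i<..<a $ i + 1}" "circle_of (x $ i) = circle_of (y $ i)"
      using xy by (auto simp: unit_box_def torus_of_eq_iff circle_of_eq_iff)
    then show "x $ i = y $ i" using inj_on_circle_of inj_onD by metis
  qed
qed

lemma open_unit_box: "open (unit_box a)"
proof -
  have "unit_box a = (\<Inter>i. {x. a $ i < x $ i} \<inter> {x. x $ i < a $ i + 1})" by (auto simp: unit_box_def)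
  then show ?thesis by (auto intro!: open_INT open_Int open_Collect_less continuous_intros)
qed

lemma torus_chart_inverse: "y \<in> unit_box a \<Longrightarrow> inv_into (unit_box a) torus_of (torus_of y) = y"
  using inv_into_f_f[OF inj_on_torus_of] by blast

lemma torus_chart_exists: "\<exists>a. q \<in> torus_of ` unit_box a"
proof -
  have "\<forall>i. \<exists>t. circle_of t = q $ i" using circle_of_surj by blast
  then obtain f where f: "\<And>i. circle_of (f i) = q $ i" by metis
  have "torus_of (\<chi> i. f i) = q" using f by (simp add: vec_eq_iff)
  moreover have "(\<chi> i. f i) \<in> unit_box (\<chi> i. f i - 1/2)" by (simp add: unit_box_def)
  ultimately show ?thesis by blast
qed

text \<open>Charts of the torus differ locally by a fixed integer translation, whose differential is
  the identity; this is why \<open>omega0\<close> looks the same in all of them.\<close>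

lemma torus_transition:
  assumes y: "y \<in> unit_box b" and q: "torus_of x = torus_of y"
  shows "\<exists>U. open U \<and> x \<in> U \<and> (\<forall>x'\<in>U. inv_into (unit_box b) torus_of (torus_of x') = x' + (y - x))"
proof (intro exI conjI ballI)
  let ?U = "(\<lambda>x'. x' + (y - x)) -` unit_box b"
  show "open ?U" by (rule open_vimage[OF open_unit_box]) (intro continuous_intros)
  show "x \<in> ?U" using y by simp
  fix x' assume x': "x' \<in> ?U"
  have "torus_of x' = torus_of (x' + (y - x))" using q unfolding torus_of_eq_iff
    by (simp add: Ints_minus minus_diff_eq)
  then show "inv_into (unit_box b) torus_of (torus_of x') = x' + (y - x)"
    using torus_chart_inverse x' by fastforce
qed

lemma open_torus_chart: "open (torus_of ` unit_box a)"
  unfolding open_vec_def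
proof
  fix q assume "q \<in> torus_of ` unit_box a"
  then obtain x where x: "x \<in> unit_box a" "q = torus_of x" by blast
  have ocirc: "open (circle_of ` {s<..<s+1})" for s
  proof -
    have "circle_of -` (circle_of ` {s<..<s+1}) = (\<Union>k::int. {s + of_int k<..<s + 1 + of_int k})"
    proof (intro equalityI subsetI)
      fix t assume "t \<in> circle_of -` (circle_of ` {s<..<s+1})"
      then obtain u where u: "u \<in> {s<..<s+1}" "t - u \<in> \<int>" by (auto simp: circle_of_eq_iff)
      then obtain k where "t - u = of_int k" by (auto elim: Ints_cases)
      then have "t \<in> {s + of_int k<..<s + 1 + of_int k}" using u by auto
      then show "t \<in> (\<Union>k::int. {s + of_int k<..<s + 1 + of_int k})" by blast
    next
      fix t assume "t \<in> (\<Union>k::int. {s + of_int k<..<s + 1 + of_int k})"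
      then obtain k :: int where k: "t \<in> {s + of_int k<..<s + 1 + of_int k}" by blast
      then have "circle_of t = circle_of (t - of_int k)" "t - of_int k \<in> {s<..<s+1}"
        by (auto simp: circle_of_eq_iff)
      then show "t \<in> circle_of -` (circle_of ` {s<..<s+1})" by blast
    qed
    then show ?thesis unfolding open_circle_def by auto
  qed
  show "\<exists>A. (\<forall>i. open (A i) \<and> q $ i \<in> A i) \<and> (\<forall>y. (\<forall>i. y $ i \<in> A i) \<longrightarrow> y \<in> torus_of ` unit_box a)"
  proof (intro exI[of _ "\<lambda>i. circle_of ` {a $ i<..<a $ i + 1}"] conjI allI impI ocirc)
    fix i show "q $ i \<in> circle_of ` {a $ i<..<a $ i + 1}" using x by (auto simp: unit_box_def)
  next
    fix y assume "\<forall>i. y $ i \<in> circle_of ` {a $ i<..<a $ i + 1}"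
    then have "\<forall>i. \<exists>t. t \<in> {a $ i<..<a $ i + 1} \<and> y $ i = circle_of t" by blast
    then obtain f where f: "\<And>i. f i \<in> {a $ i<..<a $ i + 1}" "\<And>i. y $ i = circle_of (f i)" by metis
    have "y = torus_of (\<chi> i. f i)" using f(2) by (simp add: vec_eq_iff)
    moreover have "(\<chi> i. f i) \<in> unit_box a" using f(1) by (simp add: unit_box_def)
    ultimately show "y \<in> torus_of ` unit_box a" by blast
  qed
qed

text \<open>The exponential identifies the circle with the unit circle in the punctured plane, where
  the degree is the winding number about 0. For a loop given by a lift g this number is g 1 - g 0,
  and homotopy invariance compares \<open>L\<close> with multiplication by \<open>e\<close>.\<close>

lemma circle_loop_degree:
  fixes f :: "circle \<Rightarrow> circle" and L :: "real \<Rightarrow> real" and e :: int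
  assumes L: "continuous_on UNIV L" and f: "\<And>t. f (circle_of t) = circle_of (L t)"
    and hom: "homotopic_with (\<lambda>_. True) euclidean euclidean f (circle_mult e)"
  shows "L 1 - L 0 = of_int e"
proof -
  define E where "E = circle_fun (\<lambda>t. exp (2 * of_real pi * \<i> * of_real t))"
  have E: "E (circle_of t) = exp (2 * of_real pi * \<i> * of_real t)" for t
    unfolding E_def
  proof (rule circle_fun)
    fix s t :: real assume "s - t \<in> \<int>"
    then obtain n where "s - t = of_int n" by (auto elim: Ints_cases)
    then have "s = t + of_int n" by simp
    then have "2 * of_real pi * \<i> * of_real s = 2 * of_real pi * \<i> * of_real t + of_int (2 * n) * (of_real pi * \<i>)"
      by (simp add: algebra_simps)
    then show "exp (2 * of_real pi * \<i> * of_real s) = exp (2 * of_real pi * \<i> * of_real t)"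
      unfolding exp_eq by (intro exI[of _ n]) (simp add: algebra_simps)
  qed
  have Ecirc: "continuous_map euclidean (top_of_set (- {0})) E"
  proof -
    have "continuous_on UNIV E" by (rule continuous_from_circle) (auto simp: E intro!: continuous_intros)
    moreover have "E x \<noteq> 0" for x using circle_of_surj[of x] E by (metis exp_not_eq_zero)
    ultimately show ?thesis by (auto simp: continuous_map_in_subtopology)
  qed
  have "homotopic_with (\<lambda>_. True) euclidean (top_of_set (- {0})) (E \<circ> f) (E \<circ> circle_mult e)"
    by (rule homotopic_with_compose_continuous_map_left[OF hom Ecirc]) simp
  \<comment> \<open>Every intermediate path factors through the circle, so it is automatically
    closed; this upgrades the free homotopy to one of loops.\<close>
  then have "homotopic_with (\<lambda>r. pathfinish r = pathstart r) (top_of_set {0..1}) (top_of_set (- {0}))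
      ((E \<circ> f) \<circ> circle_of) ((E \<circ> circle_mult e) \<circ> circle_of)"
  proof (rule homotopic_with_compose_continuous_map_right)
    show "continuous_map (top_of_set {0..1}) euclidean circle_of"
      by (simp add: continuous_circle_of)
    have "circle_of 1 = circle_of 0" by (simp add: circle_of_eq_iff)
    then show "pathfinish (j \<circ> circle_of) = pathstart (j \<circ> circle_of)" for j :: "circle \<Rightarrow> complex"
      by (simp add: pathfinish_def pathstart_def)
  qed
  then have "homotopic_loops (- {0}) ((E \<circ> f) \<circ> circle_of) ((E \<circ> circle_mult e) \<circ> circle_of)"
    by (simp add: homotopic_loops_def)
  then have "winding_number ((E \<circ> f) \<circ> circle_of) 0 = winding_number ((E \<circ> circle_mult e) \<circ> circle_of) 0"
    by (rule winding_number_homotopic_loops)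
  moreover have "(E \<circ> f) \<circ> circle_of = exp \<circ> (\<lambda>t. 2 * of_real pi * \<i> * of_real (L t))"
    by (rule ext) (simp add: f E)
  moreover have "(E \<circ> circle_mult e) \<circ> circle_of = exp \<circ> (\<lambda>t. 2 * of_real pi * \<i> * of_real (of_int e * t))"
    by (rule ext) (simp add: E)
  moreover have w: "winding_number (exp \<circ> (\<lambda>t. 2 * of_real pi * \<i> * of_real (g t))) 0 = of_real (g 1 - g 0)"
    if "continuous_on {0..1} g" for g :: "real \<Rightarrow> real"
  proof -
    have "path (\<lambda>t. 2 * of_real pi * \<i> * of_real (g t))" unfolding path_def by (intro continuous_intros that)
    from winding_number_compose_exp[OF this] show ?thesis
      by (simp add: pathfinish_def pathstart_def diff_divide_distrib)
  qed
  ultimately have "winding_number (exp \<circ> (\<lambda>t. 2 * of_real pi * \<i> * of_real (L t))) 0 =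
    winding_number (exp \<circ> (\<lambda>t. 2 * of_real pi * \<i> * of_real (of_int e * t))) 0" by simp
  moreover have "continuous_on {0..1} L" by (rule continuous_on_subset[OF L]) simp
  moreover have "continuous_on {0..1} (\<lambda>t. real_of_int e * t)" by (intro continuous_intros)
  ultimately have "(of_real (L 1 - L 0) :: complex) = of_real (of_int e * 1 - of_int e * 0)"
    using w[of L] w[of "\<lambda>t. real_of_int e * t"] by metis
  then show ?thesis unfolding of_real_eq_iff by simp
qed

text \<open>The lift is not constructed by path lifting but as the primitive of the given velocity,
  normalised at time 0. Near any time the chart coordinate differs from it by a constant, so being a
  lift at one nearby time is the same as at another; the property is locally constant and bisection
  makes it global.\<close>

lemma torus_curve_lift:
  fixes q :: "real \<Rightarrow> circle ^ 'n" and u :: "real \<Rightarrow> real"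
  assumes q: "continuous_on UNIV q" and u: "continuous_on UNIV u"
    and d: "\<And>t a. q t \<in> torus_of ` unit_box a \<Longrightarrow>
      ((\<lambda>s. inv_into (unit_box a) torus_of (q s) $ k) has_real_derivative u t) (at t)"
  obtains L where "\<And>t. (L has_real_derivative u t) (at t)" "\<And>t. q t $ k = circle_of (L t)"
proof -
  obtain F where F: "\<And>t. (F has_real_derivative u t) (at t)" using antiderivative_on_line[OF u] by blast
  obtain y where y: "circle_of y = q 0 $ k" using circle_of_surj by blast
  define L where "L t = F t + (y - F 0)" for t
  have L: "(L has_real_derivative u t) (at t)" for t
    unfolding L_def by (auto intro!: derivative_eq_intros F)
  define good where "good t \<longleftrightarrow> q t $ k = circle_of (L t)" for t
  have eq: "good a \<longleftrightarrow> good b" if ab: "a \<le> b" for a b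
    using ab
  proof (rule Bolzano)
    fix t0
    obtain a where a: "q t0 \<in> torus_of ` unit_box a" using torus_chart_exists by blast
    have "open (q -` (torus_of ` unit_box a))" by (rule open_vimage[OF open_torus_chart q])
    then obtain \<delta> where \<delta>: "\<delta> > 0" "ball t0 \<delta> \<subseteq> q -` (torus_of ` unit_box a)"
      using a open_contains_ball by (metis vimageI)
    define Y where "Y s = inv_into (unit_box a) torus_of (q s) $ k" for s
    have "((\<lambda>s. Y s - L s) has_real_derivative 0) (at s within ball t0 \<delta>)" if "s \<in> ball t0 \<delta>" for s
    proof -
      have "(Y has_real_derivative u s) (at s)" using d[of s a] that \<delta> by (auto simp: Y_def[abs_def])
      from DERIV_diff[OF this L] show ?thesis by (simp add: has_field_derivative_at_within)
    qed
    then have "\<exists>\<kappa>. \<forall>s\<in>ball t0 \<delta>. Y s - L s = \<kappa>"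
      by (rule has_field_derivative_zero_constant[OF convex_ball])
    then obtain \<kappa> where \<kappa>: "\<And>s. s \<in> ball t0 \<delta> \<Longrightarrow> Y s - L s = \<kappa>" by blast
    \<comment> \<open>The difference to the local coordinate is the same number at all nearby times,
      and only its integrality decides.\<close>
    have g: "good s \<longleftrightarrow> \<kappa> \<in> \<int>" if "s \<in> ball t0 \<delta>" for s
    proof -
      have "q s \<in> torus_of ` unit_box a" using that \<delta> by blast
      then have "q s = torus_of (inv_into (unit_box a) torus_of (q s))" by (simp add: f_inv_into_f)
      then have "q s $ k = circle_of (Y s)" unfolding Y_def by (metis torus_of_nth)
      then show ?thesis using \<kappa>[OF that] by (simp add: good_def circle_of_eq_iff)
    qed
    show "\<exists>d>0. \<forall>a b. a \<le> t0 \<and> t0 \<le> b \<and> b - a < d \<longrightarrow> (good a \<longleftrightarrow> good b)"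
    proof (intro exI[of _ \<delta>] conjI \<delta>(1) allI impI)
      fix a b assume "a \<le> t0 \<and> t0 \<le> b \<and> b - a < \<delta>"
      then have "a \<in> ball t0 \<delta>" "b \<in> ball t0 \<delta>" by (auto simp: dist_real_def)
      then show "good a \<longleftrightarrow> good b" using g by simp
    qed
  qed simp
  have "good 0" using y by (simp add: good_def L_def)
  then have "good t" for t using eq[of 0 t] eq[of t 0] by (cases "0 \<le> t") auto
  then show thesis using that[OF L] by (simp add: good_def)
qed

section \<open>Hamiltonian dynamics on the product with a cotangent torus\<close>

definition prod_chart :: "('a, 'e) chart \<Rightarrow> real ^ 'n \<Rightarrow> real ^ 'n \<Rightarrow>
    ('a \<times> (real ^ 'n) \<times> (circle ^ 'n), 'e \<times> (real ^ 'n) \<times> (real ^ 'n)) chart"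
  where "prod_chart c R a = (fst c \<times> (open_cube R \<times> torus_of ` unit_box a),
    map_prod (snd c) (map_prod id (inv_into (unit_box a) torus_of)))"

lemma atlas_cotangent:
  "atlas (cotangent_mfd R) = range (\<lambda>a. (open_cube R \<times> torus_of ` unit_box a, map_prod id (inv_into (unit_box a) torus_of)))"
  by (auto simp: cotangent_mfd_def prod_mfd_def open_mfd_def torus_mfd_def)

lemma atlas_product:
  "atlas (prod_mfd M (cotangent_mfd R)) = (\<Union>c\<in>atlas M. range (prod_chart c R))"
proof -
  have "atlas (prod_mfd M (cotangent_mfd R)) =
      {(fst c \<times> fst d, map_prod (snd c) (snd d)) | c d. c \<in> atlas M \<and> d \<in> atlas (cotangent_mfd R)}"
    by (simp add: prod_mfd_def)
  also have "\<dots> = (\<Union>c\<in>atlas M. range (prod_chart c R))"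
  proof (intro equalityI subsetI)
    fix C assume "C \<in> (\<Union>c\<in>atlas M. range (prod_chart c R))"
    then obtain c a where "c \<in> atlas M" "C = prod_chart c R a" by blast
    then show "C \<in> {(fst c \<times> fst d, map_prod (snd c) (snd d)) | c d. c \<in> atlas M \<and> d \<in> atlas (cotangent_mfd R)}"
      unfolding atlas_cotangent
      by (intro CollectI exI[of _ c] exI[of _ "(open_cube R \<times> torus_of ` unit_box a, map_prod id (inv_into (unit_box a) torus_of))"])
        (simp add: prod_chart_def)
  next
    fix C assume "C \<in> {(fst c \<times> fst d, map_prod (snd c) (snd d)) | c d. c \<in> atlas M \<and> d \<in> atlas (cotangent_mfd R)}"
    then show "C \<in> (\<Union>c\<in>atlas M. range (prod_chart c R))"
      unfolding atlas_cotangent by (force simp: prod_chart_def)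
  qed
  finally show ?thesis .
qed

lemma chart_inv_eqI: "inj_on (snd c) (fst c) \<Longrightarrow> x \<in> fst c \<Longrightarrow> snd c x = y \<Longrightarrow> chart_inv c y = x"
  unfolding chart_inv_def by (rule inv_into_f_eq)

lemma open_open_cube: "open (open_cube R)"
proof -
  have "open_cube R = (\<Inter>i. {p. \<bar>p $ i\<bar> < R $ i})" by (auto simp: open_cube_def)
  then show ?thesis by (auto intro!: open_INT open_Collect_less continuous_intros)
qed

context smooth_mfd
begin

lemma inj_prod_chart:
  assumes "c \<in> atlas M" shows "inj_on (snd (prod_chart c R a)) (fst (prod_chart c R a))"
  unfolding prod_chart_def fst_conv snd_conv
  by (intro map_prod_inj_on inj_chart[OF assms] inj_on_inv_into) auto

lemma prod_chart_image: "chart_image (prod_chart c R a) = chart_image c \<times> (open_cube R \<times> unit_box a)"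
proof -
  have "inv_into (unit_box a) torus_of ` torus_of ` unit_box a = unit_box a"
    using torus_chart_inverse by (force simp: image_image)
  then show ?thesis
    unfolding chart_image_def prod_chart_def fst_conv snd_conv map_prod_surj_on[OF refl refl] by simp
qed

lemma prod_chart_inv:
  assumes "c \<in> atlas M" "y \<in> chart_image c" "p \<in> open_cube R" "\<eta> \<in> unit_box a"
  shows "chart_inv (prod_chart c R a) (y, (p, \<eta>)) = (chart_inv c y, (p, torus_of \<eta>))"
  by (rule chart_inv_eqI[OF inj_prod_chart[OF assms(1)]])
    (use assms torus_chart_inverse in \<open>auto simp: prod_chart_def\<close>)

end

context symp_mfd
begin

text \<open>The pullbacks evaluate the forms in an arbitrarily chosen chart: on M the transformation
  law of \<omega> absorbs the choice, on the torus factor the charts differ by translations.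
  \<open>omega0\<close> ignores its chart and base point, hence the two
  \<open>undefined\<close>.\<close>

lemma product_form:
  fixes R :: "real ^ 'n"
  assumes c: "c \<in> atlas M" and y: "y \<in> chart_image c" and p: "p \<in> open_cube R" and \<eta>: "\<eta> \<in> unit_box a"
  shows "sum_symplectic M \<omega> (cotangent_mfd R) omega0 (prod_chart c R a) (y, (p, \<eta>)) v w
    = \<omega> c y (fst v) (fst w) + omega0 undefined undefined (snd v) (snd w)"
proof -
  let ?C = "prod_chart c R a" and ?Y = "(y, (p, \<eta>))"
  have inv: "chart_inv ?C ?Y = (chart_inv c y, (p, torus_of \<eta>))" by (rule prod_chart_inv[OF c y p \<eta>])
  let ?Ob = "chart_image c \<times> (open_cube R \<times> unit_box a)"
  have Ob: "open ?Ob" "?Y \<in> ?Ob"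
    using open_chart_image[OF c] open_open_cube open_unit_box y p \<eta> by (auto intro!: open_Times)
  have A: "pullback_2form M fst \<omega> ?C ?Y v w = \<omega> c y (fst v) (fst w)"
  proof -
    define d where "d = (SOME d. d \<in> atlas M \<and> fst (chart_inv ?C ?Y) \<in> fst d)"
    have "\<exists>d. d \<in> atlas M \<and> fst (chart_inv ?C ?Y) \<in> fst d"
      using c y unfolding inv by (intro exI[of _ c]) simp
    then have d: "d \<in> atlas M" "chart_inv c y \<in> fst d"
      using someI_ex[of "\<lambda>d. d \<in> atlas M \<and> fst (chart_inv ?C ?Y) \<in> fst d"] inv unfolding d_def by auto
    let ?\<tau> = "snd d \<circ> chart_inv c"
    have "snd c (chart_inv c y) \<in> snd c ` (fst c \<inter> fst d)" using c y d by (intro imageI) auto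
    then have "y \<in> snd c ` (fst c \<inter> fst d)" using c y by simp
    then have "(?\<tau> has_derivative frechet_derivative ?\<tau> (at y)) (at y)"
      using smooth_on_differentiable[OF smooth_transition[OF c d(1)]] frechet_derivative_works by blast
    moreover have "(fst has_derivative fst) (at ?Y)" by (auto intro!: derivative_eq_intros)
    ultimately have "(?\<tau> \<circ> fst has_derivative frechet_derivative ?\<tau> (at y) \<circ> fst) (at ?Y)"
      by (intro diff_chain_at) auto
    then have "(snd d \<circ> fst \<circ> chart_inv ?C has_derivative frechet_derivative ?\<tau> (at y) \<circ> fst) (at ?Y)"
      by (rule has_derivative_transform_within_open[OF _ Ob]) (use prod_chart_inv[OF c, where R = R and a = a] in auto)
    then have D: "frechet_derivative (snd d \<circ> fst \<circ> chart_inv ?C) (at ?Y) = frechet_derivative ?\<tau> (at y) \<circ> fst"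
      by (rule frechet_derivative_at[symmetric])
    have "pullback_2form M fst \<omega> ?C ?Y v w = \<omega> d (snd d (chart_inv c y))
        (frechet_derivative ?\<tau> (at y) (fst v)) (frechet_derivative ?\<tau> (at y) (fst w))"
      unfolding pullback_2form_def Let_def d_def[symmetric] D by (simp add: inv)
    also have "\<dots> = \<omega> c y (fst v) (fst w)"
      using form_transform[OF c d(1) chart_inv_mem[OF c y] d(2), of "fst v" "fst w"] c y by simp
    finally show ?thesis .
  qed
  have B: "pullback_2form (cotangent_mfd R) snd omega0 ?C ?Y v w = omega0 undefined undefined (snd v) (snd w)"
  proof -
    define d where "d = (SOME d. d \<in> atlas (cotangent_mfd R) \<and> snd (chart_inv ?C ?Y) \<in> fst d)"
    have "\<exists>d. d \<in> atlas (cotangent_mfd R) \<and> snd (chart_inv ?C ?Y) \<in> fst d"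
      using inv p \<eta> by (auto simp: atlas_cotangent)
    then have "d \<in> atlas (cotangent_mfd R) \<and> snd (chart_inv ?C ?Y) \<in> fst d"
      unfolding d_def by (rule someI_ex)
    then obtain b where b: "d = (open_cube R \<times> torus_of ` unit_box b, map_prod id (inv_into (unit_box b) torus_of))"
      "torus_of \<eta> \<in> torus_of ` unit_box b" using inv by (auto simp: atlas_cotangent)
    then obtain \<zeta> where \<zeta>: "\<zeta> \<in> unit_box b" "torus_of \<eta> = torus_of \<zeta>" by blast
    obtain U where U: "open U" "\<eta> \<in> U" "\<And>x. x \<in> U \<Longrightarrow> inv_into (unit_box b) torus_of (torus_of x) = x + (\<zeta> - \<eta>)"
      using torus_transition[OF \<zeta>] by blast
    let ?Ob' = "chart_image c \<times> (open_cube R \<times> (unit_box a \<inter> U))"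
    have Ob': "open ?Ob'" "?Y \<in> ?Ob'"
      using open_chart_image[OF c] open_open_cube open_unit_box U(1,2) y p \<eta> by (auto intro!: open_Times)
    have "((\<lambda>Y::'e \<times> (real ^ 'n) \<times> (real ^ 'n). snd Y + (0, \<zeta> - \<eta>)) has_derivative snd) (at ?Y)"
      by (auto intro!: derivative_eq_intros)
    then have "(snd d \<circ> snd \<circ> chart_inv ?C has_derivative snd) (at ?Y)"
      by (rule has_derivative_transform_within_open[OF _ Ob']) (use prod_chart_inv[OF c, where R = R and a = a] U(3) in \<open>auto simp: b(1)\<close>)
    then have D: "frechet_derivative (snd d \<circ> snd \<circ> chart_inv ?C) (at ?Y) = snd"
      by (rule frechet_derivative_at[symmetric])
    show ?thesis
      unfolding pullback_2form_def Let_def d_def[symmetric] D by (simp add: omega0_def)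
  qed
  show ?thesis unfolding sum_symplectic_def A B ..
qed

text \<open>With \<omega>_0 = dp \<and> dq and \<omega>(X, V) = -dF(V), the equations are q' =
  \<partial>F/\<partial>p and p' = -\<partial>F/\<partial>q; the latter is 0 because
  \<open>F\<close> is independent of q. At a fixed momentum the M-part is the field of a function on
  M.\<close>

lemma ham_vf_product:
  fixes R :: "real ^ 'n"
  assumes c: "c \<in> atlas M" and y: "y \<in> chart_image c" and p: "p \<in> open_cube R" and \<eta>: "\<eta> \<in> unit_box a"
    and F: "\<And>x p q. p \<in> open_cube R \<Longrightarrow> F (x, (p, q)) = lam p * f1 x + chi p * f2 x"
    and f1: "msmooth f1" and f2: "msmooth f2"
    and lam: "(lam has_derivative lam') (at p)" and chi: "(chi has_derivative chi') (at p)"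
  shows "ham_vf (sum_symplectic M \<omega> (cotangent_mfd R) omega0) F (prod_chart c R a) (y, (p, \<eta>)) =
    (ham_vf \<omega> (\<lambda>x. lam p * f1 x + chi p * f2 x) c y,
     (0, \<chi> k. lam' (axis k 1) * f1 (chart_inv c y) + chi' (axis k 1) * f2 (chart_inv c y)))"
proof -
  let ?C = "prod_chart c R a" and ?Y = "(y, (p, \<eta>))"
  let ?\<Omega> = "sum_symplectic M \<omega> (cotangent_mfd R) omega0"
  let ?f1 = "f1 \<circ> chart_inv c" and ?f2 = "f2 \<circ> chart_inv c"
  let ?f = "\<lambda>x. lam p * f1 x + chi p * f2 x"
  define D1 where "D1 = frechet_derivative ?f1 (at y)"
  define D2 where "D2 = frechet_derivative ?f2 (at y)"
  have D1: "(?f1 has_derivative D1) (at y)" and D2: "(?f2 has_derivative D2) (at y)"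
    unfolding D1_def D2_def using msmooth_differentiable[OF _ c y] f1 f2 frechet_derivative_works by blast+
  have Df: "(?f \<circ> chart_inv c has_derivative (\<lambda>w. lam p * D1 w + chi p * D2 w)) (at y)"
  proof -
    have "((\<lambda>y. lam p * ?f1 y + chi p * ?f2 y) has_derivative (\<lambda>w. lam p * D1 w + chi p * D2 w)) (at y)"
      by (intro has_derivative_add has_derivative_mult_right D1 D2)
    then show ?thesis by (simp add: o_def)
  qed
  let ?Ob = "chart_image c \<times> (open_cube R \<times> unit_box a)"
  have Ob: "open ?Ob" "?Y \<in> ?Ob"
    using open_chart_image[OF c] open_open_cube open_unit_box y p \<eta> by (auto intro!: open_Times)
  have dpr: "((\<lambda>Y. fst Y) has_derivative fst) (at ?Y)" "((\<lambda>Y. fst (snd Y)) has_derivative (\<lambda>w. fst (snd w))) (at ?Y)"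
    by (auto intro!: derivative_eq_intros)
  have cD1: "((\<lambda>Y. ?f1 (fst Y)) has_derivative (\<lambda>w. D1 (fst w))) (at ?Y)"
    using has_derivative_compose[OF dpr(1), of ?f1 D1] D1 by simp
  have cD2: "((\<lambda>Y. ?f2 (fst Y)) has_derivative (\<lambda>w. D2 (fst w))) (at ?Y)"
    using has_derivative_compose[OF dpr(1), of ?f2 D2] D2 by simp
  have cl: "((\<lambda>Y. lam (fst (snd Y))) has_derivative (\<lambda>w. lam' (fst (snd w)))) (at ?Y)"
    using has_derivative_compose[OF dpr(2), of lam lam'] lam by simp
  have cc: "((\<lambda>Y. chi (fst (snd Y))) has_derivative (\<lambda>w. chi' (fst (snd w)))) (at ?Y)"
    using has_derivative_compose[OF dpr(2), of chi chi'] chi by simp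
  have "((\<lambda>Y. lam (fst (snd Y)) * ?f1 (fst Y) + chi (fst (snd Y)) * ?f2 (fst Y)) has_derivative
      (\<lambda>w. (lam p * D1 (fst w) + lam' (fst (snd w)) * ?f1 y) + (chi p * D2 (fst w) + chi' (fst (snd w)) * ?f2 y))) (at ?Y)"
    using has_derivative_add[OF has_derivative_mult[OF cl cD1] has_derivative_mult[OF cc cD2]] by simp
  then have "(F \<circ> chart_inv ?C has_derivative
      (\<lambda>w. (lam p * D1 (fst w) + lam' (fst (snd w)) * ?f1 y) + (chi p * D2 (fst w) + chi' (fst (snd w)) * ?f2 y))) (at ?Y)"
    by (rule has_derivative_transform_within_open[OF _ Ob]) (use prod_chart_inv[OF c, where R = R and a = a] F in auto)
  from frechet_derivative_at[OF this, symmetric]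
  have DF: "frechet_derivative (F \<circ> chart_inv ?C) (at ?Y) w =
      (lam p * D1 (fst w) + chi p * D2 (fst w)) + (lam' (fst (snd w)) * ?f1 y + chi' (fst (snd w)) * ?f2 y)" for w
    by (simp add: algebra_simps)
  define v0 where "v0 = (ham_vf \<omega> ?f c y, (0::real ^ 'n, (\<chi> k. lam' (axis k 1) * ?f1 y + chi' (axis k 1) * ?f2 y)))"
  have ex: "linear l \<Longrightarrow> (\<Sum>k\<in>UNIV. \<pi> $ k * l (axis k 1)) = l \<pi>" for l :: "real ^ 'n \<Rightarrow> real" and \<pi>
    using linear_sum[of l "\<lambda>k. \<pi> $ k *\<^sub>R axis k 1" UNIV] linear_scale[of l]
    by (simp add: basis_expansion[of \<pi>, unfolded scalar_mult_eq_scaleR])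
  have v0: "?\<Omega> ?C ?Y v0 w = - frechet_derivative (F \<circ> chart_inv ?C) (at ?Y) w" for w
  proof -
    have "omega0 undefined undefined (snd v0) (snd w) =
        - (\<Sum>k\<in>UNIV. (fst (snd w) $ k * lam' (axis k 1)) * ?f1 y + (fst (snd w) $ k * chi' (axis k 1)) * ?f2 y)"
      unfolding v0_def omega0_def sum_negf[symmetric] by (intro sum.cong) (simp_all add: algebra_simps)
    also have "\<dots> = - (\<Sum>k\<in>UNIV. fst (snd w) $ k * lam' (axis k 1)) * ?f1 y
        - (\<Sum>k\<in>UNIV. fst (snd w) $ k * chi' (axis k 1)) * ?f2 y"
      by (simp only: sum.distrib sum_distrib_right minus_add_distrib mult_minus_left diff_conv_add_uminus)
    also have "\<dots> = - (lam' (fst (snd w)) * ?f1 y + chi' (fst (snd w)) * ?f2 y)"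
      using ex[OF has_derivative_linear[OF lam]] ex[OF has_derivative_linear[OF chi]] by simp
    finally have o: "omega0 undefined undefined (snd v0) (snd w) = - (lam' (fst (snd w)) * ?f1 y + chi' (fst (snd w)) * ?f2 y)" .
    have "\<omega> c y (fst v0) (fst w) = - (lam p * D1 (fst w) + chi p * D2 (fst w))"
      using ham_vf_eq[OF c y, of ?f "fst w"] Df frechet_derivative_at[OF Df, symmetric]
      by (auto simp: v0_def differentiable_def)
    then show ?thesis unfolding product_form[OF c y p \<eta>] o DF by simp
  qed
  \<comment> \<open>Testing against vectors of M fixes the M-part, the p-axes fix the q-part and the
    q-axes fix the p-part.\<close>
  have uniq: "v = v0" if v: "\<And>w. ?\<Omega> ?C ?Y v w = ?\<Omega> ?C ?Y v0 w" for v
  proof -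
    have ax1: "(\<Sum>i\<in>UNIV. axis k 1 $ i * g i) = g k" for k :: 'n and g :: "'n \<Rightarrow> real"
    proof -
      have "axis k 1 $ i * g i = (if i = k then g i else 0)" for i by (simp add: axis_def)
      then show ?thesis by simp
    qed
    then have ax2: "(\<Sum>i\<in>UNIV. g i * axis k 1 $ i) = g k" for k :: 'n and g :: "'n \<Rightarrow> real"
      by (simp add: mult.commute)
    note v' = v[unfolded product_form[OF c y p \<eta>]]
    have "\<omega> c y (fst v) w = \<omega> c y (fst v0) w" for w using v'[of "(w, 0)"] by (simp add: omega0_def)
    then have "fst v = fst v0" by (rule ham_vector_unique[OF c y])
    moreover have "snd (snd v) $ k = snd (snd v0) $ k" for k
      using v'[of "(0, (axis k 1, 0))"] \<open>fst v = fst v0\<close>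
      by (simp add: omega0_def ax1 ax2 sum_negf)
    moreover have "fst (snd v) $ k = fst (snd v0) $ k" for k
      using v'[of "(0, (0, axis k 1))"] \<open>fst v = fst v0\<close>
      by (simp add: omega0_def ax1 ax2 sum_negf)
    ultimately show ?thesis by (simp add: prod_eq_iff vec_eq_iff)
  qed
  have "ham_vf ?\<Omega> F ?C ?Y = v0"
    unfolding ham_vf_def
    by (rule the_equality) (use v0 uniq in auto)
  then show ?thesis by (simp add: v0_def o_def)
qed

text \<open>The momentum stays at some \<open>p0\<close>, so only the constants
  \<open>lam p0\<close> and \<open>chi p0\<close> are left of it on M, and the angles follow by a
  quadrature. Their derivative is given in every torus chart, which is the form needed for lifting
  the curve.\<close>

lemma ham_curve_product:
  fixes R :: "real ^ 'n"
  assumes z: "ham_curve (prod_mfd M (cotangent_mfd R)) (sum_symplectic M \<omega> (cotangent_mfd R) omega0) F z"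
    and F: "\<And>t x p q. p \<in> open_cube R \<Longrightarrow> F (circle_of t, (x, (p, q))) = lam p * f1 t x + chi p * f2 t x"
    and f1: "\<And>t. msmooth (f1 t)" and f2: "\<And>t. msmooth (f2 t)"
    and lam: "\<And>p. (lam has_derivative lam' p) (at p)" and chi: "\<And>p. (chi has_derivative chi' p) (at p)"
  shows "\<exists>p0 \<in> open_cube R. sol (\<lambda>t x. lam p0 * f1 t x + chi p0 * f2 t x) UNIV (\<lambda>t. fst (z t)) \<and>
    continuous_on UNIV (\<lambda>t. snd (snd (z t))) \<and>
    (\<forall>t a k. snd (snd (z t)) \<in> torus_of ` unit_box a \<longrightarrow>
      ((\<lambda>s. inv_into (unit_box a) torus_of (snd (snd (z s))) $ k) has_real_derivative
        lam' p0 (axis k 1) * f1 t (fst (z t)) + chi' p0 (axis k 1) * f2 t (fst (z t))) (at t))"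
proof -
  let ?N = "prod_mfd M (cotangent_mfd R)" and ?\<Omega> = "sum_symplectic M \<omega> (cotangent_mfd R) omega0"
  define x where "x t = fst (z t)" for t
  define p where "p t = fst (snd (z t))" for t
  define q where "q t = snd (snd (z t))" for t
  have top: "mtop ?N = prod_topology (mtop M) (prod_topology (top_of_set (open_cube R)) euclidean)"
    by (simp add: prod_mfd_def cotangent_mfd_def open_mfd_def torus_mfd_def)
  have zc: "continuous_map euclideanreal (mtop ?N) z" using z by (simp add: ham_curve_def)
  then have "continuous_map euclideanreal (mtop M) (fst \<circ> z)"
    and z2: "continuous_map euclideanreal (prod_topology (top_of_set (open_cube R)) euclidean) (snd \<circ> z)"
    unfolding top continuous_map_pairwise by blast+
  then have xc: "continuous_map euclideanreal (mtop M) x" by (simp add: x_def[abs_def] o_def)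
  have "continuous_map euclideanreal (top_of_set (open_cube R)) (fst \<circ> (snd \<circ> z))"
    "continuous_map euclideanreal euclidean (snd \<circ> (snd \<circ> z))"
    using z2 unfolding continuous_map_pairwise by blast+
  then have pc: "continuous_map euclideanreal (top_of_set (open_cube R)) p" and qc: "continuous_on UNIV q"
    by (simp_all add: p_def[abs_def] q_def[abs_def] o_def)
  have pR: "p t \<in> open_cube R" for t using continuous_map_funspace[OF pc] by auto
  have main: "(snd c \<circ> x has_vector_derivative ham_vf \<omega> (\<lambda>y. lam (p t) * f1 t y + chi (p t) * f2 t y) c (snd c (x t))) (at t) \<and>
      (p has_vector_derivative 0) (at t) \<and>
      ((\<lambda>s. inv_into (unit_box a) torus_of (q s)) has_vector_derivative
        (\<chi> k. lam' (p t) (axis k 1) * f1 t (x t) + chi' (p t) (axis k 1) * f2 t (x t))) (at t)"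
    if c: "c \<in> atlas M" "x t \<in> fst c" and a: "q t \<in> torus_of ` unit_box a" for t c a
  proof -
    let ?C = "prod_chart c R a"
    have "?C \<in> atlas ?N" unfolding atlas_product using c by blast
    moreover have "z t = (x t, (p t, q t))" by (simp add: x_def p_def q_def)
    moreover have "z t \<in> fst ?C" using c a pR by (simp add: calculation(2) prod_chart_def)
    ultimately have d: "(snd ?C \<circ> z has_vector_derivative ham_vf ?\<Omega> (\<lambda>p. F (circle_of t, p)) ?C (snd ?C (z t))) (at t)"
      using z unfolding ham_curve_def by blast
    let ?\<eta> = "inv_into (unit_box a) torus_of (q t)"
    have \<eta>: "?\<eta> \<in> unit_box a" using a by (rule inv_into_into)
    have sz: "snd ?C (z s) = (snd c (x s), (p s, inv_into (unit_box a) torus_of (q s)))" for s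
      by (simp add: prod_chart_def x_def p_def q_def map_prod_def case_prod_unfold)
    have "ham_vf ?\<Omega> (\<lambda>p. F (circle_of t, p)) ?C (snd ?C (z t)) =
      (ham_vf \<omega> (\<lambda>y. lam (p t) * f1 t y + chi (p t) * f2 t y) c (snd c (x t)),
       (0, \<chi> k. lam' (p t) (axis k 1) * f1 t (chart_inv c (snd c (x t))) + chi' (p t) (axis k 1) * f2 t (chart_inv c (snd c (x t)))))"
      unfolding sz
      by (rule ham_vf_product[OF c(1) chart_mem[OF c] pR \<eta> F f1 f2 lam chi])
    then have d': "(snd ?C \<circ> z has_vector_derivative
      (ham_vf \<omega> (\<lambda>y. lam (p t) * f1 t y + chi (p t) * f2 t y) c (snd c (x t)),
       (0, \<chi> k. lam' (p t) (axis k 1) * f1 t (x t) + chi' (p t) (axis k 1) * f2 t (x t)))) (at t)"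
      using d chart_inv_left[OF c] by simp
    have 1: "((\<lambda>s. fst ((snd ?C \<circ> z) s)) has_vector_derivative ham_vf \<omega> (\<lambda>y. lam (p t) * f1 t y + chi (p t) * f2 t y) c (snd c (x t))) (at t)"
      using bounded_linear.has_vector_derivative[OF bounded_linear_fst d'] by simp
    have 2: "((\<lambda>s. fst (snd ((snd ?C \<circ> z) s))) has_vector_derivative 0) (at t)"
      using bounded_linear.has_vector_derivative[OF bounded_linear_fst bounded_linear.has_vector_derivative[OF bounded_linear_snd d']] by simp
    have 3: "((\<lambda>s. snd (snd ((snd ?C \<circ> z) s))) has_vector_derivative
        (\<chi> k. lam' (p t) (axis k 1) * f1 t (x t) + chi' (p t) (axis k 1) * f2 t (x t))) (at t)"
      using bounded_linear.has_vector_derivative[OF bounded_linear_snd bounded_linear.has_vector_derivative[OF bounded_linear_snd d']] by simp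
    show ?thesis using 1 2 3 by (simp add: sz o_def)
  qed
  have xt: "x t \<in> topspace (mtop M)" for t using continuous_map_funspace[OF xc] by auto
  have "(p has_vector_derivative 0) (at t within UNIV)" for t
    using main chart_cover[OF xt[of t]] torus_chart_exists[of "q t"] by blast
  then obtain p0 where p0: "\<And>t. p t = p0"
    using has_vector_derivative_zero_constant[OF convex_UNIV, of p] by auto
  show ?thesis
  proof (intro bexI[of _ p0] conjI allI impI)
    show "p0 \<in> open_cube R" using pR[of 0] p0 by simp
    show "continuous_on UNIV (\<lambda>t. snd (snd (z t)))" using qc by (simp add: q_def[abs_def])
    show "sol (\<lambda>t x. lam p0 * f1 t x + chi p0 * f2 t x) UNIV (\<lambda>t. fst (z t))"
      unfolding sol_def
    proof (intro conjI ballI impI)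
      show "continuous_map (top_of_set UNIV) (mtop M) (\<lambda>t. fst (z t))" using xc by (simp add: x_def[abs_def])
      fix t c assume c: "c \<in> atlas M" "fst (z t) \<in> fst c"
      obtain a where "q t \<in> torus_of ` unit_box a" using torus_chart_exists by blast
      from main[OF c(1) _ this] c(2)
      show "(snd c \<circ> (\<lambda>t. fst (z t)) has_vector_derivative
          ham_vf \<omega> (\<lambda>x. lam p0 * f1 t x + chi p0 * f2 t x) c (snd c (fst (z t)))) (at t within UNIV)"
        by (simp add: x_def[abs_def] p0)
    qed
    fix t a k assume a: "snd (snd (z t)) \<in> torus_of ` unit_box a"
    obtain c where "c \<in> atlas M" "x t \<in> fst c" using chart_cover[OF xt[of t]] by blast
    from main[OF this, of a] a
    have "((\<lambda>s. inv_into (unit_box a) torus_of (q s)) has_vector_derivative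
        (\<chi> k. lam' (p t) (axis k 1) * f1 t (x t) + chi' (p t) (axis k 1) * f2 t (x t))) (at t)"
      by (simp add: q_def)
    from bounded_linear.has_vector_derivative[OF bounded_linear_vec_nth this, of k]
    show "((\<lambda>s. inv_into (unit_box a) torus_of (snd (snd (z s))) $ k) has_real_derivative
        lam' p0 (axis k 1) * f1 t (fst (z t)) + chi' p0 (axis k 1) * f2 t (fst (z t))) (at t)"
      by (simp add: has_real_derivative_iff_has_vector_derivative p0 q_def x_def)
  qed
qed

end

section \<open>The displacing Hamiltonian\<close>

text \<open>The slow time \<open>a\<close> runs through each period during the first \<open>\<epsilon>\<close> of it and then rests.\<close>

lemma reparametrization_exists:
  fixes Q Q' :: "real \<Rightarrow> real"
  assumes \<epsilon>: "0 < \<epsilon>" "\<epsilon> < 1"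
    and dQ: "\<And>x. (Q has_real_derivative Q' x) (at x)" and sQ: "smooth_on UNIV Q" and sQ': "smooth_on UNIV Q'"
    and Q0: "\<And>x. x \<le> 0 \<Longrightarrow> Q x = 0" and Q1: "\<And>x. x \<ge> 1 \<Longrightarrow> Q x = 1" and Q'0: "\<And>x. x \<le> 0 \<or> x \<ge> 1 \<Longrightarrow> Q' x = 0"
  obtains a A :: "real \<Rightarrow> real" where "smooth_on UNIV a" "smooth_on UNIV A"
    "\<forall>t. (a has_real_derivative A t) (at t)" "\<forall>s t. s - t \<in> \<int> \<longrightarrow> A s = A t \<and> a s - a t \<in> \<int>"
    "\<forall>t\<in>{0..1}. a t = Q (t / \<epsilon>) \<and> A t = Q' (t / \<epsilon>) / \<epsilon>" "\<forall>t. \<exists>s. A t = Q' s / \<epsilon>"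
proof -
  define a where "a t = of_int \<lfloor>t\<rfloor> + Q (frac t / \<epsilon>)" for t
  define A where "A t = Q' (frac t / \<epsilon>) / \<epsilon>" for t
  have per: "frac s = frac t" if "s - t \<in> \<int>" for s t :: real
  proof -
    obtain n where "s - t = of_int n" using \<open>s - t \<in> \<int>\<close> by (auto elim: Ints_cases)
    then have "s = t + of_int n" by simp
    then show ?thesis by (simp add: frac_def)
  qed
  \<comment> \<open>A single formula is valid on an interval reaching back beyond the integer m:
    there the ramp of the previous period is already complete (Q = 1) and the next one has not begun
    (Q = 0). These overlapping intervals cover the line, which gives smoothness at the
    integers.\<close>
  have loc: "a t = of_int m + Q ((1/\<epsilon>) * (t + (- of_int m)))" "A t = (1/\<epsilon>) * Q' ((1/\<epsilon>) * (t + (- of_int m)))"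
    if t: "of_int m - (1 - \<epsilon>) < t" "t < of_int m + 1" for t and m :: int
  proof -
    have "a t = of_int m + Q ((1/\<epsilon>) * (t + (- of_int m))) \<and> A t = (1/\<epsilon>) * Q' ((1/\<epsilon>) * (t + (- of_int m)))"
    proof (cases "of_int m \<le> t")
      case True
      then have "\<lfloor>t\<rfloor> = m" using t by linarith
      then show ?thesis by (simp add: a_def A_def frac_def)
    next
      case False
      then have f: "\<lfloor>t\<rfloor> = m - 1" using t \<epsilon> by linarith
      have "frac t / \<epsilon> \<ge> 1" using t \<epsilon> by (simp add: frac_def f field_simps)
      moreover have "(1/\<epsilon>) * (t + (- of_int m)) \<le> 0" using False \<epsilon> by (simp add: field_simps)
      ultimately show ?thesis by (simp add: a_def A_def f Q0 Q1 Q'0)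
    qed
    then show "a t = of_int m + Q ((1/\<epsilon>) * (t + (- of_int m)))" "A t = (1/\<epsilon>) * Q' ((1/\<epsilon>) * (t + (- of_int m)))"
      by simp_all
  qed
  have nb: "t \<in> {of_int \<lfloor>t\<rfloor> - (1 - \<epsilon>)<..<of_int \<lfloor>t\<rfloor> + 1}" for t :: real
    unfolding greaterThanLessThan_iff using \<epsilon> by linarith
  have lin: "smooth_on UNIV (\<lambda>t::real. (1/\<epsilon>) * (t + (- of_int m)))" for m :: int
    by (intro smooth_on_mult smooth_on_add smooth_on_const smooth_on_id) auto
  have sa: "smooth_on UNIV a"
  proof (rule smooth_on_local)
    fix t :: real
    let ?U = "{of_int \<lfloor>t\<rfloor> - (1 - \<epsilon>)<..<of_int \<lfloor>t\<rfloor> + 1}"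
    have "smooth_on UNIV (\<lambda>s. of_int \<lfloor>t\<rfloor> + Q ((1/\<epsilon>) * (s + (- of_int \<lfloor>t\<rfloor>))))"
      by (intro smooth_on_add smooth_on_const smooth_on_compose[OF _ _ _ lin sQ]) auto
    from smooth_on_subset[OF this subset_UNIV] have "smooth_on ?U a"
      by (rule smooth_on_cong[OF open_greaterThanLessThan loc(1), rotated 2]) auto
    then show "\<exists>U. open U \<and> t \<in> U \<and> smooth_on U a"
      by (intro exI[of _ ?U] conjI open_greaterThanLessThan nb)
  qed
  have sA: "smooth_on UNIV A"
  proof (rule smooth_on_local)
    fix t :: real
    let ?U = "{of_int \<lfloor>t\<rfloor> - (1 - \<epsilon>)<..<of_int \<lfloor>t\<rfloor> + 1}"
    have "smooth_on UNIV (\<lambda>s. (1/\<epsilon>) * Q' ((1/\<epsilon>) * (s + (- of_int \<lfloor>t\<rfloor>))))"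
      by (intro smooth_on_mult smooth_on_const smooth_on_compose[OF _ _ _ lin sQ']) auto
    from smooth_on_subset[OF this subset_UNIV] have "smooth_on ?U A"
      by (rule smooth_on_cong[OF open_greaterThanLessThan loc(2), rotated 2]) auto
    then show "\<exists>U. open U \<and> t \<in> U \<and> smooth_on U A"
      by (intro exI[of _ ?U] conjI open_greaterThanLessThan nb)
  qed
  have da: "(a has_real_derivative A t) (at t)" for t
  proof -
    let ?U = "{of_int \<lfloor>t\<rfloor> - (1 - \<epsilon>)<..<of_int \<lfloor>t\<rfloor> + 1}" and ?g = "\<lambda>s. of_int \<lfloor>t\<rfloor> + Q ((1/\<epsilon>) * (s + (- of_int \<lfloor>t\<rfloor>)))"
    have "((\<lambda>s. (1/\<epsilon>) * (s + (- of_int \<lfloor>t\<rfloor>))) has_real_derivative (1/\<epsilon>)) (at t)"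
      using \<epsilon> by (auto intro!: derivative_eq_intros)
    from DERIV_chain2[OF dQ this] have "(?g has_real_derivative Q' ((1/\<epsilon>) * (t + (- of_int \<lfloor>t\<rfloor>))) * (1/\<epsilon>)) (at t)"
      by (auto intro!: derivative_eq_intros)
    moreover have "Q' ((1/\<epsilon>) * (t + (- of_int \<lfloor>t\<rfloor>))) * (1/\<epsilon>) = A t" using loc(2)[of "\<lfloor>t\<rfloor>" t] nb[of t] by simp
    ultimately have "(?g has_real_derivative A t) (at t)" by simp
    then show ?thesis unfolding has_field_derivative_def
      by (rule has_derivative_transform_within_open[OF _ open_greaterThanLessThan nb[of t]]) (rule loc(1)[symmetric], auto)
  qed
  have per': "A s = A t \<and> a s - a t \<in> \<int>" if "s - t \<in> \<int>" for s t
    using per[OF that] by (simp add: A_def a_def)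
  have a01: "a t = Q (t / \<epsilon>)" if "t \<in> {0..1}" for t
  proof (cases "t = 1")
    case True
    then show ?thesis using \<epsilon> by (simp add: a_def Q0 Q1)
  next
    case False
    then have "\<lfloor>t\<rfloor> = 0" using that by (auto intro: floor_unique)
    then show ?thesis by (simp add: a_def frac_def)
  qed
  have A01: "A t = Q' (t / \<epsilon>) / \<epsilon>" if "t \<in> {0..1}" for t
  proof (cases "t = 1")
    case True
    then show ?thesis using \<epsilon> by (simp add: A_def Q'0)
  next
    case False
    then have "\<lfloor>t\<rfloor> = 0" using that by (auto intro: floor_unique)
    then show ?thesis by (simp add: A_def frac_def)
  qed
  have "\<exists>s. A t = Q' s / \<epsilon>" for t unfolding A_def by blast
  then show thesis using sa sA da per' a01 A01 by (intro that[of a A]) simp_all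
qed

text \<open>Cutoff functions of the momentum: \<open>chi\<close> falls off in the \<open>k\<close>-th direction with slope barely larger
  than \<open>1 / R\<^sub>k\<close>, and \<open>lam\<close> lives on the plateau of \<open>chi\<close>.\<close>

lemma momentum_cutoffs_exist:
  fixes R :: "real ^ 'n" and k :: 'n and G E :: real
  assumes R: "\<And>i. R $ i > 0" and G: "0 \<le> G" "G < R $ k * E"
  obtains lam chi :: "real ^ 'n \<Rightarrow> real" and \<delta> \<sigma> \<Lambda> K where
    "smooth_on UNIV lam" "smooth_on UNIV chi" "lam 0 = 1" "chi 0 = 1" "\<forall>p. 0 \<le> lam p \<and> lam p \<le> 1" "\<delta> > 0"
    "\<forall>p. norm p < 2 * \<delta> \<longrightarrow> chi p = 1" "\<forall>p. norm p \<ge> \<delta> \<longrightarrow> lam p = 0"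
    "compact K" "K \<subseteq> open_cube R" "\<forall>p. p \<notin> K \<longrightarrow> chi p = 0 \<and> lam p = 0"
    "\<sigma> \<ge> 0" "\<sigma> * G < E" "\<forall>p. \<bar>frechet_derivative chi (at p) (axis k 1)\<bar> \<le> \<sigma>"
    "\<forall>p. \<bar>frechet_derivative lam (at p) (axis k 1)\<bar> \<le> \<Lambda>"
proof -
  have E: "E > 0"
  proof (rule ccontr)
    assume "\<not> E > 0"
    then have "R $ k * E \<le> 0" using R[of k] by (intro mult_nonneg_nonpos) auto
    then show False using G by simp
  qed
  have "G / E < R $ k" using G(2) E by (simp add: field_simps)
  \<comment> \<open>The order is G/E < l1 < l < r < R_k. In direction k the cutoff descends over a
    ramp of length l ending at r, and l < r leaves a plateau. A ramp of normalised slope c = l/l1 >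
    1 has slope at most c/l = 1/l1, and G/l1 < E.\<close>
  then obtain l1 where l1: "G / E < l1" "l1 < R $ k" using dense by blast
  then obtain l where l: "l1 < l" "l < R $ k" using dense by blast
  then obtain r where r: "l < r" "r < R $ k" using dense by blast
  have l1p: "l1 > 0" using l1(1) G(1) E by (meson divide_nonneg_pos le_less_trans)
  have lp: "l > 0" using l1p l by simp
  define c where "c = l / l1"
  have c: "c > 1" using l1p l(1) by (simp add: c_def)
  define \<sigma> where "\<sigma> = c / l"
  have \<sigma>: "\<sigma> = 1 / l1" "\<sigma> \<ge> 0" using lp l1p by (simp_all add: \<sigma>_def c_def)
  have \<sigma>G: "\<sigma> * G < E" using l1(1) l1p E by (simp add: \<sigma>(1) field_simps)
  obtain Q Q' where dQ: "\<And>x. (Q has_real_derivative Q' x) (at x)"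
    and Q: "smooth_on UNIV Q" "smooth_on UNIV Q'" "\<And>x. x \<le> 0 \<Longrightarrow> Q x = 0" "\<And>x. x \<ge> 1 \<Longrightarrow> Q x = 1"
    "\<And>x. 0 \<le> Q x" "\<And>x. Q x \<le> 1" "\<And>x. 0 \<le> Q' x" "\<And>x. Q' x \<le> c" "\<And>x. x \<le> 0 \<or> x \<ge> 1 \<Longrightarrow> Q' x = 0"
    using smooth_ramp_exists[OF c] by metis
  define \<rho> where "\<rho> = Min (range (\<lambda>i. R $ i))"
  have \<rho>: "\<rho> > 0" "\<And>i. \<rho> \<le> R $ i" using R by (auto simp: \<rho>_def)
  \<comment> \<open>The transversal cutoff vanishes once S p \<ge> 2 \<delta>3^2 = \<rho>^2/2, so
    the remaining coordinates stay below \<rho>, inside the cube.\<close>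
  define \<delta>3 where "\<delta>3 = \<rho> / 2"
  have \<delta>3: "\<delta>3 > 0" using \<rho> by (simp add: \<delta>3_def)
  \<comment> \<open>Leaving out the k-th coordinate makes the transversal cutoff constant in
    direction k, so it adds nothing to the slope that is being controlled.\<close>
  define S where "S p = (\<Sum>i\<in>UNIV - {k}. p $ i * p $ i)" for p :: "real ^ 'n"
  define chik where "chik s = Q ((1/l) * (r + s)) * Q ((1/l) * (r - s))" for s
  define \<kappa> where "\<kappa> p = Q (2 - (1/\<delta>3\<^sup>2) * S p)" for p
  define chi where "chi p = chik (p $ k) * \<kappa> p" for p
  \<comment> \<open>The ball of radius 2 \<delta> fits into both plateaus. Since \<open>lam\<close>
    already ends at radius \<delta>, every momentum has a neighbourhood on which \<open>chi\<close>
    is constantly 1 or \<open>lam\<close> is constantly 0.\<close>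
  define \<delta> where "\<delta> = min ((r - l) / 2) (\<delta>3 / 2)"
  have \<delta>: "\<delta> > 0" "2 * \<delta> \<le> r - l" "2 * \<delta> \<le> \<delta>3" using r \<delta>3 unfolding \<delta>_def min_def by auto
  define lam where "lam p = Q (2 - (2/\<delta>\<^sup>2) * (p \<bullet> p))" for p :: "real ^ 'n"
  have comp: "smooth_on UNIV (\<lambda>p::real ^ 'n. p $ i)" for i
    by (rule smooth_on_linear[OF open_UNIV bounded_linear_vec_nth])
  have Ss: "smooth_on UNIV S" unfolding S_def by (intro smooth_on_sum smooth_on_mult comp) auto
  have \<kappa>s: "smooth_on UNIV \<kappa>" unfolding \<kappa>_def
    by (intro smooth_on_compose[OF _ _ _ _ Q(1)] smooth_on_diff smooth_on_mult smooth_on_const Ss) auto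
  have "smooth_on UNIV (\<lambda>p::real ^ 'n. Q ((1/l) * (r + p $ k)) * Q ((1/l) * (r - p $ k)))"
    by (intro smooth_on_mult smooth_on_compose[OF _ _ _ _ Q(1)] smooth_on_diff smooth_on_add smooth_on_const comp) auto
  from smooth_on_mult[OF open_UNIV this \<kappa>s] have chis: "smooth_on UNIV chi"
    unfolding chi_def chik_def .
  have lams: "smooth_on UNIV lam" unfolding lam_def
    by (intro smooth_on_compose[OF _ _ _ _ Q(1)] smooth_on_diff smooth_on_mult smooth_on_const smooth_on_norm_sq smooth_on_id) auto
  have Sn: "S p \<le> (norm p)\<^sup>2" for p :: "real ^ 'n"
  proof -
    have "S p \<le> (\<Sum>i\<in>UNIV. p $ i * p $ i)" unfolding S_def by (intro sum_mono2) auto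
    also have "\<dots> = (norm p)\<^sup>2" by (simp add: power2_norm_eq_inner inner_vec_def)
    finally show ?thesis .
  qed
  have S0: "0 \<le> S p" for p unfolding S_def by (intro sum_nonneg) auto
  have \<kappa>1: "\<kappa> p = 1" if "S p \<le> \<delta>3\<^sup>2" for p
  proof -
    have "(1/\<delta>3\<^sup>2) * S p \<le> 1" using that \<delta>3 by (simp add: field_simps)
    then show ?thesis by (simp add: \<kappa>_def Q(4))
  qed
  have \<kappa>0: "\<kappa> p = 0" if "S p \<ge> 2 * \<delta>3\<^sup>2" for p
  proof -
    have "(1/\<delta>3\<^sup>2) * S p \<ge> 2" using that \<delta>3 by (simp add: field_simps)
    then show ?thesis by (simp add: \<kappa>_def Q(3))
  qed
  have \<kappa>b: "0 \<le> \<kappa> p" "\<kappa> p \<le> 1" for p using Q(5,6) by (simp_all add: \<kappa>_def)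
  have chik1: "chik s = 1" if "\<bar>s\<bar> \<le> r - l" for s
  proof -
    have "(1/l) * (r + s) \<ge> 1" "(1/l) * (r - s) \<ge> 1" using that lp by (auto simp: field_simps)
    then show ?thesis by (simp add: chik_def Q(4))
  qed
  have chik0: "chik s = 0" if "\<bar>s\<bar> > r" for s
  proof -
    have "(1/l) * (r + s) \<le> 0 \<or> (1/l) * (r - s) \<le> 0" using that lp by (auto simp: field_simps)
    then show ?thesis using Q(3) by (auto simp: chik_def)
  qed
  have chi1: "chi p = 1" if "norm p < 2 * \<delta>" for p
  proof -
    have "\<bar>p $ k\<bar> \<le> r - l" using that component_le_norm_cart[of p k] \<delta> by linarith
    moreover have "S p \<le> \<delta>3\<^sup>2"
    proof -
      have "(norm p)\<^sup>2 \<le> \<delta>3\<^sup>2" using that \<delta>(3) by (intro power_mono) auto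
      then show ?thesis using Sn[of p] by simp
    qed
    ultimately show ?thesis using chik1 \<kappa>1 by (simp add: chi_def)
  qed
  have lam0: "lam p = 0" if "norm p \<ge> \<delta>" for p
  proof -
    have "\<delta>\<^sup>2 \<le> p \<bullet> p" using that \<delta> by (simp add: power2_norm_eq_inner[symmetric] power_mono)
    then have "(2/\<delta>\<^sup>2) * (p \<bullet> p) \<ge> 2" using \<delta> by (simp add: field_simps)
    then show ?thesis by (simp add: lam_def Q(3))
  qed
  define K where "K = {p. \<bar>p $ k\<bar> \<le> r} \<inter> {p. S p \<le> 2 * \<delta>3\<^sup>2}"
  have Kc: "p \<in> open_cube R" if "p \<in> K" for p
    unfolding open_cube_def mem_Collect_eq
  proof
    fix i
    show "\<bar>p $ i\<bar> < R $ i"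
    proof (cases "i = k")
      case True
      then show ?thesis using that r by (simp add: K_def)
    next
      case False
      then have "p $ i * p $ i \<le> S p" unfolding S_def by (intro member_le_sum) auto
      then have "(p $ i)\<^sup>2 \<le> 2 * \<delta>3\<^sup>2" using that by (simp add: K_def power2_eq_square)
      also have "\<dots> < \<rho>\<^sup>2" using \<rho>(1) by (simp add: \<delta>3_def power2_eq_square)
      finally have "\<bar>p $ i\<bar>\<^sup>2 < \<rho>\<^sup>2" by simp
      then have "\<bar>p $ i\<bar> < \<rho>" by (rule power2_less_imp_less) (use \<rho>(1) in simp)
      then show ?thesis using \<rho>(2)[of i] by simp
    qed
  qed
  have Kcomp: "compact K"
    unfolding compact_eq_bounded_closed
  proof
    have "norm p \<le> (\<Sum>i\<in>UNIV. R $ i)" if "p \<in> K" for p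
    proof -
      have "norm p \<le> (\<Sum>i\<in>UNIV. \<bar>p $ i\<bar>)" by (rule norm_le_l1_cart)
      also have "\<dots> \<le> (\<Sum>i\<in>UNIV. R $ i)" using Kc[OF that] by (intro sum_mono) (auto simp: open_cube_def less_imp_le)
      finally show ?thesis .
    qed
    then show "bounded K" unfolding bounded_iff by blast
    have "continuous_on UNIV S" by (rule smooth_on_continuous[OF Ss])
    then show "closed K" unfolding K_def by (intro closed_Int closed_Collect_le continuous_intros)
  qed
  have off: "chi p = 0 \<and> lam p = 0" if "p \<notin> K" for p
  proof -
    have "chi p = 0" using that chik0[of "p $ k"] \<kappa>0[of p] by (auto simp: chi_def K_def)
    then have "\<not> norm p < 2 * \<delta>" using chi1 by fastforce
    then show ?thesis using lam0[of p] \<open>chi p = 0\<close> \<delta> by simp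
  qed
  have dchi: "\<bar>frechet_derivative chi (at p) (axis k 1)\<bar> \<le> \<sigma>" for p
  proof -
    let ?D = "frechet_derivative chi (at p)"
    have D: "(chi has_derivative ?D) (at p)"
      using smooth_on_differentiable[OF chis UNIV_I] frechet_derivative_works by blast
    have line: "((\<lambda>s. p + s *\<^sub>R axis k 1) has_derivative (\<lambda>s. s *\<^sub>R axis k 1)) (at (0::real))"
      by (auto intro!: derivative_eq_intros)
    have "((\<lambda>s. chi (p + s *\<^sub>R axis k 1)) has_derivative (\<lambda>s. ?D (s *\<^sub>R axis k 1))) (at 0)"
      using has_derivative_compose[OF line, of chi ?D] D by simp
    then have 1: "((\<lambda>s. chi (p + s *\<^sub>R axis k 1)) has_real_derivative ?D (axis k 1)) (at 0)"
      using linear_scale[OF has_derivative_linear[OF D]] by (simp add: has_field_derivative_def mult.commute[of _ "?D _"])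
    have Sl: "S (p + s *\<^sub>R axis k 1) = S p" for s unfolding S_def
      by (intro sum.cong) (auto simp: axis_def)
    have eq: "chi (p + s *\<^sub>R axis k 1) = chik (p $ k + s) * \<kappa> p" for s
      unfolding chi_def \<kappa>_def Sl by (simp add: axis_def)
    let ?a = "(1/l) * (r + p $ k)" and ?b = "(1/l) * (r - p $ k)"
    have da: "((\<lambda>s. Q ((1/l) * (r + (p $ k + s)))) has_real_derivative Q' ?a * (1/l)) (at 0)"
      using lp by (intro DERIV_chain2[of Q "Q' ?a"]) (auto simp: dQ intro!: derivative_eq_intros)
    have db: "((\<lambda>s. Q ((1/l) * (r - (p $ k + s)))) has_real_derivative Q' ?b * (- (1/l))) (at 0)"
      using lp by (intro DERIV_chain2[of Q "Q' ?b"]) (auto simp: dQ intro!: derivative_eq_intros)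
    have "((\<lambda>s. chik (p $ k + s)) has_real_derivative (Q' ?a * (1/l) * Q ?b + Q' ?b * (- (1/l)) * Q ?a)) (at 0)"
      unfolding chik_def using DERIV_mult[OF da db] by simp
    then have 2: "((\<lambda>s. chi (p + s *\<^sub>R axis k 1)) has_real_derivative (Q' ?a * (1/l) * Q ?b + Q' ?b * (- (1/l)) * Q ?a) * \<kappa> p) (at 0)"
      unfolding eq by (rule DERIV_cmult_right)
    \<comment> \<open>On each side of p_k = 0 one of the two ramps is saturated, so only one factor
      contributes to the derivative.\<close>
    have "\<bar>Q' ?a * (1/l) * Q ?b + Q' ?b * (- (1/l)) * Q ?a\<bar> \<le> \<sigma>"
    proof (cases "p $ k \<ge> 0")
      case True
      then have "?a \<ge> 1" using lp r by (simp add: field_simps)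
      then have "Q' ?a = 0" "Q ?a = 1" using Q by auto
      then have "\<bar>Q' ?a * (1/l) * Q ?b + Q' ?b * (- (1/l)) * Q ?a\<bar> = Q' ?b / l" using Q(7)[of ?b] lp by simp
      also have "\<dots> \<le> \<sigma>" unfolding \<sigma>_def using Q(8) lp by (intro divide_right_mono) auto
      finally show ?thesis .
    next
      case False
      then have "?b \<ge> 1" using lp r by (simp add: field_simps)
      then have "Q' ?b = 0" "Q ?b = 1" using Q by auto
      then have "\<bar>Q' ?a * (1/l) * Q ?b + Q' ?b * (- (1/l)) * Q ?a\<bar> = Q' ?a / l" using Q(7)[of ?a] lp by simp
      also have "\<dots> \<le> \<sigma>" unfolding \<sigma>_def using Q(8) lp by (intro divide_right_mono) auto
      finally show ?thesis .
    qed
    then have "\<bar>Q' ?a * (1/l) * Q ?b + Q' ?b * (- (1/l)) * Q ?a\<bar> * \<kappa> p \<le> \<sigma> * 1"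
      using \<kappa>b \<sigma>(2) by (intro mult_mono) auto
    then show ?thesis unfolding DERIV_unique[OF 1 2] abs_mult using \<kappa>b(1)[of p] by simp
  qed
  have "\<exists>\<Lambda>. \<forall>p. \<bar>frechet_derivative lam (at p) (axis k 1)\<bar> \<le> \<Lambda>"
  proof -
    have "compact ((\<lambda>p. frechet_derivative lam (at p) (axis k 1)) ` cball 0 \<delta>)"
      by (intro compact_continuous_image continuous_on_subset[OF smooth_on_continuous[OF smooth_on_frechet[OF lams]]]) auto
    then obtain \<Lambda> where \<Lambda>: "\<And>p. p \<in> cball 0 \<delta> \<Longrightarrow> \<bar>frechet_derivative lam (at p) (axis k 1)\<bar> \<le> \<Lambda>"
      using compact_imp_bounded by (force simp: bounded_iff)
    have "frechet_derivative lam (at p) (axis k 1) = 0" if "p \<notin> cball 0 \<delta>" for p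
    proof -
      have "(lam has_derivative (\<lambda>_. 0)) (at p)"
        by (rule has_derivative_transform_within_open[OF has_derivative_const[of 0], of "- cball 0 \<delta>"])
          (use that lam0 in auto)
      from frechet_derivative_at[OF this, symmetric] show ?thesis by simp
    qed
    then have "\<bar>frechet_derivative lam (at p) (axis k 1)\<bar> \<le> \<bar>\<Lambda>\<bar>" for p
      using \<Lambda>[of p] by (cases "p \<in> cball 0 \<delta>") auto
    then show ?thesis by blast
  qed
  then obtain \<Lambda> where \<Lambda>: "\<And>p. \<bar>frechet_derivative lam (at p) (axis k 1)\<bar> \<le> \<Lambda>" by blast
  have "lam 0 = 1" "chi 0 = 1" using \<delta> chi1[of 0] by (simp_all add: lam_def Q(4))
  moreover have "0 \<le> lam p" "lam p \<le> 1" for p using Q(5,6) by (simp_all add: lam_def)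
  moreover have "K \<subseteq> open_cube R" using Kc by blast
  ultimately show thesis
    using lams chis \<delta>(1) chi1 lam0 Kcomp off \<sigma>(2) \<sigma>G dchi \<Lambda> by (intro that[of lam chi \<delta> K \<sigma> \<Lambda>]) simp_all
qed

section \<open>Time-periodic Hamiltonians: smoothness, support and sup norm\<close>

lemma circle_mfd_charts:
  "atlas circle_mfd = range (\<lambda>a. (circle_of ` {a<..<a+1}, inv_into {a<..<a+1} circle_of))"
  by (auto simp: circle_mfd_def)

lemma circle_chart_image:
  "chart_image (circle_of ` {a<..<a+1}, inv_into {a<..<a+1} circle_of) = {a<..<a+1}"
  unfolding chart_image_def using inv_into_f_f[OF inj_on_circle_of] by (force simp: image_image)

context symp_mfd
begin

lemma ham_vf_cong:
  assumes "c \<in> atlas M" "y \<in> chart_image c" "\<And>p. p \<in> fst c \<Longrightarrow> f p = g p"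
  shows "ham_vf \<omega> f c y = ham_vf \<omega> g c y"
proof -
  have "frechet_derivative (f \<circ> chart_inv c) (at y) = frechet_derivative (g \<circ> chart_inv c) (at y)"
    by (rule frechet_derivative_cong_open[OF open_chart_image[OF assms(1)] assms(2)]) (use assms in simp)
  then show ?thesis by (simp add: ham_vf_def)
qed

text \<open>Off the manifold the values of \<open>H\<close> are arbitrary.\<close>

definition lift_ham :: "(circle \<times> 'a \<Rightarrow> real) \<Rightarrow> real \<Rightarrow> 'a \<Rightarrow> real"
  where "lift_ham H t p = (if p \<in> topspace (mtop M) then H (circle_of t, p) else 0)"

context
  fixes H assumes H: "H \<in> Cc_smooth (prod_mfd circle_mfd M)"
begin

lemma top_circle_prod: "mtop (prod_mfd circle_mfd M) = prod_topology euclidean (mtop M)"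
  by (simp add: prod_mfd_def circle_mfd_def)

lemma H_continuous: "continuous_map (prod_topology euclidean (mtop M)) euclideanreal H"
  using H by (simp add: Cc_smooth_def smooth_map_def top_circle_prod open_mfd_def)

lemma lift_ham_continuous:
  "continuous_map (prod_topology euclideanreal (mtop M)) euclideanreal (\<lambda>(t, p). lift_ham H t p)"
proof -
  have "continuous_map (prod_topology euclideanreal (mtop M)) euclidean (circle_of \<circ> fst)"
    by (rule continuous_map_compose[OF continuous_map_fst]) (simp add: continuous_circle_of)
  then have "continuous_map (prod_topology euclideanreal (mtop M)) (prod_topology euclidean (mtop M)) (\<lambda>x. (circle_of (fst x), snd x))"
    by (intro continuous_map_pairedI continuous_map_snd) (simp add: o_def)
  from continuous_map_compose[OF this H_continuous]
  show ?thesis by (rule continuous_map_eq) (auto simp: lift_ham_def)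
qed

lemma lift_ham_tsmooth: "tsmooth (lift_ham H)"
  unfolding tsmooth_def
proof
  fix c assume c: "c \<in> atlas M"
  let ?F = "\<lambda>(t, y). lift_ham H t (chart_inv c y)"
  show "smooth_on (UNIV \<times> chart_image c) ?F"
  proof (rule smooth_on_local)
    fix x :: "real \<times> 'e" assume "x \<in> UNIV \<times> chart_image c"
    then obtain t y where x: "x = (t, y)" "y \<in> chart_image c" by blast
    define a where "a = t - 1/2"
    let ?k = "(circle_of ` {a<..<a+1}, inv_into {a<..<a+1} circle_of)"
    let ?D = "(fst ?k \<times> fst c, map_prod (snd ?k) (snd c))"
    let ?U = "{a<..<a+1} \<times> chart_image c"
    have inj: "inj_on (snd ?D) (fst ?D)"
      unfolding fst_conv snd_conv by (intro map_prod_inj_on inj_chart[OF c] inj_on_inv_into) auto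
    have oU: "open ?U" using open_chart_image[OF c] by (intro open_Times) auto
    \<comment> \<open>The preimage of \<open>UNIV\<close> is what the definition of smooth maps
      produces for the single chart of the real line.\<close>
    have im: "snd ?D ` (fst ?D \<inter> H -` UNIV) = ?U"
      using circle_chart_image[of a] unfolding chart_image_def fst_conv snd_conv
      by (simp add: map_prod_surj_on[OF refl refl])
    have "?D \<in> atlas (prod_mfd circle_mfd M)"
      unfolding prod_mfd_def mfd.select_convs
      by (intro CollectI exI[of _ ?k] exI[of _ c]) (use c in \<open>auto simp: circle_mfd_charts\<close>)
    then have "smooth_on (snd ?D ` (fst ?D \<inter> H -` UNIV)) (id \<circ> H \<circ> chart_inv ?D)"
      using H unfolding Cc_smooth_def smooth_map_def open_mfd_def by fastforce
    then have "smooth_on ?U (H \<circ> chart_inv ?D)" unfolding im by simp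
    moreover have "?F z = (H \<circ> chart_inv ?D) z" if zU: "z \<in> ?U" for z
    proof -
      obtain s w where z: "z = (s, w)" "s \<in> {a<..<a+1}" "w \<in> chart_image c" using zU by blast
      have "chart_inv ?D (s, w) = (circle_of s, chart_inv c w)"
        by (rule chart_inv_eqI[OF inj]) (use z c inv_into_f_f[OF inj_on_circle_of z(2)] in auto)
      moreover have "chart_inv c w \<in> topspace (mtop M)" using chart_inv_mem[OF c z(3)] chart_subset[OF c] by blast
      ultimately show ?thesis by (simp add: z(1) lift_ham_def)
    qed
    ultimately have "smooth_on ?U ?F" using smooth_on_cong[OF oU] by blast
    moreover have "x \<in> ?U" using x by (simp add: a_def)
    ultimately show "\<exists>U. open U \<and> x \<in> U \<and> smooth_on U ?F" using oU by blast
  qed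
qed

lemma lift_ham_support:
  obtains C B where "compactin (mtop M) C" "\<And>t p. p \<notin> C \<Longrightarrow> lift_ham H t p = 0" "\<And>t p. \<bar>lift_ham H t p\<bar> \<le> B" "0 \<le> B"
proof -
  let ?X = "prod_topology (euclidean :: circle topology) (mtop M)"
  let ?Z = "?X closure_of {p \<in> topspace ?X. H p \<noteq> 0}"
  have Z: "compactin ?X ?Z" using H by (simp add: Cc_smooth_def top_circle_prod)
  have sub: "{p \<in> topspace ?X. H p \<noteq> 0} \<subseteq> ?Z" by (rule closure_of_subset) auto
  have C: "compactin (mtop M) (snd ` ?Z)" by (rule image_compactin[OF Z continuous_map_snd])
  have "compactin euclideanreal (H ` ?Z)" by (rule image_compactin[OF Z H_continuous])
  then obtain B where B: "\<And>z. z \<in> ?Z \<Longrightarrow> \<bar>H z\<bar> \<le> B" using compact_imp_bounded by (force simp: bounded_iff)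
  show thesis
  proof (rule that[OF C, of "max 0 B"])
    show "lift_ham H t p = 0" if "p \<notin> snd ` ?Z" for t p
    proof (rule ccontr)
      assume "lift_ham H t p \<noteq> 0"
      then have "(circle_of t, p) \<in> ?Z" using sub by (auto simp: lift_ham_def split: if_splits)
      then show False using that by force
    qed
    show "\<bar>lift_ham H t p\<bar> \<le> max 0 B" for t p
    proof (cases "lift_ham H t p = 0")
      case False
      then have "(circle_of t, p) \<in> ?Z" using sub by (auto simp: lift_ham_def split: if_splits)
      then show ?thesis using B by (fastforce simp: lift_ham_def)
    qed auto
  qed auto
qed

lemma ham_curve_iff_sol: "ham_curve M \<omega> H \<gamma> \<longleftrightarrow> sol (lift_ham H) UNIV \<gamma>"
proof -
  have "ham_vf \<omega> (\<lambda>p. H (circle_of t, p)) c (snd c (\<gamma> t)) = ham_vf \<omega> (lift_ham H t) c (snd c (\<gamma> t))"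
    if "c \<in> atlas M" "\<gamma> t \<in> fst c" for c t
    by (rule ham_vf_cong[OF that(1) chart_mem[OF that]]) (use chart_subset[OF that(1)] in \<open>auto simp: lift_ham_def\<close>)
  then show ?thesis unfolding ham_curve_def sol_def by auto
qed

text \<open>Tube lemma around {t} times the compact support; off the support the difference is 0.
  The uniformity in p is what makes the sup norm continuous in time.\<close>

lemma lift_ham_equicontinuous:
  assumes "e > 0"
  shows "\<exists>d>0. \<forall>s p. \<bar>s - t\<bar> < d \<longrightarrow> \<bar>lift_ham H s p - lift_ham H t p\<bar> < e"
proof -
  obtain C where C: "compactin (mtop M) C" "\<And>t p. p \<notin> C \<Longrightarrow> lift_ham H t p = 0" using lift_ham_support by metis
  let ?X = "prod_topology euclideanreal (mtop M)"
  let ?g = "\<lambda>(s, p). lift_ham H s p - lift_ham H t p"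
  have "continuous_map ?X euclideanreal (\<lambda>x. case x of (s, p) \<Rightarrow> lift_ham H s p)" by (rule lift_ham_continuous)
  moreover have "continuous_map ?X euclideanreal (\<lambda>x. lift_ham H t (snd x))"
    using continuous_map_compose[OF continuous_map_snd msmooth_continuous[OF tsmooth_msmooth[OF lift_ham_tsmooth]]]
    by (simp add: o_def)
  ultimately have g: "continuous_map ?X euclideanreal ?g"
    using continuous_map_diff by (fastforce simp: case_prod_unfold)
  define W where "W = {x \<in> topspace ?X. ?g x \<in> {-e<..<e}}"
  have "openin ?X W" unfolding W_def by (rule openin_continuous_map_preimage[OF g]) simp
  moreover have "{t} \<times> C \<subseteq> W" using assms compactin_subset_topspace[OF C(1)] by (auto simp: W_def)
  ultimately obtain U V where UV: "openin euclideanreal U" "t \<in> U" "C \<subseteq> V" "U \<times> V \<subseteq> W"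
    using tube_lemma_right[of euclideanreal "mtop M" W C t] C(1) by auto
  obtain d where d: "d > 0" "\<And>s. \<bar>s - t\<bar> < d \<Longrightarrow> s \<in> U"
    using UV(1,2) eventually_interval_nbhd[of UNIV U t] by auto
  show ?thesis
  proof (intro exI[of _ d] conjI d(1) allI impI)
    fix s p assume s: "\<bar>s - t\<bar> < d"
    show "\<bar>lift_ham H s p - lift_ham H t p\<bar> < e"
    proof (cases "p \<in> C")
      case True
      then have "(s, p) \<in> W" using UV d(2)[OF s] by blast
      then show ?thesis by (auto simp: W_def)
    qed (use C(2) assms in simp)
  qed
qed

text \<open>\<open>integral\<close> has the default value 0 on functions that are not integrable, so
  the Hofer length gives information only once the sup norm is known to be continuous in time.
  Nonemptiness excludes the unspecified supremum of the empty set.\<close>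

lemma sup_norm_properties:
  assumes ne: "topspace (mtop M) \<noteq> {}"
  defines "m \<equiv> \<lambda>t. SUP p\<in>topspace (mtop M). \<bar>H (circle_of t, p)\<bar>"
  shows "continuous_on UNIV m" "\<And>t p. \<bar>lift_ham H t p\<bar> \<le> m t"
proof -
  obtain B where B: "\<And>t p. \<bar>lift_ham H t p\<bar> \<le> B" using lift_ham_support by metis
  have m: "m t = (SUP p\<in>topspace (mtop M). \<bar>lift_ham H t p\<bar>)" for t
    unfolding m_def by (rule SUP_cong) (auto simp: lift_ham_def)
  have bdd: "bdd_above ((\<lambda>p. \<bar>lift_ham H t p\<bar>) ` topspace (mtop M))" for t using B by (intro bdd_aboveI2)
  have le: "\<bar>lift_ham H t p\<bar> \<le> m t" if "p \<in> topspace (mtop M)" for t p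
    unfolding m by (rule cSUP_upper[OF that bdd])
  obtain q where q: "q \<in> topspace (mtop M)" using ne by blast
  have m0: "0 \<le> m t" for t using le[OF q, of t] by linarith
  then show "\<bar>lift_ham H t p\<bar> \<le> m t" for t p using le[of p t] m0[of t] by (cases "p \<in> topspace (mtop M)") (auto simp: lift_ham_def)
  have half: "m s \<le> m t + e" if "\<And>p. \<bar>lift_ham H s p - lift_ham H t p\<bar> < e" for s t e
    unfolding m[of s]
  proof (rule cSUP_least[OF ne])
    fix p assume "p \<in> topspace (mtop M)"
    then show "\<bar>lift_ham H s p\<bar> \<le> m t + e" using le[of p t] that[of p] by linarith
  qed
  show "continuous_on UNIV m"
  proof (rule continuous_at_imp_continuous_on, rule ballI)
    fix t
    show "isCont m t" unfolding isCont_def tendsto_iff eventually_at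
    proof (intro allI impI)
      fix e :: real assume "e > 0"
      then obtain d where d: "d > 0" "\<And>s p. \<bar>s - t\<bar> < d \<Longrightarrow> \<bar>lift_ham H s p - lift_ham H t p\<bar> < e / 2"
        using lift_ham_equicontinuous[of "e / 2" t] by auto
      have "\<bar>m s - m t\<bar> \<le> e / 2" if s: "\<bar>s - t\<bar> < d" for s
      proof -
        have "\<bar>lift_ham H t p - lift_ham H s p\<bar> < e / 2" for p using d(2)[OF s, of p] by linarith
        from half[of t s "e / 2", OF this] half[of s t "e / 2", OF d(2)[OF s]] show ?thesis by linarith
      qed
      then show "\<exists>d>0. \<forall>s\<in>UNIV. s \<noteq> t \<and> dist s t < d \<longrightarrow> dist (m s) (m t) < e"
        using d(1) \<open>e > 0\<close> by (intro exI[of _ d]) (fastforce simp: dist_real_def)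
    qed
  qed
qed

end

section \<open>Changes of time, conserved quantities and the product Hamiltonian\<close>

lemma tsmooth_rescale:
  assumes h: "tsmooth h" and a: "smooth_on UNIV a" and A: "smooth_on UNIV A"
  shows "tsmooth (\<lambda>t p. A t * h (a t) p)"
  unfolding tsmooth_def
proof
  fix c assume c: "c \<in> atlas M"
  let ?U = "UNIV \<times> chart_image c" and ?F = "\<lambda>(t, y). h t (chart_inv c y)"
  have o: "open ?U" using open_chart_image[OF c] by (intro open_Times) auto
  have f: "smooth_on ?U fst" and s: "smooth_on ?U snd"
    using smooth_on_linear[OF o] bounded_linear_fst bounded_linear_snd by blast+
  have "smooth_on ?U (\<lambda>x. (a (fst x), snd x))"
    by (intro smooth_on_Pair o s smooth_on_compose[OF o open_UNIV _ f a]) auto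
  then have "smooth_on ?U (\<lambda>x. ?F (a (fst x), snd x))"
    by (intro smooth_on_compose[where g = ?F and f = "\<lambda>x. (a (fst x), snd x)", OF o o])
      (use h c in \<open>auto simp: tsmooth_def\<close>)
  moreover have "smooth_on ?U (\<lambda>x. A (fst x))" by (rule smooth_on_compose[OF o open_UNIV _ f A]) auto
  ultimately have "smooth_on ?U (\<lambda>x. A (fst x) * ?F (a (fst x), snd x))" by (intro smooth_on_mult o)
  then show "smooth_on ?U (\<lambda>(t, y). A t * h (a t) (chart_inv c y))" by (simp add: case_prod_unfold)
qed

text \<open>The two fields are compared only along the curve itself. Besides reparametrising the
  displacing flow, this serves for an orbit along which the two Hamiltonians have proportional
  differentials but are not proportional functions.\<close>

lemma sol_time_change:
  assumes x: "sol f UNIV x" and d\<phi>: "\<And>t. (\<phi> has_real_derivative \<phi>' t) (at t)"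
    and vf: "\<And>t c. t \<in> T \<Longrightarrow> c \<in> atlas M \<Longrightarrow> x (\<phi> t) \<in> fst c \<Longrightarrow>
      ham_vf \<omega> (g t) c (snd c (x (\<phi> t))) = \<phi>' t *\<^sub>R ham_vf \<omega> (f (\<phi> t)) c (snd c (x (\<phi> t)))"
  shows "sol g T (\<lambda>t. x (\<phi> t))"
  unfolding sol_def
proof (intro conjI ballI impI)
  have "continuous_on T \<phi>" using DERIV_isCont[OF d\<phi>] by (simp add: continuous_at_imp_continuous_on)
  then have "continuous_map (top_of_set T) (top_of_set UNIV) \<phi>" by simp
  from continuous_map_compose[OF this sol_continuous[OF x]]
  show "continuous_map (top_of_set T) (mtop M) (\<lambda>t. x (\<phi> t))" by (simp add: o_def)
  fix t c assume t: "t \<in> T" and c: "c \<in> atlas M" "x (\<phi> t) \<in> fst c"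
  have "(snd c \<circ> x has_vector_derivative ham_vf \<omega> (f (\<phi> t)) c (snd c (x (\<phi> t)))) (at (\<phi> t) within \<phi> ` T)"
    using has_vector_derivative_within_subset[OF sol_derivative[OF x UNIV_I c]] by blast
  moreover have "(\<phi> has_vector_derivative \<phi>' t) (at t within T)"
    using d\<phi>[of t] by (simp add: has_real_derivative_iff_has_vector_derivative has_vector_derivative_at_within)
  ultimately have "((snd c \<circ> x) \<circ> \<phi> has_vector_derivative \<phi>' t *\<^sub>R ham_vf \<omega> (f (\<phi> t)) c (snd c (x (\<phi> t)))) (at t within T)"
    by (intro vector_diff_chain_within)
  then show "(snd c \<circ> (\<lambda>t. x (\<phi> t)) has_vector_derivative ham_vf \<omega> (g t) c (snd c (x (\<phi> t)))) (at t within T)"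
    unfolding vf[OF t c] by (simp add: o_def)
qed

text \<open>The rescaled Hamiltonian generates the same curve run through by \<open>Q\<close>, and
  \<open>Q\<close> fixes 0 and 1, so the end point is the one of the original flow. Uniqueness of
  curves gives the definite description in \<open>ham_flow\<close> its meaning.\<close>

lemma displacing_reparametrized:
  assumes H: "H \<in> Cc_smooth (prod_mfd circle_mfd M)" and disp: "displaces M \<omega> H X" and X: "X \<subseteq> topspace (mtop M)"
    and dQ: "\<And>x. (Q has_real_derivative Q' x) (at x)" and sQ: "smooth_on UNIV Q" "smooth_on UNIV Q'"
    and Q01: "Q 0 = 0" "Q 1 = 1"
    and x: "sol (\<lambda>t p. Q' t * lift_ham H (Q t) p) {0..1} x" and x0: "x 0 \<in> X"
  shows "x 1 \<notin> X"
proof -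
  let ?h = "lift_ham H" and ?g = "\<lambda>t p. Q' t * lift_ham H (Q t) p"
  have h: "tsmooth ?h" by (rule lift_ham_tsmooth[OF H])
  have g: "tsmooth ?g" by (rule tsmooth_rescale[OF h sQ])
  obtain C where C: "compactin (mtop M) C" "\<And>t p. p \<notin> C \<Longrightarrow> ?h t p = 0" using lift_ham_support[OF H] by metis
  have "x 0 \<in> topspace (mtop M)" using x0 X by blast
  then obtain \<zeta> where \<zeta>: "sol ?h UNIV \<zeta>" "\<zeta> 0 = x 0" using sol_exists[OF h C] by blast
  have "(THE \<gamma>. ham_curve M \<omega> H \<gamma> \<and> \<gamma> 0 = x 0) = \<zeta>"
    unfolding ham_curve_iff_sol[OF H]
    by (rule the_equality) (use \<zeta> sol_unique_global[OF h] in auto)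
  then have "ham_flow M \<omega> H 1 (x 0) = \<zeta> 1" by (simp add: ham_flow_def)
  then have "\<zeta> 1 \<in> ham_flow M \<omega> H 1 ` X" using x0 by (metis imageI)
  moreover have "X \<subseteq> mtop M closure_of X" by (rule closure_of_subset[OF X])
  ultimately have "\<zeta> 1 \<notin> X" using disp unfolding displaces_def by blast
  have "sol ?g {0..1} (\<lambda>t. \<zeta> (Q t))"
  proof (rule sol_time_change[OF \<zeta>(1) dQ])
    fix t c assume c: "c \<in> atlas M" "\<zeta> (Q t) \<in> fst c"
    let ?k = "?h (Q t) \<circ> chart_inv c" and ?y = "snd c (\<zeta> (Q t))"
    have y: "?y \<in> chart_image c" using c by simp
    show "ham_vf \<omega> (?g t) c ?y = Q' t *\<^sub>R ham_vf \<omega> (?h (Q t)) c ?y"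
    proof (rule ham_vf_scale[OF c(1) y tsmooth_differentiable[OF h c(1) y] tsmooth_differentiable[OF g c(1) y]])
      fix w
      have "(?k has_derivative frechet_derivative ?k (at ?y)) (at ?y)"
        using tsmooth_differentiable[OF h c(1) y] frechet_derivative_works by blast
      then have "((\<lambda>z. Q' t * ?k z) has_derivative (\<lambda>w. Q' t * frechet_derivative ?k (at ?y) w)) (at ?y)"
        by (rule has_derivative_mult_right)
      from frechet_derivative_at[OF this]
      show "frechet_derivative (?g t \<circ> chart_inv c) (at ?y) w = Q' t * frechet_derivative ?k (at ?y) w"
        by (simp add: o_def fun_eq_iff)
    qed
  qed
  from sol_unique_forward[OF g x this, of 1] have "x 1 = \<zeta> 1" using \<zeta>(2) Q01 by simp
  then show ?thesis using \<open>\<zeta> 1 \<notin> X\<close> by simp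
qed

lemma derivative_along:
  assumes x: "sol f UNIV x" and c: "c \<in> atlas M" "x t \<in> fst c" and g: "msmooth g"
  shows "((\<lambda>s. g (x s)) has_real_derivative
    frechet_derivative (g \<circ> chart_inv c) (at (snd c (x t))) (ham_vf \<omega> (f t) c (snd c (x t)))) (at t)"
proof -
  let ?g = "g \<circ> chart_inv c" and ?y = "snd c (x t)"
  have "(?g has_derivative frechet_derivative ?g (at ?y)) (at ?y)"
    using msmooth_differentiable[OF g c(1) chart_mem[OF c]] frechet_derivative_works by blast
  then have "(?g has_derivative frechet_derivative ?g (at ?y)) (at ((snd c \<circ> x) t) within (snd c \<circ> x) ` UNIV)"
    using has_derivative_at_withinI by simp
  from vector_derivative_diff_chain_within[OF sol_derivative[OF x UNIV_I c] this]
  have d: "(?g \<circ> (snd c \<circ> x) has_vector_derivative frechet_derivative ?g (at ?y) (ham_vf \<omega> (f t) c ?y)) (at t)" .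
  have "openin (top_of_set UNIV) {s \<in> UNIV. x s \<in> fst c}"
    by (rule sol_openin[OF sol_continuous[OF x] openin_chart[OF c(1)]])
  then have "open {s. x s \<in> fst c}" by simp
  from has_vector_derivative_transform_within_open[OF d this, of "\<lambda>s. g (x s)"]
  show ?thesis using c by (simp add: has_real_derivative_iff_has_vector_derivative)
qed

text \<open>The derivative of g along the flow is dg(X_f). It vanishes trivially where g is locally
  constant; where f is locally r g + k it vanishes because \<omega>(X_f, X_f) = 0. For r = 0 this
  identity says nothing about dg, but then X_f itself is 0.\<close>

lemma conserved_at:
  assumes x: "sol f UNIV x" and g: "msmooth g" and f: "msmooth (f t)" and U: "openin (mtop M) U" "x t \<in> U"
    and alt: "(\<forall>p\<in>U. g p = k) \<or> (\<forall>p\<in>U. f t p = r * g p + k)"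
  shows "((\<lambda>s. g (x s)) has_real_derivative 0) (at t)"
proof -
  obtain c where c: "c \<in> atlas M" "x t \<in> fst c" using chart_cover sol_mem[OF x UNIV_I] by blast
  let ?y = "snd c (x t)" and ?U = "snd c ` (fst c \<inter> U)"
  let ?g = "g \<circ> chart_inv c" and ?f = "f t \<circ> chart_inv c" and ?v = "ham_vf \<omega> (f t) c (snd c (x t))"
  have oU: "open ?U" "?y \<in> ?U" using open_chart_transport[OF c(1) U(1)] c U(2) by auto
  have y: "?y \<in> chart_image c" using c by simp
  have df: "?f differentiable at ?y" and dg: "?g differentiable at ?y"
    using msmooth_differentiable[OF _ c(1) y] f g by blast+
  have Dg: "(?g has_derivative frechet_derivative ?g (at ?y)) (at ?y)" using dg frechet_derivative_works by blast
  have "frechet_derivative ?g (at ?y) ?v = 0"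
    using alt
  proof
    assume "\<forall>p\<in>U. g p = k"
    then have "(?g has_derivative (\<lambda>_. 0)) (at ?y)"
      by (intro has_derivative_transform_within_open[OF has_derivative_const[of k] oU]) (use c in auto)
    from frechet_derivative_at[OF this, symmetric] show ?thesis by simp
  next
    assume fU: "\<forall>p\<in>U. f t p = r * g p + k"
    have "((\<lambda>z. r * ?g z + k) has_derivative (\<lambda>w. r * frechet_derivative ?g (at ?y) w + 0)) (at ?y)"
      by (intro has_derivative_add has_derivative_mult_right Dg has_derivative_const)
    then have "(?f has_derivative (\<lambda>w. r * frechet_derivative ?g (at ?y) w + 0)) (at ?y)"
      by (rule has_derivative_transform_within_open[OF _ oU]) (use c fU in auto)
    from frechet_derivative_at[OF this, symmetric]
    have Df: "frechet_derivative ?f (at ?y) w = r * frechet_derivative ?g (at ?y) w" for w by simp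
    have v: "\<omega> c ?y ?v w = - (r * frechet_derivative ?g (at ?y) w)" for w
      using ham_vf_eq[OF c(1) y df] by (simp add: Df)
    show ?thesis
    proof (cases "r = 0")
      case True
      then have "?v = 0" using v by (intro form_nondegenerate[OF c(1) y]) simp
      then show ?thesis using linear_0[OF has_derivative_linear[OF Dg]] by simp
    next
      case False
      then show ?thesis using v[of ?v] form_alt[OF c(1) y, of ?v] by simp
    qed
  qed
  then show ?thesis using derivative_along[OF x c g] by simp
qed

lemma product_hamiltonian_Cc_smooth:
  fixes R :: "real ^ 'n" and lam chi :: "real ^ 'n \<Rightarrow> real"
  assumes H: "H \<in> Cc_smooth (prod_mfd circle_mfd M)"
    and lam: "smooth_on UNIV lam" and chi: "smooth_on UNIV chi"
    and Kp: "compact Kp" "Kp \<subseteq> open_cube R" "\<And>p. p \<notin> Kp \<Longrightarrow> chi p = 0 \<and> lam p = 0"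
    and b: "msmooth b" and th: "msmooth th" and C: "compactin (mtop M) C"
    and C0: "\<And>p. p \<notin> C \<Longrightarrow> b p = 0 \<and> th p = 0" "\<And>t p. p \<notin> C \<Longrightarrow> lift_ham H t p = 0"
    and a: "smooth_on UNIV a" and A: "smooth_on UNIV A"
    and per: "\<And>s t. s - t \<in> \<int> \<Longrightarrow> A s = A t" "\<And>s t. s - t \<in> \<int> \<Longrightarrow> a s - a t \<in> \<int>"
  shows "\<exists>F\<in>Cc_smooth (prod_mfd circle_mfd (prod_mfd M (cotangent_mfd R))).
    \<forall>t x p q. F (circle_of t, (x, (p, q))) =
      lam p * (k1 * b x + k2 * (A t - 1) * th x) + chi p * (A t * lift_ham H (a t) x)"
proof -
  define A' where "A' = circle_fun A"
  \<comment> \<open>The slow time grows by 1 in each period and does not descend to the circle; its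
    class modulo 1 does, and that is all \<open>H\<close> sees of it.\<close>
  define a' where "a' = circle_fun (\<lambda>t. circle_of (a t))"
  have A': "A' (circle_of t) = A t" for t unfolding A'_def by (rule circle_fun) (rule per)
  have a': "a' (circle_of t) = circle_of (a t)" for t
    unfolding a'_def by (rule circle_fun) (simp add: circle_of_eq_iff per)
  have A'c: "continuous_on UNIV A'"
    by (rule continuous_from_circle) (simp add: A' smooth_on_continuous[OF A])
  have a'c: "continuous_on UNIV a'"
    by (rule continuous_from_circle, unfold a')
      (rule continuous_on_compose2[OF continuous_circle_of[of UNIV] smooth_on_continuous[OF a]], simp)
  \<comment> \<open>Values off the manifold are set to 0, so that the formula for \<open>F\<close>
    holds at all points and not only on the manifold.\<close>
  define Hh where "Hh z = (if snd z \<in> topspace (mtop M) then H z else 0)" for z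
  have Hh: "Hh (circle_of t, x) = lift_ham H t x" for t x by (simp add: Hh_def lift_ham_def)
  define F where "F z = lam (fst (snd (snd z))) * (k1 * b (fst (snd z)) + k2 * (A' (fst z) - 1) * th (fst (snd z)))
    + chi (fst (snd (snd z))) * (A' (fst z) * Hh (a' (fst z), fst (snd z)))"
    for z :: "circle \<times> 'a \<times> (real ^ 'n) \<times> (circle ^ 'n)"
  have Feq: "F (circle_of t, (x, (p, q))) =
      lam p * (k1 * b x + k2 * (A t - 1) * th x) + chi p * (A t * lift_ham H (a t) x)" for t x p q
    by (simp add: F_def A' a' Hh)
  let ?T = "prod_topology (euclidean :: circle topology)
    (prod_topology (mtop M) (prod_topology (top_of_set (open_cube R)) (euclidean :: (circle ^ 'n) topology)))"
  have top: "mtop (prod_mfd circle_mfd (prod_mfd M (cotangent_mfd R))) = ?T"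
    by (simp add: prod_mfd_def circle_mfd_def cotangent_mfd_def open_mfd_def torus_mfd_def)
  have cont: "continuous_map ?T euclideanreal F"
  proof -
    have 1: "continuous_map ?T euclidean fst" by (rule continuous_map_fst)
    have 2: "continuous_map ?T (mtop M) (\<lambda>z. fst (snd z))"
      using continuous_map_compose[OF continuous_map_snd continuous_map_fst] by (simp add: o_def)
    have "continuous_map ?T (top_of_set (open_cube R)) (\<lambda>z. fst (snd (snd z)))"
      using continuous_map_compose[OF continuous_map_snd continuous_map_compose[OF continuous_map_snd continuous_map_fst]]
      by (simp add: o_def)
    then have 3: "continuous_map ?T euclidean (\<lambda>z. fst (snd (snd z)))" by (rule continuous_map_into_fulltopology)
    have cl: "continuous_map ?T euclideanreal (\<lambda>z. lam (fst (snd (snd z))))"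
      using continuous_map_compose[OF 3, of euclideanreal lam] smooth_on_continuous[OF lam] by (simp add: o_def)
    have cc: "continuous_map ?T euclideanreal (\<lambda>z. chi (fst (snd (snd z))))"
      using continuous_map_compose[OF 3, of euclideanreal chi] smooth_on_continuous[OF chi] by (simp add: o_def)
    have cb: "continuous_map ?T euclideanreal (\<lambda>z. b (fst (snd z)))"
      using continuous_map_compose[OF 2 msmooth_continuous[OF b]] by (simp add: o_def)
    have ct: "continuous_map ?T euclideanreal (\<lambda>z. th (fst (snd z)))"
      using continuous_map_compose[OF 2 msmooth_continuous[OF th]] by (simp add: o_def)
    have cA: "continuous_map ?T euclideanreal (\<lambda>z. A' (fst z))"
      using continuous_map_compose[OF 1, of euclideanreal A'] A'c by (simp add: o_def)
    have ca: "continuous_map ?T euclidean (\<lambda>z. a' (fst z))"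
      using continuous_map_compose[OF 1, of euclidean a'] a'c by (simp add: o_def)
    have "continuous_map ?T (prod_topology euclidean (mtop M)) (\<lambda>z. (a' (fst z), fst (snd z)))"
      by (rule continuous_map_pairedI[OF ca 2])
    from continuous_map_compose[OF this H_continuous[OF H]]
    have cH: "continuous_map ?T euclideanreal (\<lambda>z. Hh (a' (fst z), fst (snd z)))"
      by (rule continuous_map_eq) (auto simp: Hh_def)
    show ?thesis unfolding F_def
      by (intro continuous_map_add continuous_map_real_mult continuous_map_diff cl cc cb ct cA cH) auto
  qed
  have smooth: "smooth_on (snd D ` (fst D \<inter> F -` UNIV)) (id \<circ> F \<circ> chart_inv D)"
    if D: "D \<in> atlas (prod_mfd circle_mfd (prod_mfd M (cotangent_mfd R)))" for D
  proof -
    obtain s c e where c: "c \<in> atlas M" and D': "D = (circle_of ` {s<..<s+1} \<times> fst (prod_chart c R e),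
        map_prod (inv_into {s<..<s+1} circle_of) (snd (prod_chart c R e)))"
    proof -
      have "D \<in> {(fst k \<times> fst d, map_prod (snd k) (snd d)) | k d. k \<in> atlas circle_mfd \<and> d \<in> atlas (prod_mfd M (cotangent_mfd R))}"
        using D unfolding prod_mfd_def[of circle_mfd] by simp
      then show thesis using that unfolding circle_mfd_charts atlas_product by fastforce
    qed
    have inj: "inj_on (snd D) (fst D)" unfolding D' fst_conv snd_conv
      by (intro map_prod_inj_on inj_prod_chart[OF c] inj_on_inv_into) auto
    let ?U = "{s<..<s+1} \<times> (chart_image c \<times> (open_cube R \<times> unit_box e))"
    have oU: "open ?U" using open_chart_image[OF c] open_open_cube open_unit_box by (intro open_Times) auto
    have im: "snd D ` (fst D \<inter> F -` UNIV) = ?U"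
    proof -
      have "snd (prod_chart c R e) ` fst (prod_chart c R e) = chart_image c \<times> (open_cube R \<times> unit_box e)"
        using prod_chart_image[of c R e] by (simp add: chart_image_def)
      moreover have "inv_into {s<..<s+1} circle_of ` circle_of ` {s<..<s+1} = {s<..<s+1}"
        using circle_chart_image[of s] by (simp add: chart_image_def)
      ultimately show ?thesis unfolding D' fst_conv snd_conv by (simp add: map_prod_surj_on[OF refl refl])
    qed
    have ci: "chart_inv D (t, (y, (p, \<eta>))) = (circle_of t, (chart_inv c y, (p, torus_of \<eta>)))"
      if "t \<in> {s<..<s+1}" "y \<in> chart_image c" "p \<in> open_cube R" "\<eta> \<in> unit_box e" for t y p \<eta>
    proof (rule chart_inv_eqI[OF inj])
      show "(circle_of t, (chart_inv c y, (p, torus_of \<eta>))) \<in> fst D"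
        using that c by (auto simp: D' prod_chart_def)
      show "snd D (circle_of t, (chart_inv c y, (p, torus_of \<eta>))) = (t, (y, (p, \<eta>)))"
        using that c inv_into_f_f[OF inj_on_circle_of that(1)] torus_chart_inverse[OF that(4)]
        by (simp add: D' prod_chart_def)
    qed
    let ?hc = "\<lambda>(t, y). lift_ham H t (chart_inv c y)"
    define G where "G z = lam (fst (snd (snd z))) * (k1 * (b \<circ> chart_inv c) (fst (snd z)) + k2 * (A (fst z) - 1) * (th \<circ> chart_inv c) (fst (snd z)))
      + chi (fst (snd (snd z))) * (A (fst z) * ?hc (a (fst z), fst (snd z)))"
      for z :: "real \<times> 'e \<times> (real ^ 'n) \<times> (real ^ 'n)"
    have pr1: "smooth_on ?U fst" by (rule smooth_on_linear[OF oU bounded_linear_fst])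
    have pr2: "smooth_on ?U (\<lambda>z. fst (snd z))"
      by (rule smooth_on_linear[OF oU bounded_linear_compose[OF bounded_linear_fst bounded_linear_snd]])
    have pr3: "smooth_on ?U (\<lambda>z. fst (snd (snd z)))"
      by (rule smooth_on_linear[OF oU bounded_linear_compose[OF bounded_linear_fst bounded_linear_compose[OF bounded_linear_snd bounded_linear_snd]]])
    have sl: "smooth_on ?U (\<lambda>z. lam (fst (snd (snd z))))" by (rule smooth_on_compose[OF oU open_UNIV _ pr3 lam]) simp
    have sc: "smooth_on ?U (\<lambda>z. chi (fst (snd (snd z))))" by (rule smooth_on_compose[OF oU open_UNIV _ pr3 chi]) simp
    have sA: "smooth_on ?U (\<lambda>z. A (fst z))" by (rule smooth_on_compose[OF oU open_UNIV _ pr1 A]) simp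
    have sa: "smooth_on ?U (\<lambda>z. a (fst z))" by (rule smooth_on_compose[OF oU open_UNIV _ pr1 a]) simp
    have sb: "smooth_on ?U (\<lambda>z. (b \<circ> chart_inv c) (fst (snd z)))"
      by (rule smooth_on_compose[OF oU open_chart_image[OF c] _ pr2]) (use b c in \<open>auto simp: msmooth_def simp del: o_apply\<close>)
    have st: "smooth_on ?U (\<lambda>z. (th \<circ> chart_inv c) (fst (snd z)))"
      by (rule smooth_on_compose[OF oU open_chart_image[OF c] _ pr2]) (use th c in \<open>auto simp: msmooth_def simp del: o_apply\<close>)
    have sp: "smooth_on ?U (\<lambda>z. (a (fst z), fst (snd z)))" by (rule smooth_on_Pair[OF oU sa pr2])
    have oc: "open (UNIV \<times> chart_image c :: (real \<times> 'e) set)" using open_chart_image[OF c] by (intro open_Times) auto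
    have shc: "smooth_on (UNIV \<times> chart_image c) ?hc" using lift_ham_tsmooth[OF H] c unfolding tsmooth_def by blast
    have sh: "smooth_on ?U (\<lambda>z. ?hc (a (fst z), fst (snd z)))"
      by (rule smooth_on_compose[where g = ?hc and f = "\<lambda>z. (a (fst z), fst (snd z))", OF oU oc _ sp shc]) auto
    have "smooth_on ?U G" unfolding G_def
      by (intro smooth_on_add smooth_on_diff smooth_on_mult smooth_on_const oU sl sc sA sb st sh)
    then have "smooth_on ?U (id \<circ> F \<circ> chart_inv D)"
      by (rule smooth_on_cong[OF oU, rotated]) (auto simp: ci Feq G_def)
    then show ?thesis unfolding im .
  qed
  have supp: "compactin ?T (?T closure_of {z \<in> topspace ?T. F z \<noteq> 0})"
  proof -
    let ?S = "(UNIV :: circle set) \<times> (C \<times> (Kp \<times> (UNIV :: (circle ^ 'n) set)))"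
    have "compactin ?T ?S"
      using C Kp by (simp add: compactin_Times compactin_subtopology compact_circle compact_torus)
    moreover have "closedin ?T ?S"
      using compactin_imp_closedin[OF Hausdorff C] compact_imp_closed[OF Kp(1)] Kp(2)
      by (simp add: closedin_prod_Times_iff closed_subset)
    moreover have "{z \<in> topspace ?T. F z \<noteq> 0} \<subseteq> ?S"
    proof
      fix z assume "z \<in> {z \<in> topspace ?T. F z \<noteq> 0}"
      then have "F z \<noteq> 0" by blast
      obtain \<theta> x p q where z: "z = (\<theta>, (x, (p, q)))" by (metis prod.collapse)
      obtain t where "\<theta> = circle_of t" using circle_of_surj by metis
      then have nz: "lam p * (k1 * b x + k2 * (A t - 1) * th x) + chi p * (A t * lift_ham H (a t) x) \<noteq> 0"
        using \<open>F z \<noteq> 0\<close> Feq z by simp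
      have "p \<in> Kp" using nz Kp(3) by fastforce
      moreover have "x \<in> C" using nz C0 by fastforce
      ultimately show "z \<in> ?S" using z by simp
    qed
    ultimately show ?thesis using closure_of_minimal closed_compactin closedin_closure_of by meson
  qed
  have "F \<in> Cc_smooth (prod_mfd circle_mfd (prod_mfd M (cotangent_mfd R)))"
    unfolding Cc_smooth_def smooth_map_def top mem_Collect_eq open_mfd_def using cont smooth supp by simp
  then show ?thesis using Feq by blast
qed

end

section \<open>Exclusion of closed orbits\<close>

lemma const_zero_Cc_smooth: "(\<lambda>_. 0) \<in> Cc_smooth N"
  by (simp add: Cc_smooth_def smooth_map_def open_mfd_def o_def smooth_on_const)

lemma smooth_deriv_zero:
  fixes f :: "'b::real_normed_vector \<Rightarrow> real"
  assumes "open U" "p \<in> U" "\<And>q. q \<in> U \<Longrightarrow> f q = k" shows "frechet_derivative f (at p) v = 0"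
proof -
  have "(f has_derivative (\<lambda>_. 0)) (at p)"
    by (rule has_derivative_transform_within_open[OF has_derivative_const[of k] assms(1,2)]) (use assms in auto)
  from frechet_derivative_at[OF this, symmetric] show ?thesis by simp
qed

text \<open>Monotonicity of W - L and W + L; it replaces the estimate of an integral by the
  comparison of two primitives.\<close>

lemma DERIV_abs_increment_le:
  fixes L W :: "real \<Rightarrow> real"
  assumes "a \<le> b" and L: "\<And>t. (L has_real_derivative u t) (at t)" and W: "\<And>t. (W has_real_derivative w t) (at t)"
    and le: "\<And>t. a \<le> t \<Longrightarrow> t \<le> b \<Longrightarrow> \<bar>u t\<bar> \<le> w t"
  shows "\<bar>L b - L a\<bar> \<le> W b - W a"
proof -
  have "W a - L a \<le> W b - L b"
  proof (rule DERIV_nonneg_imp_nondecreasing[OF \<open>a \<le> b\<close>, of "\<lambda>t. W t - L t"])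
    fix t assume "a \<le> t" "t \<le> b"
    then show "\<exists>y. ((\<lambda>t. W t - L t) has_real_derivative y) (at t) \<and> 0 \<le> y"
      using DERIV_diff[OF W L, of t] le[of t] by (intro exI[of _ "w t - u t"]) auto
  qed
  moreover have "W a + L a \<le> W b + L b"
  proof (rule DERIV_nonneg_imp_nondecreasing[OF \<open>a \<le> b\<close>, of "\<lambda>t. W t + L t"])
    fix t assume "a \<le> t" "t \<le> b"
    then show "\<exists>y. ((\<lambda>t. W t + L t) has_real_derivative y) (at t) \<and> 0 \<le> y"
      using DERIV_add[OF W L, of t] le[of t] by (intro exI[of _ "w t + u t"]) auto
  qed
  ultimately show ?thesis by linarith
qed

context symp_mfd
begin

text \<open>On the plateau of \<open>chi\<close> the momentum is a mere parameter \<open>s\<close>. A closed orbit cannot meet the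
  support of \<open>b\<close> at integer times, since the fast part \<open>[0, \<epsilon>]\<close> of the period displaces it while the
  slow part preserves the level sets of \<open>b\<close>; hence it can see \<open>b\<close> only during \<open>[0, \<epsilon>]\<close>.\<close>

lemma closed_orbit_avoids_bump:
  assumes h: "tsmooth h" and b: "msmooth b" and th: "msmooth th"
    and a: "smooth_on UNIV a" and A: "smooth_on UNIV A" and \<epsilon>: "0 < \<epsilon>" "\<epsilon> < 1"
    and aA: "\<And>t. t \<in> {0..1} \<Longrightarrow> a t = Q (t / \<epsilon>)" "\<And>t. t \<in> {0..1} \<Longrightarrow> A t = Q' (t / \<epsilon>) / \<epsilon>"
    and Q'0: "\<And>x. x \<ge> 1 \<Longrightarrow> Q' x = (0::real)" and sQ: "smooth_on UNIV Q" "smooth_on UNIV Q'"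
    and C: "closedin (mtop M) C" "\<And>p. p \<notin> C \<Longrightarrow> b p = 0" "\<And>t p. p \<notin> C \<Longrightarrow> h t p = 0"
    and V: "openin (mtop M) V" "C \<subseteq> V" "\<And>p. p \<in> V \<Longrightarrow> th p = 1" and th1: "\<And>p. th p \<le> 1"
    and D: "\<And>p. p \<notin> D \<Longrightarrow> b p = 0" "D \<subseteq> C"
    and disp: "\<And>y. sol (\<lambda>t p. Q' t * h (Q t) p + \<epsilon> * s * k1 * b p) {0..1} y \<Longrightarrow> y 0 \<in> D \<Longrightarrow> y 1 \<notin> D"
    and x: "sol (\<lambda>t p. s * (k1 * b p + k2 * (A t - 1) * th p) + 1 * (A t * h (a t) p)) UNIV x"
    and closed: "x 0 = x 1"
  shows "th (x t) = th (x 0)" "\<epsilon> \<le> t \<Longrightarrow> t \<le> 1 \<Longrightarrow> b (x t) = 0"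
proof -
  define f where "f t p = s * (k1 * b p + k2 * (A t - 1) * th p) + 1 * (A t * h (a t) p)" for t p
  have xf: "sol f UNIV x" using x unfolding f_def .
  have g: "tsmooth (\<lambda>t p. A t * h (a t) p)" by (rule tsmooth_rescale[OF h a A])
  have msm_comb: "msmooth (\<lambda>p. r1 * b p + r2 * th p + g p)" if "msmooth g" for r1 r2 g
    using b th that unfolding msmooth_def o_def
    by (auto intro!: smooth_on_add smooth_on_mult smooth_on_const open_chart_image)
  have f: "msmooth (f t)" for t
  proof -
    have "f t = (\<lambda>p. (s * k1) * b p + (s * k2 * (A t - 1)) * th p + A t * h (a t) p)"
      by (auto simp: f_def algebra_simps)
    then show ?thesis using msm_comb[OF tsmooth_msmooth[OF g]] by simp
  qed
  let ?W = "topspace (mtop M) - C"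
  have W: "openin (mtop M) ?W" using C(1) by auto
  have xt: "x t \<in> topspace (mtop M)" for t using sol_mem[OF xf] by blast
  have dth: "((\<lambda>t. th (x t)) has_real_derivative 0) (at t)" for t
  \<comment> \<open>Near \<open>C\<close> the function \<open>th\<close> is constant; off
    \<open>C\<close> both \<open>b\<close> and \<open>h\<close> vanish, and the Hamiltonian is a
    multiple of \<open>th\<close>. Either way \<open>th\<close> is conserved.\<close>
  proof (cases "x t \<in> C")
    case True
    then show ?thesis using V by (intro conserved_at[OF xf th f V(1), of t 1]) auto
  next
    case False
    have "\<forall>p\<in>?W. f t p = (s * k2 * (A t - 1)) * th p + 0" using C(2,3) by (simp add: f_def)
    then show ?thesis using False xt by (intro conserved_at[OF xf th f W, of t 0 "s * k2 * (A t - 1)"]) auto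
  qed
  then show thx: "th (x t) = th (x 0)" for t by (intro DERIV_isconst_all) blast
  have db: "((\<lambda>t. b (x t)) has_real_derivative 0) (at t)" if t: "\<epsilon> \<le> t" "t \<le> 1" for t
  proof -
    have A0: "A t = 0" using aA(2)[of t] Q'0[of "t / \<epsilon>"] t \<epsilon> by simp
    show ?thesis
    proof (cases "x t \<in> C")
      case True
      \<comment> \<open>After time \<epsilon> the fast Hamiltonian is switched off and
        \<open>th\<close> is 1 on \<open>V\<close>, so the Hamiltonian is affine in
        \<open>b\<close>.\<close>
      have "\<forall>p\<in>V. f t p = (s * k1) * b p + (- (s * k2))" using V(3) A0 by (simp add: f_def algebra_simps)
      then show ?thesis using True V by (intro conserved_at[OF xf b f V(1), of t "- (s * k2)" "s * k1"]) auto
    next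
      case False
      have "\<forall>p\<in>?W. b p = 0" using C(2) by simp
      then show ?thesis using False xt by (intro conserved_at[OF xf b f W, of t 0 0]) auto
    qed
  qed
  have bx: "b (x t) = b (x 1)" if t: "\<epsilon> \<le> t" "t \<le> 1" for t
  proof -
    have "\<exists>k. \<forall>t\<in>{\<epsilon>..1}. b (x t) = k"
      by (rule has_field_derivative_zero_constant) (use db in \<open>auto intro: has_field_derivative_at_within\<close>)
    then show ?thesis using t by fastforce
  qed
  have "b (x 0) = 0"
  proof (rule ccontr)
    assume b0: "b (x 0) \<noteq> 0"
    then have x0D: "x 0 \<in> D" using D(1) by blast
    then have "x 0 \<in> V" using D(2) V(2) by blast
    then have thx1: "th (x t) = 1" for t using thx[of t] V(3) by simp
    let ?g = "\<lambda>t p. Q' t * h (Q t) p + \<epsilon> * s * k1 * b p"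
    have sg: "tsmooth (\<lambda>t p. Q' t * h (Q t) p)" by (rule tsmooth_rescale[OF h sQ])
    \<comment> \<open>Stretching [0, \<epsilon>] to unit length turns the orbit into a solution of
      the displacing system with perturbation parameter \<epsilon> s k1.\<close>
    have "sol ?g {0..1} (\<lambda>\<tau>. x (\<epsilon> * \<tau>))"
    proof (rule sol_time_change[OF xf])
      show "((*) \<epsilon> has_real_derivative \<epsilon>) (at t)" for t
        using DERIV_cmult[OF DERIV_ident, of \<epsilon> t UNIV] by simp
      fix \<tau> c assume \<tau>: "\<tau> \<in> {0..1::real}" and c: "c \<in> atlas M" "x (\<epsilon> * \<tau>) \<in> fst c"
      let ?t = "\<epsilon> * \<tau>"
      let ?y = "snd c (x ?t)"
      have y: "?y \<in> chart_image c" using c by simp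
      have "\<epsilon> * \<tau> \<le> 1 * 1" using \<epsilon> \<tau> by (intro mult_mono) auto
      then have t01: "?t \<in> {0..1}" using \<epsilon> \<tau> by auto
      have At: "a ?t = Q \<tau>" "\<epsilon> * A ?t = Q' \<tau>" using aA[OF t01] \<epsilon> by auto
      let ?b = "b \<circ> chart_inv c" and ?th = "th \<circ> chart_inv c" and ?h = "h (Q \<tau>) \<circ> chart_inv c"
      have Db: "(?b has_derivative frechet_derivative ?b (at ?y)) (at ?y)"
        and Dth: "(?th has_derivative frechet_derivative ?th (at ?y)) (at ?y)"
        and Dh: "(?h has_derivative frechet_derivative ?h (at ?y)) (at ?y)"
        using msmooth_differentiable[OF _ c(1) y] b th tsmooth_msmooth[OF h] frechet_derivative_works by blast+
      \<comment> \<open>The orbit may leave \<open>V\<close>, where \<open>th\<close> is known to be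
        locally constant. But \<open>th\<close> is conserved, hence still equal to its maximum 1 on
        the orbit, so its differential vanishes there and the term drops out.\<close>
      have "\<forall>z\<in>chart_image c. ?th z \<le> ?th ?y" using th1 thx1[of ?t] c by simp
      then have th0: "frechet_derivative ?th (at ?y) = (\<lambda>_. 0)"
        using differential_zero_maxmin[OF y open_chart_image[OF c(1)] Dth] by blast
      have "((\<lambda>z. s * (k1 * ?b z + k2 * (A ?t - 1) * ?th z) + A ?t * ?h z) has_derivative
          (\<lambda>w. s * (k1 * frechet_derivative ?b (at ?y) w + k2 * (A ?t - 1) * 0) + A ?t * frechet_derivative ?h (at ?y) w)) (at ?y)"
        by (intro has_derivative_add has_derivative_mult_right Db Dh Dth[unfolded th0])
      then have Df: "(f ?t \<circ> chart_inv c has_derivative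
          (\<lambda>w. s * (k1 * frechet_derivative ?b (at ?y) w) + A ?t * frechet_derivative ?h (at ?y) w)) (at ?y)"
        by (simp add: f_def[abs_def] o_def At)
      have "((\<lambda>z. Q' \<tau> * ?h z + \<epsilon> * s * k1 * ?b z) has_derivative
          (\<lambda>w. Q' \<tau> * frechet_derivative ?h (at ?y) w + \<epsilon> * s * k1 * frechet_derivative ?b (at ?y) w)) (at ?y)"
        by (intro has_derivative_add has_derivative_mult_right Db Dh)
      then have Dg: "(?g \<tau> \<circ> chart_inv c has_derivative
          (\<lambda>w. Q' \<tau> * frechet_derivative ?h (at ?y) w + \<epsilon> * s * k1 * frechet_derivative ?b (at ?y) w)) (at ?y)"
        by (simp add: o_def)
      show "ham_vf \<omega> (?g \<tau>) c ?y = \<epsilon> *\<^sub>R ham_vf \<omega> (f ?t) c ?y"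
      proof (rule ham_vf_scale[OF c(1) y])
        show "f ?t \<circ> chart_inv c differentiable at ?y" "?g \<tau> \<circ> chart_inv c differentiable at ?y"
          using Df Dg unfolding differentiable_def by blast+
        fix w
        show "frechet_derivative (?g \<tau> \<circ> chart_inv c) (at ?y) w = \<epsilon> * frechet_derivative (f ?t \<circ> chart_inv c) (at ?y) w"
          unfolding fun_cong[OF frechet_derivative_at[OF Dg], of w, symmetric]
            fun_cong[OF frechet_derivative_at[OF Df], of w, symmetric]
          unfolding At(2)[symmetric] by (simp add: algebra_simps)
      qed
    qed
    \<comment> \<open>Having left \<open>D\<close>, the orbit has b = 0 at time \<epsilon> and
      therefore also at time 1, where it is back at its starting point: a contradiction.\<close>
    from disp[OF this] have "x \<epsilon> \<notin> D" using x0D by simp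
    then have "b (x \<epsilon>) = 0" by (rule D(1))
    then show False using bx[of \<epsilon>] closed b0 \<epsilon> by simp
  qed
  then show "b (x t) = 0" if "\<epsilon> \<le> t" "t \<le> 1" for t using bx[OF that] closed by simp
qed

lemma hamiltonian_without_orbits:
  fixes R :: "real ^ 'n" and e :: "int ^ 'n"
  assumes H: "H \<in> Cc_smooth (prod_mfd circle_mfd M)" and disp: "displaces M \<omega> H X"
    and X: "compactin (mtop M) X" and R: "\<And>i. R $ i > 0" and ne: "topspace (mtop M) \<noteq> {}"
    and len: "hofer_length M H < R $ k * real_of_int \<bar>e $ k\<bar>" and K: "K > 0"
  shows "\<exists>F\<in>Cc_smooth (prod_mfd circle_mfd (prod_mfd M (cotangent_mfd R))).
    (\<forall>\<theta> x q. x \<in> X \<longrightarrow> K \<le> F (\<theta>, (x, (0, q)))) \<and>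
    periodic_orbits (prod_mfd M (cotangent_mfd R)) (sum_symplectic M \<omega> (cotangent_mfd R) omega0) F (loop_class M R e) = {}"
proof -
  define h where "h = lift_ham H"
  have h: "tsmooth h" unfolding h_def by (rule lift_ham_tsmooth[OF H])
  define m where "m t = (SUP p\<in>topspace (mtop M). \<bar>H (circle_of t, p)\<bar>)" for t
  have mc: "continuous_on UNIV m" and hm: "\<And>t p. \<bar>h t p\<bar> \<le> m t"
    using sup_norm_properties[OF H ne] unfolding m_def h_def by blast+
  have m0: "0 \<le> m t" for t using hm[of t undefined] by linarith
  define G where "G = hofer_length M H"
  have Gm: "G = integral {0..1} m" by (simp add: G_def hofer_length_def m_def[abs_def])
  have G0: "0 \<le> G" unfolding Gm by (rule integral_nonneg) (use m0 mc in \<open>auto intro!: integrable_continuous_real intro: continuous_on_subset\<close>)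
  obtain Mf where Mf: "\<And>t. (Mf has_real_derivative m t) (at t)" using antiderivative_on_line[OF mc] by blast
  have MfG: "Mf 1 - Mf 0 = G"
  proof -
    have "(m has_integral (Mf 1 - Mf 0)) {0..1}"
      by (rule fundamental_theorem_of_calculus)
        (use Mf in \<open>auto simp: has_real_derivative_iff_has_vector_derivative has_vector_derivative_at_within\<close>)
    then show ?thesis unfolding Gm by (simp add: integral_unique)
  qed
  obtain lam chi :: "real ^ 'n \<Rightarrow> real" and \<delta> \<sigma> \<Lambda> Kp where lam: "smooth_on UNIV lam" and chi: "smooth_on UNIV chi"
    and lc0: "lam 0 = 1" "chi 0 = 1" and lam01: "\<forall>p. 0 \<le> lam p \<and> lam p \<le> 1" and \<delta>: "\<delta> > 0"
    and chi1: "\<forall>p. norm p < 2 * \<delta> \<longrightarrow> chi p = 1" and lam0: "\<forall>p. norm p \<ge> \<delta> \<longrightarrow> lam p = 0"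
    and Kp: "compact Kp" "Kp \<subseteq> open_cube R" "\<forall>p. p \<notin> Kp \<longrightarrow> chi p = 0 \<and> lam p = 0"
    and \<sigma>: "\<sigma> \<ge> 0" "\<sigma> * G < real_of_int \<bar>e $ k\<bar>" "\<forall>p. \<bar>frechet_derivative chi (at p) (axis k 1)\<bar> \<le> \<sigma>"
    and \<Lambda>: "\<forall>p. \<bar>frechet_derivative lam (at p) (axis k 1)\<bar> \<le> \<Lambda>"
    by (rule momentum_cutoffs_exist[OF R G0 len[folded G_def]], rule that)
  \<comment> \<open>The class enters on the plateau through integrality alone: e_k is nonzero, so an
    advance of absolute value below 1 is already excluded.\<close>
  have ek: "1 \<le> real_of_int \<bar>e $ k\<bar>"
  proof -
    have "0 \<le> \<sigma> * G" using \<sigma>(1) G0 by simp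
    then have "0 < real_of_int \<bar>e $ k\<bar>" using \<sigma>(2) by (rule le_less_trans)
    then have "1 \<le> \<bar>e $ k\<bar>" unfolding of_int_0_less_iff by linarith
    then show ?thesis unfolding of_int_1_le_iff .
  qed
  \<comment> \<open>The slope bound 2 is arbitrary; the change of time uses only the monotone
    passage from 0 to 1.\<close>
  obtain Q Q' where dQ: "\<And>x. (Q has_real_derivative Q' x) (at x)" and sQ: "smooth_on UNIV Q" "smooth_on UNIV Q'"
    and Q0: "\<And>x. x \<le> 0 \<Longrightarrow> Q x = 0" and Q1: "\<And>x. x \<ge> 1 \<Longrightarrow> Q x = 1"
    and Q'p: "\<And>x. 0 \<le> Q' x" and Q'0: "\<And>x. x \<le> 0 \<or> x \<ge> 1 \<Longrightarrow> Q' x = 0"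
    using smooth_ramp_exists[of 2] by (metis one_less_numeral_iff semiring_norm(76))
  obtain C0 B0 where C0: "compactin (mtop M) C0" "\<And>t p. p \<notin> C0 \<Longrightarrow> h t p = 0" and B0: "\<And>t p. \<bar>h t p\<bar> \<le> B0" "0 \<le> B0"
    using lift_ham_support[OF H] unfolding h_def by metis
  define g where "g t p = Q' t * h (Q t) p" for t p
  have g: "tsmooth g" unfolding g_def by (rule tsmooth_rescale[OF h sQ])
  have gC: "g t p = 0" if "p \<notin> C0" for t p using C0(2)[OF that] by (simp add: g_def)
  have dispg: "\<gamma> 1 \<notin> X" if "sol g {0..1} \<gamma>" "\<gamma> 0 \<in> X" for \<gamma>
    by (rule displacing_reparametrized[of H X Q Q' \<gamma>, OF H disp compactin_subset_topspace[OF X] dQ sQ])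
      (use that Q0[of 0] Q1[of 1] in \<open>simp_all add: g_def[abs_def] h_def\<close>)
  \<comment> \<open>With zero perturbation this only thickens \<open>X\<close> to an open set, which
    leaves room for a bump whose whole support \<open>D\<close> is displaced.\<close>
  have "\<exists>U \<eta>. openin (mtop M) U \<and> X \<subseteq> U \<and> \<eta> > 0 \<and>
    (\<forall>s x. \<bar>s\<bar> \<le> \<eta> \<longrightarrow> sol (\<lambda>t p. g t p + s * 0) {0..1} x \<longrightarrow> x 0 \<in> U \<longrightarrow> x 1 \<notin> U)"
    by (rule robust_displacement[where h = g and C = C0 and \<beta> = "\<lambda>_. 0" and D = X])
      (fact g C0(1) gC msmooth_const X dispg)+
  then obtain U \<eta>1 where U: "openin (mtop M) U" "X \<subseteq> U" and \<eta>1: "\<eta>1 > 0"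
    "\<forall>s x. \<bar>s\<bar> \<le> \<eta>1 \<longrightarrow> sol (\<lambda>t p. g t p + s * 0) {0..1} x \<longrightarrow> x 0 \<in> U \<longrightarrow> x 1 \<notin> U"
    by (elim exE conjE) (rule that)
  have dispU: "\<gamma> 1 \<notin> U" if "sol g {0..1} \<gamma>" "\<gamma> 0 \<in> U" for \<gamma>
    using \<eta>1(2)[rule_format, of 0 \<gamma>] \<eta>1(1) that by simp
  obtain b Vb D where b: "msmooth b" and b01: "\<And>x. 0 \<le> b x" "\<And>x. b x \<le> 1" and "X \<subseteq> Vb" "\<And>x. x \<in> Vb \<Longrightarrow> b x = 1"
    and D: "compactin (mtop M) D" "D \<subseteq> U" "\<And>x. x \<notin> D \<Longrightarrow> b x = 0"
    using cutoff_exists[OF X U] by metis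
  have bX: "b x = 1" if "x \<in> X" for x using that \<open>X \<subseteq> Vb\<close> \<open>\<And>x. x \<in> Vb \<Longrightarrow> b x = 1\<close> by blast
  have dispD: "\<gamma> 1 \<notin> D" if "sol g {0..1} \<gamma>" "\<gamma> 0 \<in> D" for \<gamma> using dispU that D(2) by blast
  \<comment> \<open>Now the bump itself is the perturbation, and \<eta> is the strength that the
    displacement of \<open>D\<close> tolerates. \<open>D\<close> had to be fixed before this
    strength could be known.\<close>
  have "\<exists>U \<eta>. openin (mtop M) U \<and> D \<subseteq> U \<and> \<eta> > 0 \<and>
    (\<forall>s x. \<bar>s\<bar> \<le> \<eta> \<longrightarrow> sol (\<lambda>t p. g t p + s * b p) {0..1} x \<longrightarrow> x 0 \<in> U \<longrightarrow> x 1 \<notin> U)"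
    by (rule robust_displacement[where h = g and C = C0 and \<beta> = b and D = D])
      (fact g C0(1) gC b D(1) dispD)+
  then obtain U2 \<eta> where U2: "D \<subseteq> U2" and \<eta>: "\<eta> > 0"
    "\<forall>s x. \<bar>s\<bar> \<le> \<eta> \<longrightarrow> sol (\<lambda>t p. g t p + s * b p) {0..1} x \<longrightarrow> x 0 \<in> U2 \<longrightarrow> x 1 \<notin> U2"
    by (elim exE conjE) (rule that)
  define C where "C = C0 \<union> D"
  have C: "compactin (mtop M) C" unfolding C_def by (rule compactin_Un[OF C0(1) D(1)])
  obtain th V Kt where th: "msmooth th" and th1: "\<And>x. th x \<le> 1" and V: "openin (mtop M) V" "C \<subseteq> V" "\<And>x. x \<in> V \<Longrightarrow> th x = 1"
    and Kt: "compactin (mtop M) Kt" "\<And>x. x \<notin> Kt \<Longrightarrow> th x = 0"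
    using cutoff_exists[OF C openin_topspace compactin_subset_topspace[OF C]] by metis
  define k1 where "k1 = K + B0"
  have k1: "k1 > 0" using K B0(2) by (simp add: k1_def)
  \<comment> \<open>The bound 1/2 keeps \<epsilon> below 1; the second bound gives \<epsilon> s k1
    \<le> \<eta> for all s in [0, 1]; the third makes the advance of the angle on the plateau, at
    most |\<Lambda>| k1 \<epsilon>, smaller than 1.\<close>
  define \<epsilon> where "\<epsilon> = min (1/2) (min (\<eta> / k1) (1 / (2 * (\<bar>\<Lambda>\<bar> + 1) * k1)))"
  have \<epsilon>: "0 < \<epsilon>" "\<epsilon> < 1" using k1 \<eta>(1) by (auto simp: \<epsilon>_def)
  have \<epsilon>\<eta>: "\<epsilon> * k1 \<le> \<eta>"
  proof -
    have "\<epsilon> \<le> \<eta> / k1" by (simp add: \<epsilon>_def)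
    then show ?thesis using k1 by (simp add: pos_le_divide_eq)
  qed
  have \<epsilon>\<Lambda>: "\<bar>\<Lambda>\<bar> * k1 * \<epsilon> < 1"
  proof -
    have "\<epsilon> \<le> 1 / (2 * (\<bar>\<Lambda>\<bar> + 1) * k1)" by (simp add: \<epsilon>_def)
    then have "\<bar>\<Lambda>\<bar> * k1 * \<epsilon> \<le> \<bar>\<Lambda>\<bar> * k1 * (1 / (2 * (\<bar>\<Lambda>\<bar> + 1) * k1))" using k1 by (intro mult_left_mono) auto
    also have "\<dots> = \<bar>\<Lambda>\<bar> / (2 * (\<bar>\<Lambda>\<bar> + 1))" using k1 by simp
    also have "\<dots> < 1" by (simp add: divide_less_eq)
    finally show ?thesis .
  qed
  obtain a A where a: "smooth_on UNIV a" and A: "smooth_on UNIV A" and daA: "\<forall>t. (a has_real_derivative A t) (at t)"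
    and per: "\<forall>s t. s - t \<in> \<int> \<longrightarrow> A s = A t \<and> a s - a t \<in> \<int>"
    and aA: "\<forall>t\<in>{0..1}. a t = Q (t / \<epsilon>) \<and> A t = Q' (t / \<epsilon>) / \<epsilon>"
    and AQ: "\<forall>t. \<exists>s. A t = Q' s / \<epsilon>"
    by (rule reparametrization_exists[OF \<epsilon> dQ sQ Q0 Q1 Q'0], assumption, assumption, assumption, rule that)
  note daA = daA[rule_format]
  have per: "A s = A t" "a s - a t \<in> \<int>" if "s - t \<in> \<int>" for s t using per that by blast+
  have aA: "a t = Q (t / \<epsilon>)" "A t = Q' (t / \<epsilon>) / \<epsilon>" if "t \<in> {0..1}" for t using aA that by blast+
  have A0: "0 \<le> A t" for t
  proof -
    obtain s where "A t = Q' s / \<epsilon>" using AQ by blast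
    then show ?thesis using Q'p[of s] \<epsilon>(1) by simp
  qed
  have a01: "a 0 = 0" "a 1 = 1" using aA(1)[of 0] aA(1)[of 1] Q0[of 0] Q1[of "1/\<epsilon>"] \<epsilon> by auto
  have Ca: "compactin (mtop M) (Kt \<union> C)" by (rule compactin_Un[OF Kt(1) C])
  have "\<exists>F\<in>Cc_smooth (prod_mfd circle_mfd (prod_mfd M (cotangent_mfd R))).
    \<forall>t x p q. F (circle_of t, (x, (p, q))) =
      lam p * (k1 * b x + B0 * (A t - 1) * th x) + chi p * (A t * lift_ham H (a t) x)"
    by (rule product_hamiltonian_Cc_smooth[where lam = lam and chi = chi and b = b and th = th and a = a and A = A
        and C = "Kt \<union> C" and Kp = Kp, OF H lam chi Kp(1,2) _ b th Ca _ _ a A])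
      (use D(3) Kt(2) C0(2) Kp(3) per in \<open>auto simp: C_def h_def\<close>)
  then obtain F where F: "F \<in> Cc_smooth (prod_mfd circle_mfd (prod_mfd M (cotangent_mfd R)))"
    and Feq: "\<And>t x p q. F (circle_of t, (x, (p, q))) = lam p * (k1 * b x + B0 * (A t - 1) * th x) + chi p * (A t * h (a t) x)"
    unfolding h_def by blast
  have large: "K \<le> F (\<theta>, (x, (0, q)))" if x: "x \<in> X" for \<theta> x q
  proof -
    obtain t where t: "\<theta> = circle_of t" using circle_of_surj by metis
    have "x \<in> D" using D(3)[of x] bX[OF x] by auto
    then have "th x = 1" using V by (auto simp: C_def)
    \<comment> \<open>The two parts of the compensation combine: k1 + B0 (A t - 1) = K + A t B0, and
      A t \<ge> 0 multiplies B0 + h, which is nonnegative.\<close>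
    then have "F (\<theta>, (x, (0, q))) = K + A t * (B0 + h (a t) x)"
      unfolding t Feq lc0 bX[OF x] by (simp add: k1_def algebra_simps)
    moreover have "0 \<le> B0 + h (a t) x" using B0(1)[of "a t" x] by linarith
    ultimately show ?thesis using A0[of t] by simp
  qed
  have "False" if zin: "z \<in> periodic_orbits (prod_mfd M (cotangent_mfd R)) (sum_symplectic M \<omega> (cotangent_mfd R) omega0) F (loop_class M R e)" for z
  proof -
    define \<zeta> where "\<zeta> t = z (circle_of t)" for t
    have zl: "z \<in> loop_class M R e"
      and zh: "ham_curve (prod_mfd M (cotangent_mfd R)) (sum_symplectic M \<omega> (cotangent_mfd R) omega0) F \<zeta>"
      using zin by (simp_all add: periodic_orbits_def \<zeta>_def[abs_def] o_def)
    define f1 where "f1 t x = k1 * b x + B0 * (A t - 1) * th x" for t x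
    define f2 where "f2 t x = A t * h (a t) x" for t x
    have f2: "msmooth (f2 t)" for t unfolding f2_def by (rule tsmooth_msmooth[OF tsmooth_rescale[OF h a A]])
    have f1: "msmooth (f1 t)" for t unfolding f1_def using b th unfolding msmooth_def o_def
      by (auto intro!: smooth_on_add smooth_on_mult smooth_on_const open_chart_image)
    have dl: "(lam has_derivative frechet_derivative lam (at p)) (at p)" for p
      using smooth_on_differentiable[OF lam UNIV_I] frechet_derivative_works by blast
    have dc: "(chi has_derivative frechet_derivative chi (at p)) (at p)" for p
      using smooth_on_differentiable[OF chi UNIV_I] frechet_derivative_works by blast
    define x where "x t = fst (\<zeta> t)" for t
    define q where "q t = snd (snd (\<zeta> t))" for t
    have "F (circle_of t, (x, (p, q))) = lam p * f1 t x + chi p * f2 t x" for t x p q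
      unfolding Feq f1_def f2_def ..
    from ham_curve_product[OF zh this f1 f2 dl dc]
    obtain p0 where xs: "sol (\<lambda>t x. lam p0 * f1 t x + chi p0 * f2 t x) UNIV x"
      and qc: "continuous_on UNIV q"
      and qd: "\<And>t a. q t \<in> torus_of ` unit_box a \<Longrightarrow> ((\<lambda>s. inv_into (unit_box a) torus_of (q s) $ k) has_real_derivative
        frechet_derivative lam (at p0) (axis k 1) * f1 t (x t) + frechet_derivative chi (at p0) (axis k 1) * f2 t (x t)) (at t)"
      unfolding x_def[symmetric] q_def[symmetric] by blast
    define Dl where "Dl = frechet_derivative lam (at p0) (axis k 1)"
    define Dc where "Dc = frechet_derivative chi (at p0) (axis k 1)"
    define u where "u t = Dl * f1 t (x t) + Dc * f2 t (x t)" for t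
    have xc: "continuous_map euclideanreal (mtop M) x" using sol_continuous[OF xs] by simp
    have uc: "continuous_on UNIV u"
    proof -
      have "continuous_on UNIV (\<lambda>t. b (x t))" "continuous_on UNIV (\<lambda>t. th (x t))"
        using continuous_map_compose[OF xc msmooth_continuous[OF b]] continuous_map_compose[OF xc msmooth_continuous[OF th]]
        by (simp_all add: o_def)
      moreover have "continuous_on UNIV (\<lambda>t. h (a t) (x t))"
      proof -
        have "continuous_map euclideanreal (prod_topology euclideanreal (mtop M)) (\<lambda>t. (a t, x t))"
          using smooth_on_continuous[OF a] by (intro continuous_map_pairedI xc) simp
        from continuous_map_compose[OF this lift_ham_continuous[OF H]] show ?thesis by (simp add: o_def h_def)
      qed
      ultimately show ?thesis unfolding u_def f1_def f2_def
        by (intro continuous_intros smooth_on_continuous[OF A])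
    qed
    obtain L where L: "\<And>t. (L has_real_derivative u t) (at t)" "\<And>t. q t $ k = circle_of (L t)"
      using torus_curve_lift[OF qc uc, of k] qd unfolding u_def Dl_def Dc_def by blast
    have Lc: "continuous_on UNIV L" using DERIV_isCont[OF L(1)] by (simp add: continuous_at_imp_continuous_on)
    have "homotopic_with (\<lambda>_. True) euclidean (euclidean :: (circle ^ 'n) topology) (\<lambda>t. snd (snd (z t))) (\<lambda>t. \<chi> i. circle_mult (e $ i) t)"
      using zl by (simp add: loop_class_def torus_mfd_def)
    moreover have "continuous_map (euclidean :: (circle ^ 'n) topology) euclidean (\<lambda>v. v $ k)"
      by (simp add: continuous_on_component)
    ultimately have "homotopic_with (\<lambda>_. True) euclidean euclidean ((\<lambda>v. v $ k) \<circ> (\<lambda>t. snd (snd (z t)))) ((\<lambda>v. v $ k) \<circ> (\<lambda>t. \<chi> i. circle_mult (e $ i) t))"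
      by (rule homotopic_with_compose_continuous_map_left) simp
    then have hom: "homotopic_with (\<lambda>_. True) euclidean euclidean (\<lambda>t. snd (snd (z t)) $ k) (circle_mult (e $ k))"
      by (simp add: o_def)
    have deg: "L 1 - L 0 = of_int (e $ k)"
      by (rule circle_loop_degree[OF Lc _ hom]) (use L(2) in \<open>simp add: q_def \<zeta>_def\<close>)
    have "circle_of 0 = circle_of 1" by (simp add: circle_of_eq_iff)
    then have closed: "x 0 = x 1" by (simp add: x_def \<zeta>_def)
    have "\<bar>L 1 - L 0\<bar> < real_of_int \<bar>e $ k\<bar>"
    proof (cases "norm p0 < 2 * \<delta>")
      case False
      have Dl0: "Dl = 0" unfolding Dl_def
        by (rule smooth_deriv_zero[of "- cball 0 \<delta>" _ _ 0]) (use False \<delta> lam0 in auto)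
      \<comment> \<open>The bound is the increment of \<sigma> Mf along the slow time, which runs
        from 0 to 1; so the compression of time does not show in it, and the total is \<sigma> times
        the Hofer length.\<close>
      have "\<bar>L 1 - L 0\<bar> \<le> \<sigma> * Mf (a 1) - \<sigma> * Mf (a 0)"
      proof (rule DERIV_abs_increment_le[of 0 1, OF _ L(1)])
        show "((\<lambda>t. \<sigma> * Mf (a t)) has_real_derivative \<sigma> * (m (a t) * A t)) (at t)" for t
          by (intro DERIV_cmult DERIV_chain2[OF Mf daA])
        fix t
        have "\<bar>u t\<bar> = \<bar>Dc\<bar> * (A t * \<bar>h (a t) (x t)\<bar>)" using A0[of t] by (simp add: u_def Dl0 f2_def abs_mult)
        also have "\<dots> \<le> \<sigma> * (A t * m (a t))"
          using \<sigma>(1) \<sigma>(3)[rule_format, of p0] A0 hm unfolding Dc_def by (intro mult_mono mult_left_mono mult_nonneg_nonneg) auto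
        finally show "\<bar>u t\<bar> \<le> \<sigma> * (m (a t) * A t)" by (simp add: mult.commute)
      qed simp
      also have "\<dots> = \<sigma> * G" by (simp add: a01 MfG[symmetric] algebra_simps)
      finally show ?thesis using \<sigma>(2) by simp
    next
      case True
      have chi1': "chi p0 = 1" by (rule chi1[rule_format, OF True])
      have Dc0: "Dc = 0" unfolding Dc_def
        by (rule smooth_deriv_zero[of "ball 0 (2 * \<delta>)" _ _ 1]) (use True chi1 in auto)
      define s where "s = lam p0"
      have s: "0 \<le> s" "s \<le> 1" using lam01[rule_format, of p0] by (simp_all add: s_def)
      have xs': "sol (\<lambda>t p. s * (k1 * b p + B0 * (A t - 1) * th p) + 1 * (A t * h (a t) p)) UNIV x"
        using xs unfolding chi1' f1_def f2_def s_def .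
      have "\<bar>\<epsilon> * s * k1\<bar> \<le> \<eta>"
      proof -
        have "\<epsilon> * s * k1 \<le> \<epsilon> * 1 * k1" using s \<epsilon> k1 by (intro mult_right_mono mult_left_mono) auto
        moreover have "0 \<le> \<epsilon> * s * k1" using s \<epsilon> k1 by simp
        ultimately show ?thesis using \<epsilon>\<eta> by linarith
      qed
      then have dispy: "y 1 \<notin> D" if "sol (\<lambda>t p. Q' t * h (Q t) p + \<epsilon> * s * k1 * b p) {0..1} y" "y 0 \<in> D" for y
        using \<eta>(2)[rule_format, of "\<epsilon> * s * k1" y] that U2 unfolding g_def by blast
      have Ccl: "closedin (mtop M) C" by (rule compactin_imp_closedin[OF Hausdorff C])
      have bC: "p \<notin> C \<Longrightarrow> b p = 0" and hC: "p \<notin> C \<Longrightarrow> h t p = 0" for t p using D(3) C0(2) by (auto simp: C_def)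
      have DC: "D \<subseteq> C" by (simp add: C_def)
      have Q'1: "x \<ge> 1 \<Longrightarrow> Q' x = 0" for x using Q'0 by blast
      have thx: "th (x t) = th (x 0)" for t
        by (rule closed_orbit_avoids_bump(1)[where h = h and b = b and th = th and a = a and A = A and Q = Q and Q' = Q'
            and \<epsilon> = \<epsilon> and C = C and V = V and D = D and s = s and ?k1.0 = k1 and ?k2.0 = B0 and x = x])
          (fact h b th a A \<epsilon> aA Q'1 sQ Ccl bC hC V th1 D(3) DC dispy xs' closed)+
      have bx: "b (x t) = 0" if "\<epsilon> \<le> t" "t \<le> 1" for t
        by (rule closed_orbit_avoids_bump(2)[where h = h and b = b and th = th and a = a and A = A and Q = Q and Q' = Q'
            and \<epsilon> = \<epsilon> and C = C and V = V and D = D and s = s and ?k1.0 = k1 and ?k2.0 = B0 and x = x])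
          (fact h b th a A \<epsilon> aA Q'1 sQ Ccl bC hC V th1 D(3) DC dispy xs' closed that)+
      \<comment> \<open>Since \<open>th\<close> is constant along the orbit, its contribution to the
        angular velocity is r (A t - 1), with primitive r (a t - t) vanishing at 0 and at 1.
        Subtracting it leaves the part due to \<open>b\<close> without changing the total
        advance.\<close>
      define r where "r = Dl * B0 * th (x 0)"
      define N where "N t = L t - r * (a t - t)" for t
      have N: "(N has_real_derivative Dl * k1 * b (x t)) (at t)" for t
      proof -
        have "(N has_real_derivative u t - r * (A t - 1)) (at t)"
          unfolding N_def by (intro DERIV_diff L(1) DERIV_cmult daA DERIV_ident)
        moreover have "u t - r * (A t - 1) = Dl * k1 * b (x t)"
          by (simp add: u_def Dc0 f1_def r_def thx[of t] algebra_simps)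
        ultimately show ?thesis by simp
      qed
      have "\<bar>N \<epsilon> - N 0\<bar> \<le> \<bar>\<Lambda>\<bar> * k1 * \<epsilon> - \<bar>\<Lambda>\<bar> * k1 * 0"
      proof (rule DERIV_abs_increment_le[OF _ N])
        show "((\<lambda>t. \<bar>\<Lambda>\<bar> * k1 * t) has_real_derivative \<bar>\<Lambda>\<bar> * k1) (at t)" for t
          using DERIV_cmult[OF DERIV_ident, of "\<bar>\<Lambda>\<bar> * k1" t UNIV] by simp
        fix t
        have "\<bar>Dl\<bar> \<le> \<bar>\<Lambda>\<bar>" using \<Lambda>[rule_format, of p0] unfolding Dl_def by linarith
        then have "\<bar>Dl\<bar> * k1 * b (x t) \<le> \<bar>\<Lambda>\<bar> * k1 * 1"
          using k1 b01 by (intro mult_mono mult_right_mono) auto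
        then show "\<bar>Dl * k1 * b (x t)\<bar> \<le> \<bar>\<Lambda>\<bar> * k1" using k1 b01(1)[of "x t"] by (simp add: abs_mult)
      qed (use \<epsilon> in simp)
      \<comment> \<open>After time \<epsilon> the bump vanishes on the orbit, so nothing is added to
        the advance.\<close>
      moreover have "\<bar>N 1 - N \<epsilon>\<bar> \<le> 0 - 0"
        by (rule DERIV_abs_increment_le[OF _ N, where W = "\<lambda>_. 0" and w = "\<lambda>_. 0"]) (use \<epsilon> bx in auto)
      ultimately have "\<bar>N 1 - N 0\<bar> < 1" using \<epsilon>\<Lambda> by linarith
      moreover have "N 1 - N 0 = L 1 - L 0" by (simp add: N_def a01)
      ultimately show ?thesis using ek by linarith
    qed
    then show False unfolding deg by simp
  qed
  then show ?thesis using F large by blast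
qed

end

theorem proposition1p7:
  fixes M :: "('a, 'e::euclidean_space) mfd" and \<omega> :: "('a, 'e) form2"
    and X :: "'a set" and R :: "real ^ 'n" and e :: "int ^ 'n"
  assumes "symplectic_manifold M \<omega>" and "connected_space (mtop M)"
    and "compactin (mtop M) X" and "displaceable M \<omega> X"
    and "\<forall>i. R $ i > 0"
    and "\<exists>k. ereal (R $ k * real_of_int \<bar>e $ k\<bar>) > displacement_energy M \<omega> X"
  shows "C_torus M \<omega> X R e = \<infinity>"
proof -
  interpret symp_mfd M \<omega> by unfold_locales fact
  let ?N = "prod_mfd M (cotangent_mfd R)" and ?\<Omega> = "sum_symplectic M \<omega> (cotangent_mfd R) omega0"
  let ?Y = "X \<times> {0} \<times> (UNIV :: (circle ^ 'n) set)"
  have "\<exists>F\<in>Cc_smooth (prod_mfd circle_mfd ?N). (\<forall>\<theta> x q. x \<in> X \<longrightarrow> K \<le> F (\<theta>, (x, (0, q)))) \<and>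
      periodic_orbits ?N ?\<Omega> F (loop_class M R e) = {}" if "K > 0" for K
  \<comment> \<open>The empty manifold is split off because the sup norm is unspecified there; its
    loop class is empty, so already the zero Hamiltonian has no orbits in the class, and the lower
    bound over the empty \<open>X\<close> is vacuous.\<close>
  proof (cases "topspace (mtop M) = {}")
    case True
    have "z \<notin> loop_class M R e" for z
    proof
      assume "z \<in> loop_class M R e"
      then have "\<exists>m. m \<in> topspace (mtop M)" unfolding loop_class_def by blast
      then show False using True by blast
    qed
    then have "periodic_orbits ?N ?\<Omega> (\<lambda>_. 0) (loop_class M R e) = {}" unfolding periodic_orbits_def by blast
    moreover have "X = {}" using True compactin_subset_topspace[OF assms(3)] by blast
    ultimately show ?thesis using const_zero_Cc_smooth by blast
  next
    case False
    obtain k where "displacement_energy M \<omega> X < ereal (R $ k * real_of_int \<bar>e $ k\<bar>)" using assms(6) by blast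
    then obtain H where "H \<in> Cc_smooth (prod_mfd circle_mfd M)" "displaces M \<omega> H X"
      "hofer_length M H < R $ k * real_of_int \<bar>e $ k\<bar>"
      unfolding displacement_energy_def Inf_less_iff by auto
    from hamiltonian_without_orbits[OF this(1,2) assms(3) _ False this(3) that] assms(5) show ?thesis by blast
  qed
  note F = this
  \<comment> \<open>No K is admissible, so the capacity is the infimum of the empty set, which is
    \<infinity>.\<close>
  have "{ereal K | K. K > 0 \<and> (\<forall>H\<in>Cc_smooth (prod_mfd circle_mfd ?N).
      (INF x\<in>UNIV \<times> ?Y. ereal (H x)) \<ge> ereal K \<longrightarrow> periodic_orbits ?N ?\<Omega> H (loop_class M R e) \<noteq> {})} = {}"
  proof -
    have False if K: "K > 0" and all: "\<forall>H\<in>Cc_smooth (prod_mfd circle_mfd ?N).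
      (INF x\<in>UNIV \<times> ?Y. ereal (H x)) \<ge> ereal K \<longrightarrow> periodic_orbits ?N ?\<Omega> H (loop_class M R e) \<noteq> {}" for K
    proof -
      obtain F where F: "F \<in> Cc_smooth (prod_mfd circle_mfd ?N)" "\<And>\<theta> x q. x \<in> X \<Longrightarrow> K \<le> F (\<theta>, (x, (0, q)))"
        "periodic_orbits ?N ?\<Omega> F (loop_class M R e) = {}" using F[OF K] by blast
      have "ereal K \<le> (INF x\<in>UNIV \<times> ?Y. ereal (F x))"
        by (rule INF_greatest) (use F(2) in auto)
      then show False using all F(1,3) by blast
    qed
    then show ?thesis by blast
  qed
  then show ?thesis unfolding C_torus_def C_BPS_def by (simp only: Inf_empty top_ereal_def)
qed

end
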